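(* The Diophantine problem for spherical equations over the class of groups $\{\mathbb{Z}^n\wr\mathbb{Z}_2\}_{n\in\mathbb{N}}$ is $\mathbf{NP}$-hard. That is, the following problem is $\mathbf{NP}$-hard: given $n\in\mathbb{N}$, $m\ge 1$ and $c_1,\dots,c_m\in\mathbb{Z}^n\wr\mathbb{Z}_2$, decide whether there exist $z_1,\dots,z_m\in\mathbb{Z}^n\wr\mathbb{Z}_2$ such that $\prod_{j=1}^m z_j^{-1}c_jz_j=1$.
   Context: Wreath product: for finitely generated abelian groups $A,B$ (written additively), $A^B$ is the group of finitely supported functions $f\colon B\to A$ under pointwise addition; for $f\in A^B$, $b\in B$ put $f^b(x)=f(b+x)$. Then $A\wr B=B\ltimes A^B$ with multiplication $(\delta_1,f_1)(\delta_2,f_2)=(\delta_1+\delta_2,\,f_1^{\delta_2}+f_2)$. An element $a\in A$ is identified with $(0,f)$, where $f(0)=a$ and $f(x)=0$ for $x\ne 0$; an element $b\in B$ is identified with $(b,0)$. Generators of $A$ and of $B$ together generate $A\wr B$. Representation: $\mathbb{Z}_2$ is the cyclic group of order $2$; $n$ is given in unary; the $c_j$ are given as words in the standard generators of $\mathbb{Z}^n$ and $\mathbb{Z}_2$ and their inverses; the input size is $n$ plus the total length of the equation. $\mathbf{NP}$-hardness is with respect to polynomial-time many-one reductions. *)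

theory Defs
  imports
    "HOL-Algebra.Elementary_Groups"
    "HOL-Algebra.Product_Groups"
    "HOL-Computational_Algebra.Polynomial"
begin

section \<open>Turing machines, polynomial time and NP\<close>

text \<open>
  Deterministic multi-tape machines with two-way infinite tapes. Tape symbols are numbers:
  0 is the blank, 1 and 2 stand for the input bits False and True, larger numbers are auxiliary
  symbols. A tape consists of its contents and the head position.
\<close>

datatype direction = Left | Stay | Right

fun shift :: "direction \<Rightarrow> int" where
  "shift Left = -1"
| "shift Stay = 0"
| "shift Right = 1"

type_synonym tape = "(int \<Rightarrow> nat) \<times> int"
type_synonym config = "nat \<times> tape list"

text \<open>
  The states are \<open>0, \<dots>, num_states\<close>; the computation starts in state 0 and halts in state
  \<open>num_states\<close>. The transition function maps a non-halting state and the scanned symbols to the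
  next state and, for each tape, the symbol to be written and the head movement. For a
  well-formed machine only its restriction to a finite set of arguments is ever used.
\<close>

record turing_machine =
  num_tapes :: nat
  num_states :: nat
  num_symbols :: nat
  transition :: "nat \<Rightarrow> nat list \<Rightarrow> nat \<times> (nat \<times> direction) list"

definition well_formed :: "turing_machine \<Rightarrow> bool" where
  "well_formed M \<longleftrightarrow>
     num_tapes M \<ge> 1 \<and> num_symbols M \<ge> 3 \<and>
     (\<forall>q < num_states M. \<forall>ss. length ss = num_tapes M \<and> set ss \<subseteq> {..<num_symbols M} \<longrightarrow>
        (case transition M q ss of (q', as) \<Rightarrow>
           q' \<le> num_states M \<and> length as = num_tapes M \<and> fst ` set as \<subseteq> {..<num_symbols M}))"

fun scanned :: "tape \<Rightarrow> nat" where
  "scanned (c, i) = c i"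

fun update_tape :: "tape \<Rightarrow> nat \<times> direction \<Rightarrow> tape" where
  "update_tape (c, i) (s, d) = (c(i := s), i + shift d)"

fun step :: "turing_machine \<Rightarrow> config \<Rightarrow> config" where
  "step M (q, tps) =
     (if q < num_states M
      then let (q', as) = transition M q (map scanned tps) in (q', map2 update_tape tps as)
      else (q, tps))"

definition contents :: "bool list \<Rightarrow> int \<Rightarrow> nat" where
  "contents x i =
     (if 0 \<le> i \<and> nat i < length x then (if x ! nat i then 2 else 1) else 0)"

text \<open>
  The inputs are written on the first tapes, starting at cell 0, and the remaining tapes are
  blank. The output is the whole contents of the first tape on halting.
\<close>

definition initial_config :: "turing_machine \<Rightarrow> bool list list \<Rightarrow> config" where
  "initial_config M xs =
     (0, map (\<lambda>j. (contents (if j < length xs then xs ! j else []), 0)) [0..<num_tapes M])"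

definition halts_with_output :: "turing_machine \<Rightarrow> bool list list \<Rightarrow> nat \<Rightarrow> bool list \<Rightarrow> bool" where
  "halts_with_output M xs t y \<longleftrightarrow>
     (case (step M ^^ t) (initial_config M xs) of (q, tps) \<Rightarrow>
        q = num_states M \<and> fst (tps ! 0) = contents y)"

text \<open>Functions of \<open>k\<close> words computable in time polynomial in the total length of the inputs.\<close>

definition poly_time_computable :: "nat \<Rightarrow> (bool list list \<Rightarrow> bool list) \<Rightarrow> bool" where
  "poly_time_computable k f \<longleftrightarrow>
     (\<exists>M (p :: nat poly). well_formed M \<and> k \<le> num_tapes M \<and>
        (\<forall>xs. length xs = k \<longrightarrow>
           (\<exists>t \<le> poly p (sum_list (map length xs)). halts_with_output M xs t (f xs))))"

text \<open>NP in terms of polynomial-time verifiers \<open>R\<close> and certificates \<open>u\<close> of polynomial length.\<close>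

definition NP :: "bool list set set" where
  "NP = {L. \<exists>R (p :: nat poly).
           poly_time_computable 2 (\<lambda>xs. [R (xs ! 0) (xs ! 1)]) \<and>
           (\<forall>x. x \<in> L \<longleftrightarrow> (\<exists>u. length u \<le> poly p (length x) \<and> R x u))}"

definition poly_time_reducible :: "bool list set \<Rightarrow> bool list set \<Rightarrow> bool" where
  "poly_time_reducible L L' \<longleftrightarrow>
     (\<exists>f. poly_time_computable 1 (\<lambda>xs. f (xs ! 0)) \<and> (\<forall>x. x \<in> L \<longleftrightarrow> f x \<in> L'))"

definition NP_hard :: "bool list set \<Rightarrow> bool" where
  "NP_hard L \<longleftrightarrow> (\<forall>L' \<in> NP. poly_time_reducible L' L)"


section \<open>Wreath products\<close>

definition wreath :: "('a, 'm) monoid_scheme \<Rightarrow> ('b, 'n) monoid_scheme \<Rightarrow> ('b \<times> ('b \<Rightarrow> 'a)) monoid"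
  where
  "wreath A B =
     \<lparr>carrier = carrier B \<times>
        {f \<in> carrier B \<rightarrow>\<^sub>E carrier A. finite {x \<in> carrier B. f x \<noteq> \<one>\<^bsub>A\<^esub>}},
      monoid.mult = (\<lambda>(d1, f1) (d2, f2).
        (d1 \<otimes>\<^bsub>B\<^esub> d2, \<lambda>x\<in>carrier B. f1 (d2 \<otimes>\<^bsub>B\<^esub> x) \<otimes>\<^bsub>A\<^esub> f2 x)),
      one = (\<one>\<^bsub>B\<^esub>, \<lambda>x\<in>carrier B. \<one>\<^bsub>A\<^esub>)\<rparr>"

definition wreath_base ::
    "('a, 'm) monoid_scheme \<Rightarrow> ('b, 'n) monoid_scheme \<Rightarrow> 'a \<Rightarrow> 'b \<times> ('b \<Rightarrow> 'a)" where
  "wreath_base A B a = (\<one>\<^bsub>B\<^esub>, \<lambda>x\<in>carrier B. if x = \<one>\<^bsub>B\<^esub> then a else \<one>\<^bsub>A\<^esub>)"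

definition wreath_top ::
    "('a, 'm) monoid_scheme \<Rightarrow> ('b, 'n) monoid_scheme \<Rightarrow> 'b \<Rightarrow> 'b \<times> ('b \<Rightarrow> 'a)" where
  "wreath_top A B b = (b, \<lambda>x\<in>carrier B. \<one>\<^bsub>A\<^esub>)"

lemma group_wreath:
  assumes "comm_group A" "comm_group B"
  shows "group (wreath A B)"
proof -
  interpret A: comm_group A by fact
  interpret B: comm_group B by fact
  have shift_supp: "finite {x \<in> carrier B. f (d \<otimes>\<^bsub>B\<^esub> x) \<noteq> \<one>\<^bsub>A\<^esub>}"
    if d: "d \<in> carrier B" and fin: "finite {x \<in> carrier B. f x \<noteq> \<one>\<^bsub>A\<^esub>}" for d f
  proof (rule finite_subset)
    show "{x \<in> carrier B. f (d \<otimes>\<^bsub>B\<^esub> x) \<noteq> \<one>\<^bsub>A\<^esub>} \<subseteq>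
        (\<lambda>y. inv\<^bsub>B\<^esub> d \<otimes>\<^bsub>B\<^esub> y) ` {x \<in> carrier B. f x \<noteq> \<one>\<^bsub>A\<^esub>}"
    proof
      fix x assume x: "x \<in> {x \<in> carrier B. f (d \<otimes>\<^bsub>B\<^esub> x) \<noteq> \<one>\<^bsub>A\<^esub>}"
      then have "x = inv\<^bsub>B\<^esub> d \<otimes>\<^bsub>B\<^esub> (d \<otimes>\<^bsub>B\<^esub> x)"
        using d by (simp add: B.m_assoc [symmetric])
      then show "x \<in> (\<lambda>y. inv\<^bsub>B\<^esub> d \<otimes>\<^bsub>B\<^esub> y) ` {x \<in> carrier B. f x \<noteq> \<one>\<^bsub>A\<^esub>}"
        using x d by blast
    qed
  qed (use fin in simp)
  show ?thesis
  proof (rule groupI)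
    fix u v assume "u \<in> carrier (wreath A B)" "v \<in> carrier (wreath A B)"
    then obtain d f e g where uv: "u = (d, f)" "v = (e, g)"
      and car: "d \<in> carrier B" "e \<in> carrier B" "f \<in> carrier B \<rightarrow>\<^sub>E carrier A"
        "g \<in> carrier B \<rightarrow>\<^sub>E carrier A"
      and fin: "finite {x \<in> carrier B. f x \<noteq> \<one>\<^bsub>A\<^esub>}" "finite {x \<in> carrier B. g x \<noteq> \<one>\<^bsub>A\<^esub>}"
      by (cases u; cases v) (auto simp: wreath_def)
    let ?h = "\<lambda>x\<in>carrier B. f (e \<otimes>\<^bsub>B\<^esub> x) \<otimes>\<^bsub>A\<^esub> g x"
    have "{x \<in> carrier B. ?h x \<noteq> \<one>\<^bsub>A\<^esub>} \<subseteq>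
        {x \<in> carrier B. f (e \<otimes>\<^bsub>B\<^esub> x) \<noteq> \<one>\<^bsub>A\<^esub>} \<union> {x \<in> carrier B. g x \<noteq> \<one>\<^bsub>A\<^esub>}"
      by auto
    then have "finite {x \<in> carrier B. ?h x \<noteq> \<one>\<^bsub>A\<^esub>}"
      using shift_supp [OF car(2) fin(1)] fin(2) finite_subset by blast
    moreover have "?h \<in> carrier B \<rightarrow>\<^sub>E carrier A"
      using car by (simp add: restrict_PiE_iff PiE_iff)
    ultimately show "u \<otimes>\<^bsub>wreath A B\<^esub> v \<in> carrier (wreath A B)"
      using car by (simp add: uv wreath_def)
  next
    show "\<one>\<^bsub>wreath A B\<^esub> \<in> carrier (wreath A B)"
      by (auto simp: wreath_def)
  next
    fix u v w assume "u \<in> carrier (wreath A B)" "v \<in> carrier (wreath A B)"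
      "w \<in> carrier (wreath A B)"
    then obtain d f e g k h where uvw: "u = (d, f)" "v = (e, g)" "w = (k, h)"
      and car: "d \<in> carrier B" "e \<in> carrier B" "k \<in> carrier B" "f \<in> carrier B \<rightarrow> carrier A"
        "g \<in> carrier B \<rightarrow> carrier A" "h \<in> carrier B \<rightarrow> carrier A"
      by (cases u; cases v; cases w) (auto simp: wreath_def PiE_def)
    have "f (e \<otimes>\<^bsub>B\<^esub> (k \<otimes>\<^bsub>B\<^esub> x)) \<otimes>\<^bsub>A\<^esub> g (k \<otimes>\<^bsub>B\<^esub> x) \<otimes>\<^bsub>A\<^esub> h x =
        f (e \<otimes>\<^bsub>B\<^esub> k \<otimes>\<^bsub>B\<^esub> x) \<otimes>\<^bsub>A\<^esub> (g (k \<otimes>\<^bsub>B\<^esub> x) \<otimes>\<^bsub>A\<^esub> h x)"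
      if "x \<in> carrier B" for x
      using car that by (simp add: B.m_assoc A.m_assoc Pi_iff)
    then show "u \<otimes>\<^bsub>wreath A B\<^esub> v \<otimes>\<^bsub>wreath A B\<^esub> w =
        u \<otimes>\<^bsub>wreath A B\<^esub> (v \<otimes>\<^bsub>wreath A B\<^esub> w)"
      using car by (simp add: uvw wreath_def B.m_assoc cong: restrict_cong)
  next
    fix u assume "u \<in> carrier (wreath A B)"
    then show "\<one>\<^bsub>wreath A B\<^esub> \<otimes>\<^bsub>wreath A B\<^esub> u = u"
      by (cases u) (auto simp: wreath_def PiE_iff extensional_def fun_eq_iff)
  next
    fix u assume "u \<in> carrier (wreath A B)"
    then obtain d f where u: "u = (d, f)"
      and car: "d \<in> carrier B" "f \<in> carrier B \<rightarrow>\<^sub>E carrier A"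
      and fin: "finite {x \<in> carrier B. f x \<noteq> \<one>\<^bsub>A\<^esub>}"
      by (cases u) (auto simp: wreath_def)
    let ?g = "\<lambda>x\<in>carrier B. inv\<^bsub>A\<^esub> (f (inv\<^bsub>B\<^esub> d \<otimes>\<^bsub>B\<^esub> x))"
    have f: "f x \<in> carrier A" if "x \<in> carrier B" for x
      using that car by auto
    have "finite {x \<in> carrier B. ?g x \<noteq> \<one>\<^bsub>A\<^esub>}"
      by (rule finite_subset [OF _ shift_supp [OF _ fin, of "inv\<^bsub>B\<^esub> d"]])
        (use car in auto)
    then have "(inv\<^bsub>B\<^esub> d, ?g) \<in> carrier (wreath A B)"
      using car f by (auto simp: wreath_def)
    moreover have "(inv\<^bsub>B\<^esub> d, ?g) \<otimes>\<^bsub>wreath A B\<^esub> u = \<one>\<^bsub>wreath A B\<^esub>"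
      using car f by (auto simp: wreath_def u B.m_assoc [symmetric] intro!: restrict_ext)
    ultimately show "\<exists>v \<in> carrier (wreath A B). v \<otimes>\<^bsub>wreath A B\<^esub> u = \<one>\<^bsub>wreath A B\<^esub>"
      by blast
  qed
qed

definition free_abelian_power :: "nat \<Rightarrow> (nat \<Rightarrow> int) monoid" where
  "free_abelian_power n = product_group {..<n} (\<lambda>_. integer_group)"

definition unit_vector :: "nat \<Rightarrow> nat \<Rightarrow> nat \<Rightarrow> int" where
  "unit_vector n i = (\<lambda>j\<in>{..<n}. if j = i then 1 else 0)"

abbreviation Zn_wr_Z2 :: "nat \<Rightarrow> (int \<times> (int \<Rightarrow> nat \<Rightarrow> int)) monoid" where
  "Zn_wr_Z2 n \<equiv> wreath (free_abelian_power n) (integer_mod_group 2)"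

lemma group_Zn_wr_Z2: "group (Zn_wr_Z2 n)"
proof (rule group_wreath)
  show "comm_group (free_abelian_power n)"
    unfolding free_abelian_power_def
    by (rule group.group_comm_groupI) (simp_all add: add.commute)
qed simp


section \<open>Spherical equations\<close>

definition list_prod :: "('a, 'm) monoid_scheme \<Rightarrow> 'a list \<Rightarrow> 'a" where
  "list_prod G xs = foldr (\<otimes>\<^bsub>G\<^esub>) xs \<one>\<^bsub>G\<^esub>"

definition spherical_solvable :: "('a, 'm) monoid_scheme \<Rightarrow> 'a list \<Rightarrow> bool" where
  "spherical_solvable G cs \<longleftrightarrow>
     (\<exists>zs. length zs = length cs \<and> set zs \<subseteq> carrier G \<and>
        list_prod G (map2 (\<lambda>z c. inv\<^bsub>G\<^esub> z \<otimes>\<^bsub>G\<^esub> c \<otimes>\<^bsub>G\<^esub> z) zs cs) = \<one>\<^bsub>G\<^esub>)"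

text \<open>
  Letters of words over the standard generators: \<open>Base i s\<close> stands for the \<open>i\<close>-th standard
  generator of $\mathbb{Z}^n$ and \<open>Top s\<close> for the generator of $\mathbb{Z}_2$. The letter denotes
  the inverse of the generator if \<open>s\<close> holds.
\<close>

datatype letter = Base nat bool | Top bool

fun valid_letter :: "nat \<Rightarrow> letter \<Rightarrow> bool" where
  "valid_letter n (Base i s) \<longleftrightarrow> i < n"
| "valid_letter n (Top s) \<longleftrightarrow> True"

fun letter_value :: "nat \<Rightarrow> letter \<Rightarrow> int \<times> (int \<Rightarrow> nat \<Rightarrow> int)" where
  "letter_value n (Base i s) =
     (let g = wreath_base (free_abelian_power n) (integer_mod_group 2) (unit_vector n i)
      in if s then inv\<^bsub>Zn_wr_Z2 n\<^esub> g else g)"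
| "letter_value n (Top s) =
     (let g = wreath_top (free_abelian_power n) (integer_mod_group 2) 1
      in if s then inv\<^bsub>Zn_wr_Z2 n\<^esub> g else g)"

definition word_value :: "nat \<Rightarrow> letter list \<Rightarrow> int \<times> (int \<Rightarrow> nat \<Rightarrow> int)" where
  "word_value n w = list_prod (Zn_wr_Z2 n) (map (letter_value n) w)"

text \<open>
  Binary encoding of instances. The rank and the indices of the generators are written in unary;
  each letter of a word and each word of an equation is preceded by True, and False marks the
  end. As indices are smaller than the rank, the length of the code is polynomially related to
  the rank plus the total length of the equation.
\<close>

fun encode_nat :: "nat \<Rightarrow> bool list" where
  "encode_nat n = replicate n True @ [False]"

fun encode_letter :: "letter \<Rightarrow> bool list" where
  "encode_letter (Base i s) = False # s # encode_nat i"
| "encode_letter (Top s) = [True, s]"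

fun encode_list :: "('a \<Rightarrow> bool list) \<Rightarrow> 'a list \<Rightarrow> bool list" where
  "encode_list enc [] = [False]"
| "encode_list enc (x # xs) = True # enc x @ encode_list enc xs"

definition encode_equation :: "nat \<Rightarrow> letter list list \<Rightarrow> bool list" where
  "encode_equation n cs = encode_nat n @ encode_list (encode_list encode_letter) cs"

lemma encode_nat_prefix_free:
  "encode_nat m @ r = encode_nat n @ s \<Longrightarrow> m = n \<and> r = s"
proof (induction m arbitrary: n)
  case 0
  then show ?case by (cases n) auto
next
  case (Suc m)
  then show ?case by (cases n) auto
qed

lemma encode_letter_prefix_free:
  "encode_letter a @ r = encode_letter b @ s \<Longrightarrow> a = b \<and> r = s"
  by (cases a; cases b) (auto simp del: encode_nat.simps dest: encode_nat_prefix_free)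

lemma encode_list_prefix_free:
  assumes "\<And>a b r s. enc a @ r = enc b @ s \<Longrightarrow> a = b \<and> r = s"
  shows "encode_list enc xs @ r = encode_list enc ys @ s \<Longrightarrow> xs = ys \<and> r = s"
proof (induction xs arbitrary: ys)
  case Nil
  then show ?case by (cases ys) auto
next
  case (Cons x xs)
  then show ?case by (cases ys) (auto dest: assms)
qed

lemma encode_equation_inject:
  "encode_equation m cs = encode_equation n ds \<longleftrightarrow> m = n \<and> cs = ds"
proof
  assume eq: "encode_equation m cs = encode_equation n ds"
  then have mn: "m = n"
    and "encode_list (encode_list encode_letter) cs = encode_list (encode_list encode_letter) ds"
    unfolding encode_equation_def by (auto dest: encode_nat_prefix_free simp del: encode_nat.simps)
  then have "cs = ds"
    using encode_list_prefix_free
        [OF encode_list_prefix_free [OF encode_letter_prefix_free],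
          where xs = cs and ys = ds and r = "[]" and s = "[]"]
    by simp
  with mn show "m = n \<and> cs = ds" by simp
qed simp

text \<open>Words that do not encode an instance are not in the language.\<close>

definition spherical_problem :: "bool list set" where
  "spherical_problem =
     {encode_equation n cs | n cs.
        cs \<noteq> [] \<and> (\<forall>c \<in> set cs. \<forall>l \<in> set c. valid_letter n l) \<and>
        spherical_solvable (Zn_wr_Z2 n) (map (word_value n) cs)}"

end

theory Submission
  imports Defs
begin

text \<open>
  If \<open>c\<^sub>j = (0, f\<^sub>j)\<close>, conjugation can only swap the two values of \<open>f\<^sub>j\<close>, so a spherical equation over
  $\mathbb{Z}^n \wr \mathbb{Z}_2$ can express any 0-1 linear system: columns \<open>u\<^sub>v\<close> become \<open>(u\<^sub>v, 0)\<close>, and one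
  further element \<open>(-b, b - \<Sum>u\<^sub>v)\<close> makes both components vanish exactly if some set of columns, or
  the complementary one, sums up to \<open>b\<close>.

  Computations of a multi-tape machine are the 0-1 solutions of such a system without any passage
  to a single tape: the variables record which transition is used when, where each head is, and
  what the unscanned cells contain, and all constraints are linear equations with coefficients
  \<open>0\<close> and \<open>\<plusminus>1\<close>. The certificate enters as the free initial contents of the second tape.

  The system is written down by nested loops whose bounds and indices are polynomials in the loop
  counters and the input length. A machine keeps these numbers in unary as head positions.
\<close>

section \<open>Machine programs\<close>

text \<open>\<open>NP_hard\<close> asks for a concrete multi-tape machine as reduction. The equation
  is therefore laid out so that it can be printed from left to right without reading back anything
  written. Whatever depends only on the verifier (tapes, states, symbols, transitions) is unrolled
  in the program text; time, cell and certificate index are loops at run time. Every equation of the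
  system is a balance: what step t - 1 produces for time t is what step t consumes. For a run the
  balances telescope. Conversely, a solution is not decoded into a run. Only the certificate is read
  off; the deterministic verifier has a run on it anyway, and induction on time shows that the
  solution coincides with that run. Acceptance is the one row of time T with a positive right-hand
  side, and slack can only subtract there.\<close>

datatype instr = Act nat "nat option" direction | Br nat "nat set" int

definition act_tape :: "nat option \<Rightarrow> direction \<Rightarrow> tape \<Rightarrow> tape" where
  "act_tape so d \<tau> = update_tape \<tau> (case so of None \<Rightarrow> scanned \<tau> | Some s \<Rightarrow> s, d)"

text \<open>Jumps are relative to the program counter. \<open>nat\<close> and \<open>min\<close>
  keep the target between 0 and \<open>length prog\<close>, the halting state, so that the compiled
  machine is well formed for arbitrary offsets.\<close>

fun pstep :: "instr list \<Rightarrow> nat \<times> (nat \<Rightarrow> tape) \<Rightarrow> nat \<times> (nat \<Rightarrow> tape)" where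
  "pstep prog (pc, \<tau>) =
     (if pc < length prog
      then case prog ! pc of
             Act j so d \<Rightarrow> (Suc pc, \<tau>(j := act_tape so d (\<tau> j)))
           | Br j S off \<Rightarrow>
               (if scanned (\<tau> j) \<in> S then min (nat (int pc + off)) (length prog) else Suc pc, \<tau>)
      else (pc, \<tau>))"

text \<open>Quantifying over the surrounding code makes fragments position independent, so that
  sequential composition is concatenation.\<close>

definition runs :: "instr list \<Rightarrow> (nat \<Rightarrow> tape) \<Rightarrow> nat \<Rightarrow> (nat \<Rightarrow> tape) \<Rightarrow> bool" where
  "runs P \<tau> t \<tau>' \<longleftrightarrow>
     (\<forall>pre post. (pstep (pre @ P @ post) ^^ t) (length pre, \<tau>) = (length pre + length P, \<tau>'))"

lemma funpow_1: "f ^^ 1 = (f :: 'a \<Rightarrow> 'a)"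
  by simp

lemma runs_Nil: "runs [] \<tau> 0 \<tau>"
  by (simp add: runs_def)

lemma runs_append:
  assumes "runs P \<tau> t \<tau>'" "runs Q \<tau>' t' \<tau>''"
  shows "runs (P @ Q) \<tau> (t + t') \<tau>''"
  unfolding runs_def
proof (intro allI)
  fix pre post
  have 1: "(pstep (pre @ P @ (Q @ post)) ^^ t) (length pre, \<tau>) = (length pre + length P, \<tau>')"
    using assms(1) unfolding runs_def by blast
  have 2: "(pstep ((pre @ P) @ Q @ post) ^^ t') (length (pre @ P), \<tau>') =
      (length (pre @ P) + length Q, \<tau>'')"
    using assms(2) unfolding runs_def by blast
  show "(pstep (pre @ (P @ Q) @ post) ^^ (t + t')) (length pre, \<tau>) =
      (length pre + length (P @ Q), \<tau>'')"
    using 1 2 by (simp add: add.commute [of t] funpow_add add.assoc)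
qed

lemma runs_Act: "runs [Act j so d] \<tau> 1 (\<tau>(j := act_tape so d (\<tau> j)))"
  by (simp add: runs_def)

text \<open>\<open>Br 0 UNIV\<close> is an unconditional jump. The test branches on the complement
  of \<open>S\<close>, so that the body is entered by falling through; the 2 counts the test itself
  and the closing jump.\<close>

definition While :: "nat \<Rightarrow> nat set \<Rightarrow> instr list \<Rightarrow> instr list" where
  "While j S P = [Br j (- S) (int (length P) + 2)] @ P @ [Br 0 UNIV (- (int (length P) + 1))]"

definition Cond :: "nat \<Rightarrow> nat set \<Rightarrow> instr list \<Rightarrow> instr list \<Rightarrow> instr list" where
  "Cond j S P Q =
     [Br j (- S) (int (length P) + 2)] @ P @ [Br 0 UNIV (int (length Q) + 1)] @ Q"

lemma runs_While_stop:
  assumes "scanned (\<tau> j) \<notin> S"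
  shows "runs (While j S P) \<tau> 1 \<tau>"
  using assms by (simp add: runs_def While_def nth_append nat_add_distrib)

lemma runs_While_step:
  assumes "scanned (\<tau> j) \<in> S" "runs P \<tau> t \<tau>'" "runs (While j S P) \<tau>' t' \<tau>''"
  shows "runs (While j S P) \<tau> (t + t' + 2) \<tau>''"
  unfolding runs_def
proof (intro allI)
  fix pre post
  let ?R = "pre @ While j S P @ post"
  let ?b = "[Br j (- S) (int (length P) + 2)]" and ?e = "[Br 0 UNIV (- (int (length P) + 1))]"
  have 0: "pstep ?R (length pre, \<tau>) = (length pre + 1, \<tau>)"
    using assms(1) by (simp add: While_def nth_append)
  have "(pstep ((pre @ ?b) @ P @ (?e @ post)) ^^ t) (length (pre @ ?b), \<tau>) =
      (length (pre @ ?b) + length P, \<tau>')"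
    using assms(2) unfolding runs_def by blast
  then have 1: "(pstep ?R ^^ t) (length pre + 1, \<tau>) = (length pre + 1 + length P, \<tau>')"
    by (simp add: While_def)
  have 2: "pstep ?R (length pre + 1 + length P, \<tau>') = (length pre, \<tau>')"
    by (simp add: While_def nth_append)
  have 3: "(pstep ?R ^^ t') (length pre, \<tau>') = (length pre + length (While j S P), \<tau>'')"
    using assms(3) unfolding runs_def by blast
  \<comment> \<open>\<open>funpow_add\<close> performs the right summand first: test, body, jump
    back and remaining loop are listed backwards.\<close>
  have eq: "t + t' + 2 = t' + (1 + (t + 1))" by simp
  show "(pstep ?R ^^ (t + t' + 2)) (length pre, \<tau>) =
      (length pre + length (While j S P), \<tau>'')"
    unfolding eq using 0 1 2 3 by (simp only: funpow_add o_def funpow_1)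
qed

lemma runs_Cond_true:
  assumes "scanned (\<tau> j) \<in> S" "runs P \<tau> t \<tau>'"
  shows "runs (Cond j S P Q) \<tau> (t + 2) \<tau>'"
  unfolding runs_def
proof (intro allI)
  fix pre post
  let ?R = "pre @ Cond j S P Q @ post"
  let ?b = "[Br j (- S) (int (length P) + 2)]" and ?e = "[Br 0 UNIV (int (length Q) + 1)]"
  have 0: "pstep ?R (length pre, \<tau>) = (length pre + 1, \<tau>)"
    using assms(1) by (simp add: Cond_def nth_append)
  have "(pstep ((pre @ ?b) @ P @ (?e @ Q @ post)) ^^ t) (length (pre @ ?b), \<tau>) =
      (length (pre @ ?b) + length P, \<tau>')"
    using assms(2) unfolding runs_def by blast
  then have 1: "(pstep ?R ^^ t) (length pre + 1, \<tau>) = (length pre + 1 + length P, \<tau>')"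
    by (simp add: Cond_def)
  have 2: "pstep ?R (length pre + 1 + length P, \<tau>') = (length pre + length (Cond j S P Q), \<tau>')"
    by (simp add: Cond_def nth_append nat_add_distrib min_def)
  have eq: "t + 2 = 1 + (t + 1)" by simp
  show "(pstep ?R ^^ (t + 2)) (length pre, \<tau>) = (length pre + length (Cond j S P Q), \<tau>')"
    unfolding eq using 0 1 2 by (simp only: funpow_add o_def funpow_1)
qed

lemma runs_Cond_false:
  assumes "scanned (\<tau> j) \<notin> S" "runs Q \<tau> t \<tau>'"
  shows "runs (Cond j S P Q) \<tau> (t + 1) \<tau>'"
  unfolding runs_def
proof (intro allI)
  fix pre post
  let ?R = "pre @ Cond j S P Q @ post"
  let ?b = "[Br j (- S) (int (length P) + 2)]" and ?e = "[Br 0 UNIV (int (length Q) + 1)]"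
  have 0: "pstep ?R (length pre, \<tau>) = (length pre + length P + 2, \<tau>)"
    using assms(1) by (simp add: Cond_def nth_append nat_add_distrib min_def)
  have "(pstep ((pre @ ?b @ P @ ?e) @ Q @ post) ^^ t) (length (pre @ ?b @ P @ ?e), \<tau>) =
      (length (pre @ ?b @ P @ ?e) + length Q, \<tau>')"
    using assms(2) unfolding runs_def by blast
  then have 1: "(pstep ?R ^^ t) (length pre + length P + 2, \<tau>) =
      (length pre + length (Cond j S P Q), \<tau>')"
    by (simp add: Cond_def)
  show "(pstep ?R ^^ (t + 1)) (length pre, \<tau>) = (length pre + length (Cond j S P Q), \<tau>')"
    using 0 1 by (simp only: funpow_add o_def funpow_1)
qed

section \<open>Compilation of programs into multi-tape machines\<close>

definition instr_tape :: "instr \<Rightarrow> nat" where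
  "instr_tape i = (case i of Act j _ _ \<Rightarrow> j | Br j _ _ \<Rightarrow> j)"

definition instr_symbol :: "instr \<Rightarrow> nat" where
  "instr_symbol i = (case i of Act _ (Some s) _ \<Rightarrow> s | _ \<Rightarrow> 0)"

definition prog_transition :: "nat \<Rightarrow> instr list \<Rightarrow> nat \<Rightarrow> nat list \<Rightarrow> nat \<times> (nat \<times> direction) list" where
  "prog_transition K prog q ss =
     (case prog ! q of
        Act j so d \<Rightarrow>
          (Suc q, map (\<lambda>i. if i = j then (case so of None \<Rightarrow> ss ! i | Some s \<Rightarrow> s, d) else (ss ! i, Stay)) [0..<K])
      | Br j S off \<Rightarrow>
          (if ss ! j \<in> S then min (nat (int q + off)) (length prog) else Suc q,
           map (\<lambda>i. (ss ! i, Stay)) [0..<K]))"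

definition prog_machine :: "nat \<Rightarrow> nat \<Rightarrow> instr list \<Rightarrow> turing_machine" where
  "prog_machine K G prog =
     \<lparr>num_tapes = K, num_states = length prog, num_symbols = G, transition = prog_transition K prog\<rparr>"

lemma well_formed_prog_machine:
  assumes "K \<ge> 1" "G \<ge> 3" "\<And>i. i \<in> set prog \<Longrightarrow> instr_symbol i < G"
  shows "well_formed (prog_machine K G prog)"
proof -
  have "case prog_transition K prog q ss of (q', as) \<Rightarrow>
           q' \<le> length prog \<and> length as = K \<and> fst ` set as \<subseteq> {..<G}"
    if q: "q < length prog" and ss: "length ss = K" "set ss \<subseteq> {..<G}" for q ss
  proof -
    have nth: "ss ! i < G" if "i < K" for i
      using that ss nth_mem [of i ss] by blast
    have sym: "instr_symbol (prog ! q) < G"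
      using q assms(3) by simp
    show ?thesis
      using q nth sym by (auto simp: prog_transition_def instr_symbol_def split: instr.splits option.splits if_splits)
  qed
  then show ?thesis
    using assms by (simp add: well_formed_def prog_machine_def)
qed

lemma step_prog_machine:
  assumes "\<And>i. i \<in> set prog \<Longrightarrow> instr_tape i < K"
  shows "step (prog_machine K G prog) (q, map \<tau> [0..<K]) =
    (case pstep prog (q, \<tau>) of (q', \<tau>') \<Rightarrow> (q', map \<tau>' [0..<K]))"
proof (cases "q < length prog")
  case True
  then have "instr_tape (prog ! q) < K" using assms by simp
  moreover have same: "update_tape x (scanned x, Stay) = x" for x
    by (cases x) simp
  ultimately show ?thesis
    using True
    by (auto simp: prog_machine_def prog_transition_def instr_tape_def act_tape_def same
      intro!: nth_equalityI split: instr.splits option.splits if_splits)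
qed (simp add: prog_machine_def)

lemma steps_prog_machine:
  assumes "\<And>i. i \<in> set prog \<Longrightarrow> instr_tape i < K"
  shows "(step (prog_machine K G prog) ^^ t) (q, map \<tau> [0..<K]) =
    (case (pstep prog ^^ t) (q, \<tau>) of (q', \<tau>') \<Rightarrow> (q', map \<tau>' [0..<K]))"
proof (induction t)
  case (Suc t)
  then show ?case
    using step_prog_machine [OF assms, where G = G]
    by (cases "(pstep prog ^^ t) (q, \<tau>)") (simp del: pstep.simps step.simps)
qed simp

section \<open>Counter programs running in polynomial time\<close>

lemma poly_mono_nat: "a \<le> b \<Longrightarrow> poly p a \<le> poly p (b :: nat)"
  by (induction p) (auto intro!: add_mono mult_mono)

text \<open>Tape 0 is the output. Any other tape is a counter, whose value is the distance of the head from
  the mark 3 in cell 0. On tape 1 this mark is followed by the input.\<close>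

definition mark :: "bool list \<Rightarrow> nat \<Rightarrow> int \<Rightarrow> nat" where
  "mark x j i = (if i = 0 then 3 else if j = 1 \<and> i > 0 then contents x (i - 1) else 0)"

definition cfg :: "bool list \<Rightarrow> bool list \<Rightarrow> (nat \<Rightarrow> nat) \<Rightarrow> nat \<Rightarrow> tape" where
  "cfg x w r j = (if j = 0 then (contents w, int (length w)) else (mark x j, int (r j)))"

lemma contents_le_2: "contents x i \<le> 2"
  by (simp add: contents_def)

lemma scanned_cfg: "j \<noteq> 0 \<Longrightarrow> scanned (cfg x w r j) = mark x j (int (r j))"
  by (simp add: cfg_def)

text \<open>The zero test for counters. It works on tape 1 as well, since input symbols are at most
  2.\<close>

lemma mark_eq_3_iff: "mark x j i = 3 \<longleftrightarrow> i = 0"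
  using contents_le_2 [of x "i - 1"] by (auto simp: mark_def)

definition inc :: "nat \<Rightarrow> instr list" where
  "inc j = [Act j None Right]"

definition dec :: "nat \<Rightarrow> instr list" where
  "dec j = [Act j None Left]"

definition out :: "bool \<Rightarrow> instr list" where
  "out b = [Act 0 (Some (if b then 2 else 1)) Right]"

text \<open>The counter is decremented before the body and consumed by the loop, so the body sees
  descending values ending with 0. Hence the lists \<open>rev [0..<N]\<close> in everything that is
  printed by a loop.\<close>

definition For :: "nat \<Rightarrow> instr list \<Rightarrow> instr list" where
  "For j P = While j (- {3}) (dec j @ P)"

lemma runs_inc: "j \<noteq> 0 \<Longrightarrow> runs (inc j) (cfg x w r) 1 (cfg x w (r(j := Suc (r j))))"
proof -
  assume "j \<noteq> 0"
  then have "(cfg x w r)(j := act_tape None Right (cfg x w r j)) = cfg x w (r(j := Suc (r j)))"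
    by (auto simp: cfg_def act_tape_def fun_eq_iff)
  then show ?thesis
    using runs_Act [of j None Right "cfg x w r"] by (simp add: inc_def)
qed

lemma runs_dec: "j \<noteq> 0 \<Longrightarrow> r j = Suc i \<Longrightarrow> runs (dec j) (cfg x w r) 1 (cfg x w (r(j := i)))"
proof -
  assume "j \<noteq> 0" "r j = Suc i"
  then have "(cfg x w r)(j := act_tape None Left (cfg x w r j)) = cfg x w (r(j := i))"
    by (auto simp: cfg_def act_tape_def fun_eq_iff)
  then show ?thesis
    using runs_Act [of j None Left "cfg x w r"] by (simp add: dec_def)
qed

lemma contents_snoc: "contents (w @ [b]) = (contents w)(int (length w) := if b then 2 else 1)"
  by (auto simp: contents_def fun_eq_iff nth_append nat_less_iff)

lemma runs_out: "runs (out b) (cfg x w r) 1 (cfg x (w @ [b]) r)"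
proof -
  have "(cfg x w r)(0 := act_tape (Some (if b then 2 else 1)) Right (cfg x w r 0)) = cfg x (w @ [b]) r"
    by (auto simp: cfg_def act_tape_def contents_snoc)
  then show ?thesis
    using runs_Act [of 0 "Some (if b then 2 else 1)" Right "cfg x w r"] by (simp only: out_def)
qed

text \<open>\<open>w i\<close> and \<open>r i\<close> describe the configuration in which
  \<open>i\<close> rounds remain, so the family is traversed downwards. The 3 steps per round
  besides the body are the test, the decrement and the jump back.\<close>

lemma runs_For:
  assumes j: "j \<noteq> 0" and r: "\<And>i. i \<le> N \<Longrightarrow> r i j = i"
    and body: "\<And>i. i < N \<Longrightarrow>
      \<exists>t\<le>B. runs P (cfg x (w (Suc i)) ((r (Suc i))(j := i))) t (cfg x (w i) (r i))"
  shows "\<exists>t \<le> N * (B + 3) + 1. runs (For j P) (cfg x (w N) (r N)) t (cfg x (w 0) (r 0))"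
  using r body
proof (induction N)
  case 0
  have "runs (For j P) (cfg x (w 0) (r 0)) 1 (cfg x (w 0) (r 0))"
    unfolding For_def using j 0(1) by (intro runs_While_stop) (simp add: scanned_cfg mark_eq_3_iff)
  then show ?case by auto
next
  case (Suc N)
  obtain t' where t': "t' \<le> N * (B + 3) + 1" "runs (For j P) (cfg x (w N) (r N)) t' (cfg x (w 0) (r 0))"
    using Suc by auto
  obtain t where t: "t \<le> B" "runs P (cfg x (w (Suc N)) ((r (Suc N))(j := N))) t (cfg x (w N) (r N))"
    using Suc(3) by blast
  have rN: "r (Suc N) j = Suc N" using Suc(2) by blast
  have "runs (dec j @ P) (cfg x (w (Suc N)) (r (Suc N))) (1 + t) (cfg x (w N) (r N))"
    by (rule runs_append [OF runs_dec t(2)]) (use j rN in auto)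
  then have "runs (For j P) (cfg x (w (Suc N)) (r (Suc N))) (1 + t + t' + 2) (cfg x (w 0) (r 0))"
    using t'(2) j rN unfolding For_def
    by (intro runs_While_step) (auto simp: scanned_cfg mark_eq_3_iff simp del: One_nat_def)
  then show ?case
    using t t' by (intro exI [of _ "1 + t + t' + 2"]) simp
qed

text \<open>A stack of numbers is kept on the tapes from number 2 on. Since unused counters are zero,
  pushing or popping a zero does not change the configuration.\<close>

definition regs :: "nat list \<Rightarrow> nat \<Rightarrow> nat" where
  "regs e j = (if 2 \<le> j \<and> j - 2 < length e then e ! (j - 2) else 0)"

abbreviation stk :: "bool list \<Rightarrow> bool list \<Rightarrow> nat list \<Rightarrow> nat \<Rightarrow> tape" where
  "stk x w e \<equiv> cfg x w (regs e)"

lemma regs_snoc_0: "regs (e @ [0]) = regs e"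
  by (auto simp: regs_def fun_eq_iff nth_append)

lemma regs_nth: "k < length e \<Longrightarrow> regs e (k + 2) = e ! k"
  by (simp add: regs_def)

lemma regs_upd: "k < length e \<Longrightarrow> (regs e)(k + 2 := v) = regs (e[k := v])"
  by (auto simp: regs_def fun_eq_iff nth_list_update)

section \<open>Arithmetic on the stack\<close>

lemma runs_inc_stk:
  assumes "k < length e"
  shows "runs (inc (k + 2)) (stk x w e) 1 (stk x w (e[k := Suc (e ! k)]))"
  using runs_inc [of "k + 2" x w "regs e"] regs_upd [OF assms] regs_nth [OF assms]
  by (simp del: One_nat_def)

lemma runs_For_stk:
  assumes k: "k < n" and e: "\<And>i. i \<le> N \<Longrightarrow> length (e i) = n \<and> e i ! k = i"
    and body: "\<And>i. i < N \<Longrightarrow>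
      \<exists>t\<le>B. runs P (stk x (w (Suc i)) ((e (Suc i))[k := i])) t (stk x (w i) (e i))"
  shows "\<exists>t \<le> N * (B + 3) + 1. runs (For (k + 2) P) (stk x (w N) (e N)) t (stk x (w 0) (e 0))"
proof (rule runs_For)
  show "regs (e i) (k + 2) = i" if "i \<le> N" for i
    using k e [OF that] by (subst regs_nth) auto
  show "\<exists>t\<le>B. runs P (cfg x (w (Suc i)) ((regs (e (Suc i)))(k + 2 := i))) t (stk x (w i) (e i))"
    if "i < N" for i
    using k e [of "Suc i"] that body [OF that] by (subst regs_upd) auto
qed simp

text \<open>The top of the stack is moved unit by unit into slot \<open>k\<close>; having reached
  zero, it counts as popped.\<close>

lemma runs_add_slot:
  assumes k: "k < length e"
  shows "\<exists>t \<le> b * 4 + 1.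
    runs (For (length e + 2) (inc (k + 2))) (stk x w (e @ [b])) t (stk x w (e[k := e ! k + b]))"
proof -
  let ?e = "\<lambda>i. e[k := e ! k + (b - i)] @ [i]"
  have "\<exists>t \<le> b * (1 + 3) + 1. runs (For (length e + 2) (inc (k + 2))) (stk x w (?e b)) t (stk x w (?e 0))"
  proof (rule runs_For_stk [where n = "length e + 1" and e = ?e and w = "\<lambda>_. w"])
    fix i assume i: "i < b"
    have "runs (inc (k + 2)) (stk x w (e[k := e ! k + (b - Suc i)] @ [i])) 1 (stk x w (?e i))"
      using runs_inc_stk [of k "e[k := e ! k + (b - Suc i)] @ [i]" x w] k i
      by (simp add: nth_append list_update_append Suc_diff_Suc)
    then show "\<exists>t\<le>1. runs (inc (k + 2)) (stk x w ((?e (Suc i))[length e := i])) t (stk x w (?e i))"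
      by (auto simp: list_update_append)
  qed (auto simp: nth_append)
  then show ?thesis
    by (simp add: regs_snoc_0)
qed

text \<open>The parameter of all time bounds. Counters are unary, so the stack contributes the sum
  of its values.\<close>

definition sz :: "bool list \<Rightarrow> nat list \<Rightarrow> nat" where
  "sz x e = length x + sum_list e"

lemma sz_append [simp]: "sz x (e @ e') = sz x e + sum_list e'"
  by (simp add: sz_def)

text \<open>One polynomial bounds the time and also the value, because the pushed value enlarges the
  size in which the cost of subsequent code is measured. \<open>E\<close> does not see the temporary
  values \<open>g\<close>.\<close>

definition pushes ::
    "instr list \<Rightarrow> nat poly \<Rightarrow> nat \<Rightarrow> nat \<Rightarrow> (bool list \<Rightarrow> nat list \<Rightarrow> nat) \<Rightarrow> bool" where
  "pushes P p n m E \<longleftrightarrow>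
     (\<forall>x w e g. length e = n \<and> length g = m \<longrightarrow>
        E x e \<le> poly p (sz x (e @ g)) \<and>
        (\<exists>t \<le> poly p (sz x (e @ g)). runs P (stk x w (e @ g)) t (stk x w (e @ g @ [E x e]))))"

text \<open>The quantification over \<open>m\<close> allows temporary values to be pushed above the \<open>n\<close> arguments.\<close>

definition computes :: "nat \<Rightarrow> (bool list \<Rightarrow> nat list \<Rightarrow> nat) \<Rightarrow> bool" where
  "computes n E \<longleftrightarrow> (\<forall>m. \<exists>P p. pushes P p n m E)"

lemma pushesD:
  assumes "pushes P p n m E" "length e = n" "length g = m"
  shows "E x e \<le> poly p (sz x (e @ g))"
    "\<exists>t \<le> poly p (sz x (e @ g)). runs P (stk x w (e @ g)) t (stk x w (e @ g @ [E x e]))"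
  using assms unfolding pushes_def by blast+

lemma pushesI:
  assumes "\<And>x e g. length e = n \<Longrightarrow> length g = m \<Longrightarrow> E x e \<le> poly p (sz x (e @ g))"
    "\<And>x w e g. length e = n \<Longrightarrow> length g = m \<Longrightarrow>
      \<exists>t \<le> poly q (sz x (e @ g)). runs P (stk x w (e @ g)) t (stk x w (e @ g @ [E x e]))"
  shows "pushes P (p + q) n m E"
  unfolding pushes_def
proof (intro allI impI conjI)
  fix x w :: "bool list" and e g :: "nat list" assume l: "length e = n \<and> length g = m"
  show "E x e \<le> poly (p + q) (sz x (e @ g))"
    using assms(1) [of e g x] l by simp
  show "\<exists>t \<le> poly (p + q) (sz x (e @ g)). runs P (stk x w (e @ g)) t (stk x w (e @ g @ [E x e]))"
    using assms(2) [of e g x w] l unfolding poly_add by (meson trans_le_add2)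
qed

lemma computes_0: "computes n (\<lambda>x e. 0)"
  unfolding computes_def
proof (intro allI exI)
  fix m
  show "pushes [] (0 + 0) n m (\<lambda>x e. 0)"
    by (rule pushesI) (auto simp: regs_snoc_0 simp flip: append_assoc intro: runs_Nil)
qed

lemma computes_Suc:
  assumes "computes n E"
  shows "computes n (\<lambda>x e. Suc (E x e))"
  unfolding computes_def
proof
  fix m
  obtain P p where P: "pushes P p n m E"
    using assms unfolding computes_def by blast
  have "pushes (P @ inc (n + m + 2)) ((p + 1) + (p + 1)) n m (\<lambda>x e. Suc (E x e))"
  proof (rule pushesI)
    fix x w :: "bool list" and e g :: "nat list" assume l: "length e = n" "length g = m"
    show "Suc (E x e) \<le> poly (p + 1) (sz x (e @ g))"
      using pushesD(1) [OF P l, of x] by simp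
    obtain t where t: "t \<le> poly p (sz x (e @ g))" "runs P (stk x w (e @ g)) t (stk x w (e @ g @ [E x e]))"
      using pushesD(2) [OF P l] by blast
    have "runs (inc (n + m + 2)) (stk x w (e @ g @ [E x e])) 1 (stk x w (e @ g @ [Suc (E x e)]))"
      using runs_inc_stk [of "n + m" "e @ g @ [E x e]" x w] l by (simp add: nth_append list_update_append)
    from runs_append [OF t(2) this] t(1) show "\<exists>t \<le> poly (p + 1) (sz x (e @ g)).
        runs (P @ inc (n + m + 2)) (stk x w (e @ g)) t (stk x w (e @ g @ [Suc (E x e)]))"
      by (intro exI [of _ "t + 1"]) simp
  qed
  then show "\<exists>P p. pushes P p n m (\<lambda>x e. Suc (E x e))"
    by blast
qed

lemma computes_const: "computes n (\<lambda>x e. c)"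
  by (induction c) (simp_all add: computes_0 computes_Suc)

lemma computes_add:
  assumes "computes n E" "computes n F"
  shows "computes n (\<lambda>x e. E x e + F x e)"
  unfolding computes_def
proof
  fix m
  obtain P p where P: "pushes P p n m E"
    using assms(1) unfolding computes_def by blast
  obtain Q q where Q: "pushes Q q n (Suc m) F"
    using assms(2) unfolding computes_def by blast
  \<comment> \<open>The second program finds the first value on the stack, so at original size
    \<open>s\<close> its size parameter is at most \<open>s + p(s)\<close>.\<close>
  let ?q = "pcompose q ([:0, 1:] + p)"
  have "pushes (P @ Q @ For (n + m + 1 + 2) (inc (n + m + 2))) ((p + ?q) + (p + ?q + (?q * [:4:] + 1))) n m
      (\<lambda>x e. E x e + F x e)"
  proof (rule pushesI)
    fix x w :: "bool list" and e g :: "nat list" assume l: "length e = n" "length g = m"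
    let ?s = "sz x (e @ g)" and ?a = "E x e" and ?b = "F x e"
    have a: "?a \<le> poly p ?s"
      using pushesD(1) [OF P l, of x] by simp
    have s': "sz x (e @ g @ [?a]) \<le> poly ([:0, 1:] + p) ?s"
      using a by simp
    have l': "length (g @ [?a]) = Suc m"
      using l by simp
    have b: "?b \<le> poly ?q ?s"
      using pushesD(1) [OF Q l(1) l', of x] poly_mono_nat [OF s', of q]
      unfolding poly_pcompose by simp
    show "?a + ?b \<le> poly (p + ?q) ?s"
      unfolding poly_add by (rule add_mono [OF a b])
    obtain t where t: "t \<le> poly p ?s" "runs P (stk x w (e @ g)) t (stk x w (e @ g @ [?a]))"
      using pushesD(2) [OF P l] by blast
    obtain t' where t': "t' \<le> poly q (sz x (e @ g @ [?a]))"
      "runs Q (stk x w (e @ g @ [?a])) t' (stk x w (e @ g @ [?a, ?b]))"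
      using pushesD(2) [OF Q l(1) l', of x w] by auto
    obtain u where u: "u \<le> ?b * 4 + 1" "runs (For (n + m + 1 + 2) (inc (n + m + 2)))
       (stk x w (e @ g @ [?a, ?b])) u (stk x w (e @ g @ [?a + ?b]))"
      using runs_add_slot [of "n + m" "e @ g @ [?a]" ?b x w] l
      by (auto simp: list_update_append nth_append)
    have "t + (t' + u) \<le> poly (p + ?q + (?q * [:4:] + 1)) ?s"
      using t(1) t'(1) u(1) b poly_mono_nat [OF s', of q] by (simp add: poly_pcompose)
    then show "\<exists>t \<le> poly (p + ?q + (?q * [:4:] + 1)) ?s.
        runs (P @ Q @ For (n + m + 1 + 2) (inc (n + m + 2))) (stk x w (e @ g)) t (stk x w (e @ g @ [?a + ?b]))"
      using runs_append [OF t(2) runs_append [OF t'(2) u(2)]] by blast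
  qed
  then show "\<exists>P p. pushes P p n m (\<lambda>x e. E x e + F x e)"
    by blast
qed

text \<open>A zero, which costs nothing to push, serves as accumulator. The value of
  \<open>F\<close> is counted down above it, and in every round \<open>E\<close> is recomputed and
  added. This explains the \<open>m + 1\<close> and \<open>m + 2\<close> temporary values.\<close>

lemma computes_mult:
  assumes "computes n E" "computes n F"
  shows "computes n (\<lambda>x e. E x e * F x e)"
  unfolding computes_def
proof
  fix m
  obtain P p where P: "pushes P p n (m + 2) E"
    using assms(1) unfolding computes_def by blast
  obtain Q q where Q: "pushes Q q n (m + 1) F"
    using assms(2) unfolding computes_def by blast
  \<comment> \<open>During a round the accumulator is at most \<open>p * q\<close> and the counter
    at most \<open>q\<close>, which bounds the size at which \<open>E\<close> is recomputed; the
    rest is the cost of the addition.\<close>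
  let ?B = "pcompose p ([:0, 1:] + p * q + q) + (p * [:4:] + 1)"
  let ?body = "P @ For (n + m + 2 + 2) (inc (n + m + 2))"
  have "pushes (Q @ For (n + m + 1 + 2) ?body) (p * q + (q + (q * (?B + [:3:]) + 1))) n m
      (\<lambda>x e. E x e * F x e)"
  proof (rule pushesI)
    fix x w :: "bool list" and e g :: "nat list" assume l: "length e = n" "length g = m"
    let ?s = "sz x (e @ g)" and ?a = "E x e" and ?b = "F x e"
    have l': "length (g @ [0]) = m + 1" "length (g @ [u, v]) = m + 2" for u v :: nat
      using l by simp_all
    have a: "?a \<le> poly p ?s"
      using pushesD(1) [OF P l(1) l'(2) [of 0 0], of x] by simp
    have b: "?b \<le> poly q ?s"
      using pushesD(1) [OF Q l(1) l'(1), of x] by simp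
    show "?a * ?b \<le> poly (p * q) ?s"
      unfolding poly_mult by (rule mult_mono [OF a b]) simp_all
    obtain t where t: "t \<le> poly q ?s" "runs Q (stk x w (e @ g)) t (stk x w (e @ g @ [0, ?b]))"
      using pushesD(2) [OF Q l(1) l'(1), of x w] regs_snoc_0 [of "e @ g"] by auto
    let ?e = "\<lambda>i. e @ g @ [?a * (?b - i), i]"
    have "\<exists>t \<le> ?b * (poly ?B ?s + 3) + 1.
       runs (For (n + m + 1 + 2) ?body) (stk x w (?e ?b)) t (stk x w (?e 0))"
    proof (rule runs_For_stk [where n = "n + m + 2" and e = ?e and w = "\<lambda>_. w"])
      fix i assume i: "i < ?b"
      let ?c = "?a * (?b - Suc i)"
      obtain t where t: "t \<le> poly p (sz x (e @ g @ [?c, i]))"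
        "runs P (stk x w (e @ g @ [?c, i])) t (stk x w (e @ g @ [?c, i, ?a]))"
        using pushesD(2) [OF P l(1) l'(2), of x ?c i w] by auto
      have ab: "?a * ?b \<le> poly p ?s * poly q ?s"
        by (rule mult_mono [OF a b]) simp_all
      have "?c \<le> poly p ?s * poly q ?s"
        by (rule le_trans [OF mult_le_mono2 ab]) simp
      moreover have "i \<le> poly q ?s"
        using b i by (rule order.strict_implies_order [OF order.strict_trans2 [rotated]])
      ultimately have "sz x (e @ g @ [?c, i]) \<le> poly ([:0, 1:] + p * q + q) ?s"
        by simp
      then have t1: "t \<le> poly (pcompose p ([:0, 1:] + p * q + q)) ?s"
        using t(1) poly_mono_nat unfolding poly_pcompose by (meson le_trans)
      obtain u where u: "u \<le> ?a * 4 + 1" "runs (For (n + m + 2 + 2) (inc (n + m + 2)))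
          (stk x w (e @ g @ [?c, i, ?a])) u (stk x w (e @ g @ [?c + ?a, i]))"
        using runs_add_slot [of "n + m" "e @ g @ [?c, i]" ?a x w] l
        by (auto simp: list_update_append nth_append)
      have "?c + ?a = ?a * (?b - i)"
        using i by (metis Suc_diff_Suc add.commute mult_Suc_right)
      then have "runs ?body (stk x w (e @ g @ [?c, i])) (t + u) (stk x w (?e i))"
        using runs_append [OF t(2) u(2)] by simp
      moreover have "t + u \<le> poly ?B ?s"
        using t1 u(1) a by simp
      moreover have "(?e (Suc i))[n + m + 1 := i] = e @ g @ [?c, i]"
        using l by (simp add: list_update_append)
      ultimately show "\<exists>t\<le>poly ?B ?s. runs ?body (stk x w ((?e (Suc i))[n + m + 1 := i])) t (stk x w (?e i))"
        by (metis (no_types, lifting))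
    qed (use l in \<open>auto simp: nth_append\<close>)
    then obtain u where u: "u \<le> ?b * (poly ?B ?s + 3) + 1" "runs (For (n + m + 1 + 2) ?body)
       (stk x w (e @ g @ [0, ?b])) u (stk x w (e @ g @ [?a * ?b]))"
      using regs_snoc_0 [of "e @ g @ [?a * ?b]"] by auto
    have "?b * (poly ?B ?s + 3) \<le> poly q ?s * (poly ?B ?s + 3)"
      using b by (rule mult_le_mono1)
    then have "t + u \<le> poly q ?s + (poly q ?s * (poly ?B ?s + 3) + 1)"
      using t(1) u(1) by linarith
    also have "\<dots> = poly (q + (q * (?B + [:3:]) + 1)) ?s"
      by simp
    finally have "t + u \<le> poly (q + (q * (?B + [:3:]) + 1)) ?s" .
    then show "\<exists>t \<le> poly (q + (q * (?B + [:3:]) + 1)) ?s.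
        runs (Q @ For (n + m + 1 + 2) ?body) (stk x w (e @ g)) t (stk x w (e @ g @ [?a * ?b]))"
      using runs_append [OF t(2) u(2)] by blast
  qed
  then show "\<exists>P p. pushes P p n m (\<lambda>x e. E x e * F x e)"
    by blast
qed

text \<open>Reading a counter destroys it. It is counted down into two fresh slots, and one of the
  two copies is then moved back.\<close>

lemma computes_var:
  assumes k: "k < n"
  shows "computes n (\<lambda>x e. e ! k)"
  unfolding computes_def
proof
  fix m
  let ?body = "inc (n + m + 2) @ inc (n + m + 1 + 2)"
  have "pushes (For (k + 2) ?body @ For (n + m + 1 + 2) (inc (k + 2)))
     ([:0, 1:] + ([:0, 5:] + 1 + ([:0, 4:] + 1))) n m (\<lambda>x e. e ! k)"
  proof (rule pushesI)
    fix x w :: "bool list" and e g :: "nat list" assume l: "length e = n" "length g = m"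
    let ?a = "e ! k"
    have "?a \<le> sum_list e"
      using k l by (intro member_le_sum_list) auto
    then have a: "?a \<le> sz x (e @ g)"
      by (simp add: sz_def)
    then show "?a \<le> poly [:0, 1:] (sz x (e @ g))"
      by simp
    let ?e = "\<lambda>i. e[k := i] @ g @ [?a - i, ?a - i]"
    have "\<exists>t \<le> ?a * (2 + 3) + 1. runs (For (k + 2) ?body) (stk x w (?e ?a)) t (stk x w (?e 0))"
    proof (rule runs_For_stk [where n = "n + m + 2" and e = ?e and w = "\<lambda>_. w"])
      fix i assume i: "i < ?a"
      let ?c = "?a - Suc i"
      have 1: "runs (inc (n + m + 2)) (stk x w (e[k := i] @ g @ [?c, ?c])) 1
          (stk x w (e[k := i] @ g @ [Suc ?c, ?c]))"
        using runs_inc_stk [of "n + m" "e[k := i] @ g @ [?c, ?c]" x w] l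
        by (simp add: nth_append list_update_append)
      have 2: "runs (inc (n + m + 1 + 2)) (stk x w (e[k := i] @ g @ [Suc ?c, ?c])) 1
          (stk x w (e[k := i] @ g @ [Suc ?c, Suc ?c]))"
        using runs_inc_stk [of "n + m + 1" "e[k := i] @ g @ [Suc ?c, ?c]" x w] l
        by (simp add: nth_append list_update_append)
      have "(?e (Suc i))[k := i] = e[k := i] @ g @ [?c, ?c]"
        using l k by (simp add: list_update_append)
      moreover have "Suc ?c = ?a - i"
        using i by simp
      ultimately show "\<exists>t\<le>2. runs ?body (stk x w ((?e (Suc i))[k := i])) t (stk x w (?e i))"
        using runs_append [OF 1 2] by (intro exI [of _ "1 + 1"]) simp
    qed (use l k in \<open>auto simp: nth_append\<close>)
    then obtain t where t: "t \<le> ?a * 5 + 1"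
      "runs (For (k + 2) ?body) (stk x w (e @ g)) t (stk x w (e[k := 0] @ g @ [?a, ?a]))"
      using regs_snoc_0 [of "e @ g @ [0]"] regs_snoc_0 [of "e @ g"] by auto
    obtain u where u: "u \<le> ?a * 4 + 1" "runs (For (n + m + 1 + 2) (inc (k + 2)))
        (stk x w (e[k := 0] @ g @ [?a, ?a])) u (stk x w (e @ g @ [?a]))"
      using runs_add_slot [of k "e[k := 0] @ g @ [?a]" ?a x w] l k
      by (auto simp: list_update_append nth_append)
    have "t + u \<le> poly ([:0, 5:] + 1 + ([:0, 4:] + 1)) (sz x (e @ g))"
      using t(1) u(1) a by simp
    then show "\<exists>t \<le> poly ([:0, 5:] + 1 + ([:0, 4:] + 1)) (sz x (e @ g)).
       runs (For (k + 2) ?body @ For (n + m + 1 + 2) (inc (k + 2))) (stk x w (e @ g)) t (stk x w (e @ g @ [?a]))"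
      using runs_append [OF t(2) u(2)] by blast
  qed
  then show "\<exists>P p. pushes P p n m (\<lambda>x e. e ! k)"
    by blast
qed

lemma runs_reset_input:
  "\<exists>t \<le> v * 3 + 1. runs (For 1 []) (cfg x w ((regs e)(1 := v))) t (stk x w e)"
proof -
  have "\<exists>t \<le> v * (0 + 3) + 1. runs (For 1 []) (cfg x w ((regs e)(1 := v))) t (cfg x w ((regs e)(1 := 0)))"
    by (rule runs_For [where r = "\<lambda>i. (regs e)(1 := i)" and w = "\<lambda>_. w"]) (auto intro: runs_Nil)
  moreover have "(regs e)(1 := 0) = regs e"
    by (auto simp: regs_def)
  ultimately show ?thesis by simp
qed

lemma mark_input: "mark x (Suc 0) (int (Suc i)) = contents x (int i)"
  by (simp add: mark_def)

lemma runs_inc_input: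
  "runs (inc 1) (cfg x w ((regs e)(1 := v))) 1 (cfg x w ((regs e)(1 := Suc v)))"
  using runs_inc [of 1 x w "(regs e)(1 := v)"] by simp

lemma runs_inc_slot:
  "runs (inc (length e + 2)) (cfg x w ((regs (e @ [a]))(1 := v))) 1
     (cfg x w ((regs (e @ [Suc a]))(1 := v)))"
proof -
  have *: "((regs (e @ [a]))(1 := v))(length e + 2 := Suc a) = (regs (e @ [Suc a]))(1 := v)"
    by (auto simp: regs_def nth_append fun_eq_iff)
  have **: "((regs (e @ [a]))(1 := v)) (length e + 2) = a"
    by (auto simp: regs_def nth_append fun_eq_iff)
  show ?thesis
    using runs_inc [of "length e + 2" x w "(regs (e @ [a]))(1 := v)"] unfolding ** * by simp
qed

lemma contents_neq_0_iff: "contents x (int i) \<noteq> 0 \<longleftrightarrow> i < length x"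
  by (simp add: contents_def)

lemma runs_measure_input:
  assumes "i \<le> length x"
  shows "\<exists>t \<le> (length x - i) * 4 + 1.
    runs (While 1 {1, 2} (inc (length e + 2) @ inc 1)) (cfg x w ((regs (e @ [i]))(1 := Suc i))) t
      (cfg x w ((regs (e @ [length x]))(1 := Suc (length x))))"
  using assms
proof (induction i rule: inc_induct)
  case base
  have "runs (While 1 {1, 2} (inc (length e + 2) @ inc 1)) (cfg x w ((regs (e @ [length x]))(1 := Suc (length x)))) 1
      (cfg x w ((regs (e @ [length x]))(1 := Suc (length x))))"
    using contents_neq_0_iff [of x "length x"]
    by (intro runs_While_stop) (simp add: scanned_cfg mark_input del: of_nat_Suc)
  then show ?case
    by (intro exI [of _ 1] conjI) (simp, assumption)
next
  case (step i)
  then obtain t where t: "t \<le> (length x - Suc i) * 4 + 1"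
    "runs (While 1 {1, 2} (inc (length e + 2) @ inc 1)) (cfg x w ((regs (e @ [Suc i]))(1 := Suc (Suc i)))) t
      (cfg x w ((regs (e @ [length x]))(1 := Suc (length x))))"
    by blast
  have "contents x (int i) \<in> {1, 2}"
    using contents_neq_0_iff [of x i] contents_le_2 [of x "int i"] step by auto
  then have "runs (While 1 {1, 2} (inc (length e + 2) @ inc 1)) (cfg x w ((regs (e @ [i]))(1 := Suc i))) ((1 + 1) + t + 2)
      (cfg x w ((regs (e @ [length x]))(1 := Suc (length x))))"
    by (intro runs_While_step [OF _ runs_append [OF runs_inc_slot runs_inc_input] t(2)])
      (simp add: scanned_cfg mark_input del: of_nat_Suc)
  moreover have "(1 + 1) + t + 2 \<le> (length x - i) * 4 + 1"
    using t(1) step by (simp add: Suc_diff_Suc [symmetric])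
  ultimately show ?case by blast
qed

lemma regs_fun_upd_1: "(regs e)(1 := 0) = regs e" "(regs e)(Suc 0 := 0) = regs e"
  by (auto simp: regs_def)

text \<open>Head 1 leaves the mark and walks over the input up to the first blank while the new slot
  is incremented; \<open>For 1 []\<close> takes it home.\<close>

lemma computes_length: "computes n (\<lambda>x e. length x)"
  unfolding computes_def
proof
  fix m
  let ?P = "inc 1 @ While 1 {1, 2} (inc (n + m + 2) @ inc 1) @ For 1 []"
  have "pushes ?P ([:0, 1:] + [:6, 7:]) n m (\<lambda>x e. length x)"
  proof (rule pushesI)
    fix x w :: "bool list" and e g :: "nat list" assume l: "length e = n" "length g = m"
    show "length x \<le> poly [:0, 1:] (sz x (e @ g))"
      by (simp add: sz_def)
    have 1: "runs (inc 1) (stk x w (e @ g)) 1 (cfg x w ((regs (e @ g @ [0]))(1 := Suc 0)))"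
      using runs_inc_input [of x w "e @ g" 0] regs_snoc_0 [of "e @ g"] by (simp add: regs_fun_upd_1)
    obtain t where t: "t \<le> length x * 4 + 1"
      "runs (While 1 {1, 2} (inc (n + m + 2) @ inc 1)) (cfg x w ((regs (e @ g @ [0]))(1 := Suc 0))) t
        (cfg x w ((regs (e @ g @ [length x]))(1 := Suc (length x))))"
      using runs_measure_input [of 0 x "e @ g" w] l by auto
    obtain u where u: "u \<le> Suc (length x) * 3 + 1"
      "runs (For 1 []) (cfg x w ((regs (e @ g @ [length x]))(1 := Suc (length x)))) u (stk x w (e @ g @ [length x]))"
      using runs_reset_input by blast
    have "1 + (t + u) \<le> poly [:6, 7:] (sz x (e @ g))"
      using t(1) u(1) by (simp add: sz_def)
    then show "\<exists>t \<le> poly [:6, 7:] (sz x (e @ g)).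
       runs ?P (stk x w (e @ g)) t (stk x w (e @ g @ [length x]))"
      using runs_append [OF 1 runs_append [OF t(2) u(2)]] by blast
  qed
  then show "\<exists>P p. pushes P p n m (\<lambda>x e. length x)"
    by blast
qed

text \<open>This is how input symbols enter row numbers. The value of \<open>E\<close> is
  transferred to the position of head 1, one further move accounts for the mark, and the scanned
  symbol is rebuilt as a number in the slot just emptied.\<close>

lemma computes_input:
  assumes "computes n E"
  shows "computes n (\<lambda>x e. contents x (int (E x e)))"
  unfolding computes_def
proof
  fix m
  obtain P p where P: "pushes P p n m E"
    using assms unfolding computes_def by blast
  let ?s = "inc (n + m + 2)"
  let ?C = "Cond 1 {1} ?s (Cond 1 {2} (?s @ ?s) [])"
  let ?P = "P @ For (n + m + 2) (inc 1) @ inc 1 @ ?C @ For 1 []"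
  have "pushes ?P ([:2:] + (p + (p * [:7:] + [:13:]))) n m (\<lambda>x e. contents x (int (E x e)))"
  proof (rule pushesI)
    fix x w :: "bool list" and e g :: "nat list" assume l: "length e = n" "length g = m"
    let ?a = "E x e"
    show "contents x (int (E x e)) \<le> poly [:2:] (sz x (e @ g))"
      by (simp add: contents_le_2)
    have a: "?a \<le> poly p (sz x (e @ g))"
      using pushesD(1) [OF P l, of x] by simp
    obtain t where t: "t \<le> poly p (sz x (e @ g))" "runs P (stk x w (e @ g)) t (stk x w (e @ g @ [?a]))"
      using pushesD(2) [OF P l] by blast
    let ?r = "\<lambda>i. (regs (e @ g @ [i]))(1 := ?a - i)"
    have "\<exists>t \<le> ?a * (1 + 3) + 1. runs (For (n + m + 2) (inc 1)) (cfg x w (?r ?a)) t (cfg x w (?r 0))"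
    proof (rule runs_For [where r = ?r and w = "\<lambda>_. w"])
      fix i assume i: "i < ?a"
      have "(?r (Suc i))(n + m + 2 := i) = (regs (e @ g @ [i]))(1 := ?a - Suc i)"
        using l by (auto simp: regs_def nth_append fun_eq_iff)
      moreover have "Suc (?a - Suc i) = ?a - i"
        using i by simp
      ultimately show "\<exists>t\<le>1. runs (inc 1) (cfg x w ((?r (Suc i))(n + m + 2 := i))) t (cfg x w (?r i))"
        using runs_inc_input [of x w "e @ g @ [i]" "?a - Suc i"] by auto
    qed (use l in \<open>auto simp: regs_def nth_append\<close>)
    then obtain u where u: "u \<le> ?a * 4 + 1" "runs (For (n + m + 2) (inc 1)) (stk x w (e @ g @ [?a])) u
        (cfg x w ((regs (e @ g @ [0]))(1 := ?a)))"
      using regs_fun_upd_1 by auto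
    note v = runs_inc_input [of x w "e @ g @ [0]" ?a]
    let ?c = "contents x (int ?a)"
    let ?f = "\<lambda>c. cfg x w ((regs (e @ g @ [c]))(1 := Suc ?a))"
    have inc: "runs ?s (?f c) 1 (?f (Suc c))" for c
      using runs_inc_slot [of "e @ g" x w c "Suc ?a"] l by simp
    have scan: "scanned (?f 0 1) = ?c"
      by (simp add: scanned_cfg mark_input del: of_nat_Suc)
    have "\<exists>t \<le> 5. runs ?C (?f 0) t (?f ?c)"
    proof -
      consider "?c = 0" | "?c = 1" | "?c = 2"
        using contents_le_2 [of x "int ?a"] by linarith
      then show ?thesis
      proof cases
        case 1
        have "runs ?C (?f 0) (0 + 1 + 1) (?f 0)"
          by (intro runs_Cond_false runs_Nil) (simp_all only: scan 1, simp_all)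
        then show ?thesis using 1 by (intro exI [of _ "0 + 1 + 1"]) simp
      next
        case 2
        have "runs ?C (?f 0) (1 + 2) (?f 1)"
          using inc [of 0] by (intro runs_Cond_true) (simp_all only: scan 2, simp_all)
        then show ?thesis using 2 by (intro exI [of _ "1 + 2"]) simp
      next
        case 3
        have "runs (?s @ ?s) (?f 0) (1 + 1) (?f 2)"
          using runs_append [OF inc [of 0] inc [of "Suc 0"]] by (simp add: numeral_2_eq_2)
        then have "runs ?C (?f 0) (1 + 1 + 2 + 1) (?f 2)"
          by (intro runs_Cond_false runs_Cond_true) (simp_all only: scan 3, simp_all)
        then show ?thesis using 3 by (intro exI [of _ "1 + 1 + 2 + 1"]) simp
      qed
    qed
    then obtain k where k: "k \<le> 5" "runs ?C (?f 0) k (?f ?c)"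
      by blast
    obtain y where y: "y \<le> Suc ?a * 3 + 1" "runs (For 1 []) (?f ?c) y (stk x w (e @ g @ [?c]))"
      using runs_reset_input by blast
    have "t + (u + (1 + (k + y))) \<le> poly (p + (p * [:7:] + [:13:])) (sz x (e @ g))"
      using t(1) u(1) k(1) y(1) a by simp
    then show "\<exists>t \<le> poly (p + (p * [:7:] + [:13:])) (sz x (e @ g)).
        runs ?P (stk x w (e @ g)) t (stk x w (e @ g @ [?c]))"
      using runs_append [OF t(2) runs_append [OF u(2) runs_append [OF v runs_append [OF k(2) y(2)]]]]
      by blast
  qed
  then show "\<exists>P p. pushes P p n m (\<lambda>x e. contents x (int (E x e)))"
    by blast
qed

lemma computes_poly:
  assumes "computes n E"
  shows "computes n (\<lambda>x e. poly p (E x e))"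
  by (induction p) (simp_all add: computes_const computes_add computes_mult assms)

section \<open>Programs that print words\<close>

definition emits :: "nat \<Rightarrow> (bool list \<Rightarrow> nat list \<Rightarrow> bool list) \<Rightarrow> bool" where
  "emits n F \<longleftrightarrow>
     (\<exists>P p. \<forall>x w e. length e = n \<longrightarrow>
        (\<exists>t \<le> poly p (sz x e). runs P (stk x w e) t (stk x (w @ F x e) e)))"

lemma emits_Nil: "emits n (\<lambda>x e. [])"
  unfolding emits_def by (intro exI [of _ "[]"] exI [of _ 0]) (auto intro: runs_Nil)

lemma emits_append:
  assumes "emits n F" "emits n G"
  shows "emits n (\<lambda>x e. F x e @ G x e)"
proof -
  obtain P p where P: "\<And>x w e. length e = n \<Longrightarrow> \<exists>t \<le> poly p (sz x e). runs P (stk x w e) t (stk x (w @ F x e) e)"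
    using assms(1) unfolding emits_def by blast
  obtain Q q where Q: "\<And>x w e. length e = n \<Longrightarrow> \<exists>t \<le> poly q (sz x e). runs Q (stk x w e) t (stk x (w @ G x e) e)"
    using assms(2) unfolding emits_def by blast
  show ?thesis
    unfolding emits_def
  proof (intro exI [of _ "P @ Q"] exI [of _ "p + q"] allI impI)
    fix x w :: "bool list" and e :: "nat list" assume l: "length e = n"
    obtain t where t: "t \<le> poly p (sz x e)" "runs P (stk x w e) t (stk x (w @ F x e) e)"
      using P l by blast
    obtain u where u: "u \<le> poly q (sz x e)" "runs Q (stk x (w @ F x e) e) u (stk x ((w @ F x e) @ G x e) e)"
      using Q l by blast
    show "\<exists>t \<le> poly (p + q) (sz x e). runs (P @ Q) (stk x w e) t (stk x (w @ F x e @ G x e) e)"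
      using runs_append [OF t(2) u(2)] t(1) u(1) by (intro exI [of _ "t + u"]) simp
  qed
qed

lemma emits_single: "emits n (\<lambda>x e. [b])"
  unfolding emits_def
  by (intro exI [of _ "out b"] exI [of _ 1]) (auto intro!: exI [of _ 1] runs_out simp del: One_nat_def)

lemma emits_const: "emits n (\<lambda>x e. bs)"
proof (induction bs)
  case (Cons b bs)
  show ?case
    using emits_append [OF emits_single [of n b] Cons] by simp
qed (rule emits_Nil)

text \<open>\<open>L\<close> does not depend on the input: the repetition is unrolled, with a
  separate program fragment for each entry.\<close>

lemma emits_concat:
  assumes "\<And>a. a \<in> set L \<Longrightarrow> emits n (F a)"
  shows "emits n (\<lambda>x e. concat (map (\<lambda>a. F a x e) L))"
  using assms by (induction L) (simp_all add: emits_Nil emits_append)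

text \<open>The bound is pushed and, while it is counted down, is itself the loop variable; so the
  body has one argument more.\<close>

lemma emits_for:
  assumes "computes n E" "emits (Suc n) F"
  shows "emits n (\<lambda>x e. concat (map (\<lambda>i. F x (e @ [i])) (rev [0..<E x e])))"
proof -
  obtain P p where P: "pushes P p n 0 E"
    using assms(1) unfolding computes_def by blast
  obtain Q q where Q: "\<And>x w e. length e = Suc n \<Longrightarrow> \<exists>t \<le> poly q (sz x e). runs Q (stk x w e) t (stk x (w @ F x e) e)"
    using assms(2) unfolding emits_def by blast
  let ?B = "pcompose q ([:0, 1:] + p)"
  let ?P = "P @ For (n + 2) Q" and ?p = "p + (p * (?B + [:3:]) + 1)"
  show ?thesis
    unfolding emits_def
  proof (intro exI [of _ ?P] exI [of _ ?p] allI impI)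
    fix x w :: "bool list" and e :: "nat list" assume l: "length e = n"
    let ?N = "E x e" and ?s = "sz x e"
    have N: "?N \<le> poly p ?s"
      using pushesD(1) [OF P l, of "[]" x] by simp
    obtain t where t: "t \<le> poly p ?s" "runs P (stk x w e) t (stk x w (e @ [?N]))"
      using pushesD(2) [OF P l, of "[]" x w] by auto
    \<comment> \<open>The output when the counter shows \<open>i\<close>: the values from
      \<open>?N - 1\<close> down to \<open>i\<close> have been treated.\<close>
    let ?w = "\<lambda>i. w @ concat (map (\<lambda>i. F x (e @ [i])) (rev [i..<?N]))"
    have "\<exists>t \<le> ?N * (poly ?B ?s + 3) + 1. runs (For (n + 2) Q) (stk x (?w ?N) (e @ [?N])) t (stk x (?w 0) (e @ [0]))"
    proof (rule runs_For_stk [where n = "Suc n" and e = "\<lambda>i. e @ [i]" and w = ?w])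
      fix i assume i: "i < ?N"
      have "sz x (e @ [i]) \<le> poly ([:0, 1:] + p) ?s"
        using i N by simp
      then have "poly q (sz x (e @ [i])) \<le> poly ?B ?s"
        unfolding poly_pcompose by (rule poly_mono_nat)
      moreover have "?w i = ?w (Suc i) @ F x (e @ [i])"
        using i by (subst upt_conv_Cons) simp_all
      ultimately show "\<exists>t\<le>poly ?B ?s. runs Q (stk x (?w (Suc i)) ((e @ [Suc i])[n := i])) t (stk x (?w i) (e @ [i]))"
        using Q [of "e @ [i]" x "?w (Suc i)"] l by (auto simp: list_update_append intro: order.trans)
    qed (use l in auto)
    then obtain u where u: "u \<le> ?N * (poly ?B ?s + 3) + 1"
      "runs (For (n + 2) Q) (stk x w (e @ [?N])) u (stk x (?w 0) e)"
      by (auto simp: regs_snoc_0)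
    have "?N * (poly ?B ?s + 3) \<le> poly p ?s * (poly ?B ?s + 3)"
      using N by (rule mult_le_mono1)
    then have "t + u \<le> poly p ?s + (poly p ?s * (poly ?B ?s + 3) + 1)"
      using t(1) u(1) by linarith
    also have "\<dots> = poly ?p ?s"
      by simp
    finally have "t + u \<le> poly ?p ?s" .
    then show "\<exists>t \<le> poly ?p ?s. runs ?P (stk x w e) t (stk x (?w 0) e)"
      using runs_append [OF t(2) u(2)] by blast
  qed
qed

lemma emits_replicate:
  assumes "computes n E"
  shows "emits n (\<lambda>x e. replicate (E x e) b)"
proof -
  have "concat (map (\<lambda>i. [b]) (rev [0..<k])) = replicate k b" for k
    by (induction k) (simp_all add: replicate_append_same)
  then show ?thesis
    using emits_for [OF assms emits_single [of "Suc n" b]] by simp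
qed

text \<open>The input is moved to tape 1, shifted by one cell to make room for the mark in cell 0.\<close>

definition marks :: "nat \<Rightarrow> instr list" where
  "marks K = map (\<lambda>j. Act j (Some 3) Stay) [1..<K]"

text \<open>Each input cell is erased after copying, because the whole contents of tape 0 on halting
  is the output.\<close>

definition copy_input :: "instr list" where
  "copy_input = While 0 {1, 2}
     (Cond 0 {1} [Act 1 (Some 1) Right] [Act 1 (Some 2) Right] @ [Act 0 (Some 0) Right])"

text \<open>Tape 0 has no mark. After copying, head 1 is one cell ahead of head 0; once this lead is
  removed, both return in step and the mark on tape 1 stops both at cell 0.\<close>

definition rewind :: "instr list" where
  "rewind = [Act 1 None Left] @ While 1 (- {3}) ([Act 1 None Left] @ [Act 0 None Left])"

lemma runs_marks:
  "runs (marks K) \<tau> (K - 1)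
     (\<lambda>j. if 1 \<le> j \<and> j < K then act_tape (Some 3) Stay (\<tau> j) else \<tau> j)"
proof (induction K)
  case 0
  then show ?case by (simp add: marks_def runs_Nil)
next
  case (Suc K)
  show ?case
  proof (cases "K = 0")
    case True
    have "(\<lambda>j. if 1 \<le> j \<and> j < Suc 0 then act_tape (Some 3) Stay (\<tau> j) else \<tau> j) = \<tau>"
      by auto
    then show ?thesis using True by (simp add: marks_def runs_Nil)
  next
    case False
    then have eq: "marks (Suc K) = marks K @ [Act K (Some 3) Stay]" "Suc K - 1 = (K - 1) + 1"
      by (simp_all add: marks_def)
    let ?\<tau> = "\<lambda>j. if 1 \<le> j \<and> j < K then act_tape (Some 3) Stay (\<tau> j) else \<tau> j"
    have "?\<tau>(K := act_tape (Some 3) Stay (?\<tau> K)) =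
        (\<lambda>j. if 1 \<le> j \<and> j < Suc K then act_tape (Some 3) Stay (\<tau> j) else \<tau> j)"
      using False by (auto simp: fun_eq_iff less_Suc_eq)
    then show ?thesis
      using runs_append [OF Suc runs_Act [of K "Some 3" Stay]] unfolding eq by metis
  qed
qed

definition copying :: "bool list \<Rightarrow> nat \<Rightarrow> nat \<Rightarrow> tape" where
  "copying x i j =
     (if j = 0 then (\<lambda>p. if p < int i then 0 else contents x p, int i)
      else if j = 1 then (\<lambda>p. if p \<le> int i then mark x 1 p else 0, int i + 1)
      else ((\<lambda>_. 0)(0 := 3), 0))"

lemma runs_copy_input:
  assumes "i \<le> length x"
  shows "\<exists>t \<le> (length x - i) * 6 + 1. runs copy_input (copying x i) t (copying x (length x))"
  using assms
proof (induction i rule: inc_induct)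
  case base
  have "runs copy_input (copying x (length x)) 1 (copying x (length x))"
    unfolding copy_input_def
    by (intro runs_While_stop) (simp add: copying_def contents_def)
  then show ?case
    by (intro exI [of _ 1] conjI) (simp, assumption)
next
  case (step i)
  obtain t where t: "t \<le> (length x - Suc i) * 6 + 1" "runs copy_input (copying x (Suc i)) t (copying x (length x))"
    using step by blast
  define b where "b = x ! i"
  have c: "contents x (int i) = (if b then 2 else 1)"
    using step by (simp add: contents_def b_def)
  let ?\<tau> = "\<lambda>b. (copying x i)(1 := act_tape (Some (if b then 2 else 1)) Right (copying x i 1))"
  have "\<exists>t \<le> 3. runs (Cond 0 {1} [Act 1 (Some 1) Right] [Act 1 (Some 2) Right]) (copying x i) t (?\<tau> b)"
  proof (cases b)
    case True
    have "runs (Cond 0 {1} [Act 1 (Some 1) Right] [Act 1 (Some 2) Right]) (copying x i) (1 + 1) (?\<tau> True)"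
      using c True runs_Act [of 1 "Some 2" Right "copying x i"]
      by (intro runs_Cond_false) (simp_all add: copying_def)
    then show ?thesis using True by (intro exI [of _ "1 + 1"]) simp
  next
    case False
    have "runs (Cond 0 {1} [Act 1 (Some 1) Right] [Act 1 (Some 2) Right]) (copying x i) (1 + 2) (?\<tau> False)"
      using c False runs_Act [of 1 "Some 1" Right "copying x i"]
      by (intro runs_Cond_true) (simp_all add: copying_def)
    then show ?thesis using False by (intro exI [of _ "1 + 2"]) simp
  qed
  then obtain u where u: "u \<le> 3"
    "runs (Cond 0 {1} [Act 1 (Some 1) Right] [Act 1 (Some 2) Right]) (copying x i) u (?\<tau> b)"
    by blast
  have "mark x 1 (int i + 1) = (if b then 2 else 1)"
    using c by (simp add: mark_def)
  then have "(?\<tau> b)(0 := act_tape (Some 0) Right (?\<tau> b 0)) = copying x (Suc i)"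
    by (auto simp: copying_def act_tape_def fun_eq_iff)
  then have "runs (Cond 0 {1} [Act 1 (Some 1) Right] [Act 1 (Some 2) Right] @ [Act 0 (Some 0) Right])
      (copying x i) (u + 1) (copying x (Suc i))"
    using runs_append [OF u(2) runs_Act [of 0 "Some 0" Right]] by metis
  then have "runs copy_input (copying x i) (u + 1 + t + 2) (copying x (length x))"
    using t(2) c unfolding copy_input_def by (intro runs_While_step) (simp_all add: copying_def)
  moreover have "u + 1 + t + 2 \<le> (length x - i) * 6 + 1"
    using t(1) u(1) step by (simp add: Suc_diff_Suc [symmetric])
  ultimately show ?case by blast
qed

definition rewinding :: "bool list \<Rightarrow> nat \<Rightarrow> nat \<Rightarrow> tape" where
  "rewinding x i j = (if j = 0 then (\<lambda>_. 0, int i) else (mark x j, if j = 1 then int i else 0))"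

lemma runs_rewind_loop:
  "\<exists>t \<le> i * 4 + 1. runs (While 1 (- {3}) ([Act 1 None Left] @ [Act 0 None Left]))
     (rewinding x i) t (rewinding x 0)"
proof (induction i)
  case 0
  have "runs (While 1 (- {3}) ([Act 1 None Left] @ [Act 0 None Left])) (rewinding x 0) 1 (rewinding x 0)"
    by (intro runs_While_stop) (simp add: rewinding_def mark_eq_3_iff)
  then show ?case by (intro exI [of _ 1] conjI) (simp, assumption)
next
  case (Suc i)
  obtain t where t: "t \<le> i * 4 + 1" "runs (While 1 (- {3}) ([Act 1 None Left] @ [Act 0 None Left]))
     (rewinding x i) t (rewinding x 0)"
    using Suc by blast
  let ?\<tau> = "(rewinding x (Suc i))(1 := act_tape None Left (rewinding x (Suc i) 1))"
  have "?\<tau>(0 := act_tape None Left (?\<tau> 0)) = rewinding x i"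
    by (auto simp: rewinding_def act_tape_def fun_eq_iff)
  then have "runs ([Act 1 None Left] @ [Act 0 None Left]) (rewinding x (Suc i)) (1 + 1) (rewinding x i)"
    using runs_append [OF runs_Act [of 1 None Left "rewinding x (Suc i)"] runs_Act [of 0 None Left]] by metis
  then have "runs (While 1 (- {3}) ([Act 1 None Left] @ [Act 0 None Left]))
     (rewinding x (Suc i)) (1 + 1 + t + 2) (rewinding x 0)"
    using t(2) by (intro runs_While_step) (simp_all add: rewinding_def mark_eq_3_iff)
  then show ?case
    using t(1) by (intro exI [of _ "1 + 1 + t + 2"] conjI) simp_all
qed

definition setup_prog :: "nat \<Rightarrow> instr list" where
  "setup_prog K = marks K @ [Act 1 None Right] @ copy_input @ rewind"

text \<open>Tapes from number \<open>K\<close> on are never touched; giving them the form of counter tapes makes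
  the final configuration uniform.\<close>

definition start_tapes :: "nat \<Rightarrow> bool list \<Rightarrow> nat \<Rightarrow> tape" where
  "start_tapes K x j =
     (if j = 0 then (contents x, 0) else if j < K then (\<lambda>_. 0, 0) else ((\<lambda>_. 0)(0 := 3), 0))"

lemma runs_setup_prog:
  assumes K: "K \<ge> 2"
  shows "\<exists>t \<le> K + 3 + length x * 10. runs (setup_prog K) (start_tapes K x) t (stk x [] [])"
proof -
  let ?\<tau> = "\<lambda>j. if 1 \<le> j \<and> j < K then act_tape (Some 3) Stay (start_tapes K x j) else start_tapes K x j"
  have 1: "runs (marks K) (start_tapes K x) (K - 1) ?\<tau>"
    by (rule runs_marks)
  have "?\<tau>(1 := act_tape None Right (?\<tau> 1)) = copying x 0"
    using K by (auto simp: copying_def start_tapes_def act_tape_def mark_def contents_def fun_eq_iff)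
  then have 2: "runs [Act 1 None Right] ?\<tau> 1 (copying x 0)"
    using runs_Act [of 1 None Right ?\<tau>] by metis
  obtain t where t: "t \<le> length x * 6 + 1" "runs copy_input (copying x 0) t (copying x (length x))"
    using runs_copy_input [of 0 x] by auto
  have "(copying x (length x))(1 := act_tape None Left (copying x (length x) 1)) = rewinding x (length x)"
    by (auto simp: copying_def rewinding_def act_tape_def mark_def contents_def fun_eq_iff)
  then have 3: "runs [Act 1 None Left] (copying x (length x)) 1 (rewinding x (length x))"
    using runs_Act [of 1 None Left "copying x (length x)"] by metis
  obtain u where u: "u \<le> length x * 4 + 1"
    "runs (While 1 (- {3}) ([Act 1 None Left] @ [Act 0 None Left])) (rewinding x (length x)) u (rewinding x 0)"
    using runs_rewind_loop by blast
  have 4: "rewinding x 0 = stk x [] []"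
    by (auto simp: rewinding_def cfg_def regs_def contents_def fun_eq_iff)
  have "runs (setup_prog K) (start_tapes K x) (K - 1 + (1 + (t + (1 + u)))) (stk x [] [])"
    using runs_append [OF 1 runs_append [OF 2 runs_append [OF t(2) runs_append [OF 3 u(2)]]]] 4
    by (simp add: setup_prog_def rewind_def)
  then show ?thesis
    using t(1) u(1) K by (intro exI [of _ "K - 1 + (1 + (t + (1 + u)))"]) simp
qed

lemma emits_poly_time_computable:
  assumes "emits 0 (\<lambda>x e. f x)"
  shows "poly_time_computable 1 (\<lambda>xs. f (xs ! 0))"
proof -
  obtain P p where P: "\<And>x w. \<exists>t \<le> poly p (sz x []). runs P (stk x w []) t (stk x (w @ f x) [])"
    using assms unfolding emits_def by auto
  \<comment> \<open>Sums bound the finitely many tape numbers and symbols of the program; the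
    constants provide for tapes 0 and 1 and for symbols up to the mark 3.\<close>
  define K where "K = 2 + sum_list (map instr_tape P)"
  define prog where "prog = setup_prog K @ P"
  define G where "G = 4 + sum_list (map instr_symbol prog)"
  let ?M = "prog_machine K G prog"
  have tape_P: "instr_tape i < K" if "i \<in> set P" for i
    using member_le_sum_list [of "instr_tape i" "map instr_tape P"] that by (simp add: K_def)
  have tape: "instr_tape i < K" if "i \<in> set prog" for i
    using that tape_P
    by (auto simp: prog_def setup_prog_def marks_def copy_input_def rewind_def While_def Cond_def
        instr_tape_def K_def)
  have symbol: "instr_symbol i < G" if "i \<in> set prog" for i
    using member_le_sum_list [of "instr_symbol i" "map instr_symbol prog"] that by (simp add: G_def)
  have wf: "well_formed ?M"
    by (rule well_formed_prog_machine) (use symbol in \<open>auto simp: K_def G_def\<close>)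
  have "\<exists>t \<le> poly (p + [:K + 3, 10:]) (sum_list (map length xs)). halts_with_output ?M xs t (f (xs ! 0))"
    if xs: "length xs = 1" for xs
  proof -
    obtain x where x: "xs = [x]"
      using xs by (cases xs) auto
    obtain t where t: "t \<le> K + 3 + length x * 10" "runs (setup_prog K) (start_tapes K x) t (stk x [] [])"
      using runs_setup_prog [of K x] by (auto simp: K_def)
    obtain u where u: "u \<le> poly p (length x)" "runs P (stk x [] []) u (stk x (f x) [])"
      using P [of x "[]"] by (auto simp: sz_def)
    have "runs prog (start_tapes K x) (t + u) (stk x (f x) [])"
      unfolding prog_def by (rule runs_append [OF t(2) u(2)])
    from this [unfolded runs_def, rule_format, of "[]" "[]"]
    have steps: "(pstep prog ^^ (t + u)) (0, start_tapes K x) = (length prog, stk x (f x) [])"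
      by simp
    have init: "initial_config ?M xs = (0, map (start_tapes K x) [0..<K])"
      by (auto simp: initial_config_def prog_machine_def x start_tapes_def contents_def fun_eq_iff)
    have "(step ?M ^^ (t + u)) (initial_config ?M xs) = (length prog, map (stk x (f x) []) [0..<K])"
      using steps_prog_machine [OF tape, where q = 0 and t = "t + u" and \<tau> = "start_tapes K x" and G = G]
      by (simp only: init steps prod.case)
    moreover have "0 < K"
      by (simp add: K_def)
    ultimately have "halts_with_output ?M xs (t + u) (f x)"
      by (simp add: halts_with_output_def prog_machine_def cfg_def)
    moreover have "t + u \<le> poly (p + [:K + 3, 10:]) (sum_list (map length xs))"
      using t(1) u(1) x by simp
    ultimately show ?thesis
      using x by auto
  qed
  then show ?thesis
    unfolding poly_time_computable_def
    by (intro exI [of _ ?M] exI [of _ "p + [:K + 3, 10:]"]) (use wf in \<open>auto simp: prog_machine_def K_def\<close>)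
qed

section \<open>Spherical equations and linear systems\<close>

text \<open>Coordinates on the wreath product: top component and the values at the two elements of
  the group of order 2. \<open>u\<close> and \<open>v\<close> are arbitrary functions cut off at
  \<open>n\<close>, so that equality has to be tested below \<open>n\<close> only.\<close>

definition elt :: "nat \<Rightarrow> int \<Rightarrow> (nat \<Rightarrow> int) \<Rightarrow> (nat \<Rightarrow> int) \<Rightarrow> int \<times> (int \<Rightarrow> nat \<Rightarrow> int)" where
  "elt n d u v = (d, \<lambda>x\<in>{0..<2}. \<lambda>i\<in>{..<n}. if x = 0 then u i else v i)"

lemmas wreath_simps = wreath_def free_abelian_power_def carrier_integer_mod_group
  mult_integer_mod_group one_integer_mod_group

lemma atLeastLessThan_0_2: "{0..<2} = {0, 1 :: int}"
  by auto

lemma elt_eq_iff: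
  "elt n d u v = elt n d' u' v' \<longleftrightarrow> d = d' \<and> (\<forall>i<n. u i = u' i \<and> v i = v' i)" (is "?L \<longleftrightarrow> ?R")
proof
  assume L: ?L
  have "u i = u' i" "v i = v' i" if "i < n" for i
  proof -
    have "snd (elt n d u v) 0 i = snd (elt n d' u' v') 0 i"
      "snd (elt n d u v) 1 i = snd (elt n d' u' v') 1 i"
      using L by simp_all
    then show "u i = u' i" "v i = v' i"
      using that by (simp_all add: elt_def)
  qed
  then show ?R
    using L by (simp add: elt_def)
qed (auto simp: elt_def restrict_def fun_eq_iff)

lemma elt_in_carrier: "d \<in> {0, 1} \<Longrightarrow> elt n d u v \<in> carrier (Zn_wr_Z2 n)"
  by (auto simp: wreath_simps elt_def atLeastLessThan_0_2)

lemma carrier_elt: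
  assumes "z \<in> carrier (Zn_wr_Z2 n)"
  obtains d u v where "d \<in> {0, 1}" "z = elt n d u v"
proof -
  obtain d f where z: "z = (d, f)" by (cases z)
  have d: "d \<in> {0, 1}" and f: "f \<in> {0, 1} \<rightarrow>\<^sub>E ({..<n} \<rightarrow>\<^sub>E UNIV)"
    using assms by (auto simp: wreath_simps z atLeastLessThan_0_2)
  have ff: "f x \<in> {..<n} \<rightarrow>\<^sub>E UNIV" if "x \<in> {0, 1}" for x
    using f that by blast
  have "f = (\<lambda>x\<in>{0..<2}. \<lambda>i\<in>{..<n}. if x = 0 then f 0 i else f 1 i)"
  proof
    fix x
    show "f x = (\<lambda>x\<in>{0..<2}. \<lambda>i\<in>{..<n}. if x = 0 then f 0 i else f 1 i) x"
    proof (cases "x \<in> {0, 1}")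
      case True
      then show ?thesis
        using ff [OF True] by (auto simp: fun_eq_iff restrict_def PiE_iff extensional_def)
    next
      case False
      then show ?thesis
        using f by (auto simp: restrict_def PiE_iff extensional_def)
    qed
  qed
  then have "z = elt n d (f 0) (f 1)"
    unfolding elt_def z by blast
  with d that show thesis by blast
qed

lemma elt_mult:
  assumes "d \<in> {0, 1}" "e \<in> {0, 1}"
  shows "elt n d u v \<otimes>\<^bsub>Zn_wr_Z2 n\<^esub> elt n e u' v' =
    elt n ((d + e) mod 2) (\<lambda>i. (if e = 0 then u i else v i) + u' i) (\<lambda>i. (if e = 0 then v i else u i) + v' i)"
  using assms by (auto simp: wreath_simps elt_def restrict_def fun_eq_iff atLeastLessThan_0_2)

lemma elt_one: "\<one>\<^bsub>Zn_wr_Z2 n\<^esub> = elt n 0 (\<lambda>_. 0) (\<lambda>_. 0)"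
  by (auto simp: wreath_simps elt_def restrict_def fun_eq_iff)

text \<open>As the base group is abelian, the part \<open>a\<close>, \<open>b\<close> of the
  conjugator cancels, and its top component exchanges the two values. This is the source of the
  binary choices.\<close>

lemma elt_conj:
  assumes "d \<in> {0, 1}"
  shows "inv\<^bsub>Zn_wr_Z2 n\<^esub> (elt n d a b) \<otimes>\<^bsub>Zn_wr_Z2 n\<^esub> elt n 0 u v \<otimes>\<^bsub>Zn_wr_Z2 n\<^esub> elt n d a b =
    (if d = 0 then elt n 0 u v else elt n 0 v u)"
proof -
  interpret group "Zn_wr_Z2 n" by (rule group_Zn_wr_Z2)
  let ?c' = "if d = 0 then elt n 0 u v else elt n 0 v u"
  have "elt n 0 u v \<otimes>\<^bsub>Zn_wr_Z2 n\<^esub> elt n d a b = elt n d a b \<otimes>\<^bsub>Zn_wr_Z2 n\<^esub> ?c'"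
    using assms by (auto simp: elt_mult elt_eq_iff add.commute)
  moreover have "elt n d a b \<in> carrier (Zn_wr_Z2 n)" "elt n 0 u v \<in> carrier (Zn_wr_Z2 n)"
    "?c' \<in> carrier (Zn_wr_Z2 n)"
    using assms by (auto intro: elt_in_carrier)
  ultimately show ?thesis
    by (simp add: m_assoc inv_solve_left')
qed

lemma list_prod_elt:
  "list_prod (Zn_wr_Z2 n) (map (\<lambda>j. elt n 0 (u j) (v j)) js) =
     elt n 0 (\<lambda>i. \<Sum>j\<leftarrow>js. u j i) (\<lambda>i. \<Sum>j\<leftarrow>js. v j i)"
  by (induction js) (simp_all add: list_prod_def elt_one elt_mult)

lemma list_prod_append:
  assumes "set xs \<subseteq> carrier (Zn_wr_Z2 n)" "set ys \<subseteq> carrier (Zn_wr_Z2 n)"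
  shows "list_prod (Zn_wr_Z2 n) (xs @ ys) = list_prod (Zn_wr_Z2 n) xs \<otimes>\<^bsub>Zn_wr_Z2 n\<^esub> list_prod (Zn_wr_Z2 n) ys"
proof -
  interpret group "Zn_wr_Z2 n" by (rule group_Zn_wr_Z2)
  have c: "list_prod (Zn_wr_Z2 n) zs \<in> carrier (Zn_wr_Z2 n)" if "set zs \<subseteq> carrier (Zn_wr_Z2 n)" for zs
    using that by (induction zs) (auto simp: list_prod_def)
  from assms(1) show ?thesis
  proof (induction xs)
    case Nil
    then show ?case using c [OF assms(2)] by (simp add: list_prod_def)
  next
    case (Cons x xs)
    then show ?case using c [of xs] c [OF assms(2)] by (simp add: list_prod_def m_assoc)
  qed
qed

text \<open>By \<open>elt_conj\<close> an unknown matters only through its top component; True in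
  \<open>ss\<close> means that the two values are exchanged.\<close>

lemma spherical_solvable_elt_iff:
  "spherical_solvable (Zn_wr_Z2 n) (map (\<lambda>(u, v). elt n 0 u v) ps) \<longleftrightarrow>
     (\<exists>ss. length ss = length ps \<and>
       (\<forall>i<n. (\<Sum>((u, v), s)\<leftarrow>zip ps ss. if s then v i else u i) = 0 \<and>
              (\<Sum>((u, v), s)\<leftarrow>zip ps ss. if s then u i else v i) = 0))" (is "?L \<longleftrightarrow> ?R")
proof -
  let ?G = "Zn_wr_Z2 n"
  let ?cs = "map (\<lambda>(u, v). elt n 0 u v) ps"
  have main: "list_prod ?G (map2 (\<lambda>z c. inv\<^bsub>?G\<^esub> z \<otimes>\<^bsub>?G\<^esub> c \<otimes>\<^bsub>?G\<^esub> z) zs ?cs) =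
      elt n 0 (\<lambda>i. \<Sum>((u, v), s)\<leftarrow>zip ps ss. if s then v i else u i)
              (\<lambda>i. \<Sum>((u, v), s)\<leftarrow>zip ps ss. if s then u i else v i)"
    if l: "length zs = length ps" "length ss = length ps"
      and z: "\<And>j. j < length ps \<Longrightarrow> \<exists>d a b. d \<in> {0, 1} \<and> zs ! j = elt n d a b \<and> (d = 1 \<longleftrightarrow> ss ! j)" for zs ss
  proof -
    have "map2 (\<lambda>z c. inv\<^bsub>?G\<^esub> z \<otimes>\<^bsub>?G\<^esub> c \<otimes>\<^bsub>?G\<^esub> z) zs ?cs =
        map (\<lambda>((u, v), s). elt n 0 (\<lambda>i. if s then v i else u i) (\<lambda>i. if s then u i else v i)) (zip ps ss)"
    proof (rule nth_equalityI)
      fix j assume "j < length (map2 (\<lambda>z c. inv\<^bsub>?G\<^esub> z \<otimes>\<^bsub>?G\<^esub> c \<otimes>\<^bsub>?G\<^esub> z) zs ?cs)"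
      then have j: "j < length ps" using l by simp
      obtain u v where uv: "ps ! j = (u, v)" by fastforce
      obtain d a b where "d \<in> {0, 1}" "zs ! j = elt n d a b" "d = 1 \<longleftrightarrow> ss ! j"
        using z [OF j] by blast
      then show "map2 (\<lambda>z c. inv\<^bsub>?G\<^esub> z \<otimes>\<^bsub>?G\<^esub> c \<otimes>\<^bsub>?G\<^esub> z) zs ?cs ! j =
         map (\<lambda>((u, v), s). elt n 0 (\<lambda>i. if s then v i else u i) (\<lambda>i. if s then u i else v i)) (zip ps ss) ! j"
        using j l uv by (auto simp: elt_conj)
    qed (use l in simp)
    also have "\<dots> = map (\<lambda>p. elt n 0 ((\<lambda>((u, v), s) i. if s then v i else u i) p)
        ((\<lambda>((u, v), s) i. if s then u i else v i) p)) (zip ps ss)"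
      by (intro map_cong) auto
    finally have eq: "map2 (\<lambda>z c. inv\<^bsub>?G\<^esub> z \<otimes>\<^bsub>?G\<^esub> c \<otimes>\<^bsub>?G\<^esub> z) zs ?cs = \<dots>" .
    show ?thesis
      unfolding eq list_prod_elt by (simp add: case_prod_unfold)
  qed
  show ?thesis
  proof
    assume ?L
    then obtain zs where zs: "length zs = length ps" "set zs \<subseteq> carrier ?G"
      "list_prod ?G (map2 (\<lambda>z c. inv\<^bsub>?G\<^esub> z \<otimes>\<^bsub>?G\<^esub> c \<otimes>\<^bsub>?G\<^esub> z) zs ?cs) = \<one>\<^bsub>?G\<^esub>"
      unfolding spherical_solvable_def by auto
    let ?ss = "map (\<lambda>z. fst z = 1) zs"
    have "\<exists>d a b. d \<in> {0, 1} \<and> zs ! j = elt n d a b \<and> (d = 1 \<longleftrightarrow> ?ss ! j)" if "j < length ps" for j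
    proof -
      have "zs ! j \<in> carrier ?G" using that zs by auto
      then obtain d a b where "d \<in> {0, 1}" "zs ! j = elt n d a b" by (rule carrier_elt)
      then show ?thesis using that zs(1) by (auto simp: elt_def)
    qed
    then show ?R
      using main [of zs ?ss] zs by (intro exI [of _ ?ss]) (simp add: elt_one elt_eq_iff)
  next
    assume ?R
    then obtain ss where ss: "length ss = length ps"
       "\<forall>i<n. (\<Sum>((u, v), s)\<leftarrow>zip ps ss. if s then v i else u i) = 0 \<and>
              (\<Sum>((u, v), s)\<leftarrow>zip ps ss. if s then u i else v i) = 0" by blast
    let ?zs = "map (\<lambda>s. elt n (if s then 1 else 0) (\<lambda>_. 0) (\<lambda>_. 0)) ss"
    have "list_prod ?G (map2 (\<lambda>z c. inv\<^bsub>?G\<^esub> z \<otimes>\<^bsub>?G\<^esub> c \<otimes>\<^bsub>?G\<^esub> z) ?zs ?cs) = \<one>\<^bsub>?G\<^esub>"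
      using ss by (subst main [of ?zs ss]) (auto simp: elt_one elt_eq_iff)
    moreover have "set ?zs \<subseteq> carrier ?G"
      by (auto intro: elt_in_carrier)
    ultimately show ?L
      unfolding spherical_solvable_def using ss(1) by (intro exI [of _ ?zs]) simp
  qed
qed

text \<open>The sign True stands for minus.\<close>

definition vec_of :: "('r \<times> bool) list \<Rightarrow> 'r \<Rightarrow> int" where
  "vec_of c r = (\<Sum>(r', s)\<leftarrow>c. if r' = r then (if s then -1 else 1) else 0)"

text \<open>The exclusive or of the signs lets \<open>s\<close> negate the whole vector.\<close>

definition base_word :: "bool \<Rightarrow> (nat \<times> bool) list \<Rightarrow> letter list" where
  "base_word s c = map (\<lambda>(i, s'). Base i (s' \<noteq> s)) c"

lemma vec_of_simps [simp]:
  "vec_of [] r = 0"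
  "vec_of ((r', s) # c) r = (if r' = r then (if s then -1 else 1) else 0) + vec_of c r"
  "vec_of (c @ c') r = vec_of c r + vec_of c' r"
  by (simp_all add: vec_of_def)

lemma letter_value_Base:
  assumes "i < n"
  shows "letter_value n (Base i s) = elt n 0 (vec_of [(i, s)]) (\<lambda>_. 0)"
proof -
  interpret group "Zn_wr_Z2 n" by (rule group_Zn_wr_Z2)
  have base: "wreath_base (free_abelian_power n) (integer_mod_group 2) (unit_vector n i) =
      elt n 0 (\<lambda>j. if i = j then 1 else 0) (\<lambda>_. 0)"
    by (auto simp: wreath_base_def wreath_simps elt_def unit_vector_def restrict_def fun_eq_iff)
  have "inv\<^bsub>Zn_wr_Z2 n\<^esub> (elt n 0 (\<lambda>j. if i = j then 1 else 0) (\<lambda>_. 0)) =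
      elt n 0 (\<lambda>j. if i = j then -1 else 0) (\<lambda>_. 0)"
    by (rule inv_equality) (auto simp: elt_mult elt_one elt_eq_iff intro: elt_in_carrier)
  with base show ?thesis
    by (auto simp: Let_def elt_eq_iff)
qed

lemma letter_value_Top: "letter_value n (Top False) = elt n 1 (\<lambda>_. 0) (\<lambda>_. 0)"
  by (auto simp: Let_def wreath_top_def wreath_simps elt_def restrict_def fun_eq_iff)

lemma word_value_base_word:
  assumes "\<forall>(i, s) \<in> set c. i < n"
  shows "word_value n (base_word s c) = elt n 0 (\<lambda>i. if s then - vec_of c i else vec_of c i) (\<lambda>_. 0)"
  using assms
proof (induction c)
  case Nil
  then show ?case by (simp add: word_value_def base_word_def list_prod_def elt_one elt_eq_iff)
next
  case (Cons p c)
  obtain i s' where p: "p = (i, s')" by (cases p)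
  have "i < n" using Cons(2) p by simp
  moreover have "word_value n (base_word s (p # c)) =
      letter_value n (Base i (s' \<noteq> s)) \<otimes>\<^bsub>Zn_wr_Z2 n\<^esub> word_value n (base_word s c)"
    by (simp add: word_value_def base_word_def list_prod_def p)
  moreover have "word_value n (base_word s c) = elt n 0 (\<lambda>i. if s then - vec_of c i else vec_of c i) (\<lambda>_. 0)"
    using Cons by auto
  ultimately show ?case
    by (auto simp: letter_value_Base elt_mult elt_eq_iff p simp del: letter_value.simps)
qed

lemma valid_letter_value: "valid_letter n l \<Longrightarrow> letter_value n l \<in> carrier (Zn_wr_Z2 n)"
proof -
  interpret group "Zn_wr_Z2 n" by (rule group_Zn_wr_Z2)
  assume "valid_letter n l"
  moreover have "elt n 1 (\<lambda>_. 0) (\<lambda>_. 0) \<in> carrier (Zn_wr_Z2 n)"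
    by (simp add: elt_in_carrier)
  ultimately show ?thesis
    using letter_value_Top [of n]
    by (cases l) (auto simp: letter_value_Base Let_def elt_in_carrier split: if_splits simp del: letter_value.simps(1))
qed

lemma word_value_append:
  assumes "\<forall>l \<in> set w. valid_letter n l" "\<forall>l \<in> set w'. valid_letter n l"
  shows "word_value n (w @ w') = word_value n w \<otimes>\<^bsub>Zn_wr_Z2 n\<^esub> word_value n w'"
proof -
  have "set (map (letter_value n) v) \<subseteq> carrier (Zn_wr_Z2 n)" if "\<forall>l \<in> set v. valid_letter n l" for v
    unfolding set_map using that valid_letter_value by blast
  then show ?thesis
    unfolding word_value_def map_append using assms by (intro list_prod_append) blast+
qed

lemma word_value_Nil: "word_value n [] = elt n 0 (\<lambda>_. 0) (\<lambda>_. 0)"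
  by (simp add: word_value_def list_prod_def elt_one)

lemma word_value_Top:
  "word_value n (Top False # w) = elt n 1 (\<lambda>_. 0) (\<lambda>_. 0) \<otimes>\<^bsub>Zn_wr_Z2 n\<^esub> word_value n w"
  unfolding letter_value_Top [symmetric] by (simp add: word_value_def list_prod_def)

text \<open>The first word compensates for the sum of all columns, so that choosing a subset of the
  columns with sum \<open>b\<close> makes both components vanish.\<close>

definition system_words :: "('v \<Rightarrow> (nat \<times> bool) list) \<Rightarrow> 'v list \<Rightarrow> (nat \<times> bool) list \<Rightarrow> letter list list" where
  "system_words col vs b =
     (base_word True b @ [Top False] @ base_word False b @ base_word True (concat (map col vs)) @ [Top False])
       # map (\<lambda>v. base_word False (col v)) vs"

lemma vec_of_concat: "vec_of (concat cs) i = (\<Sum>c\<leftarrow>cs. vec_of c i)"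
  by (induction cs) simp_all

text \<open>Exchanged and unexchanged columns add up to the total, which the first word compensates,
  so both coordinates impose the same condition. If the first word is exchanged, the exchanged
  columns are the chosen ones, otherwise the unexchanged ones.\<close>

lemma spherical_solvable_system_words:
  assumes b: "\<forall>(i, s) \<in> set b. i < n"
    and col: "\<forall>v \<in> set vs. \<forall>(i, s) \<in> set (col v). i < n"
    and dist: "distinct vs"
  shows "spherical_solvable (Zn_wr_Z2 n) (map (word_value n) (system_words col vs b)) \<longleftrightarrow>
    (\<exists>y. \<forall>i<n. (\<Sum>v\<leftarrow>vs. if y v then vec_of (col v) i else 0) = vec_of b i)"
proof -
  let ?S = "\<lambda>i. \<Sum>v\<leftarrow>vs. vec_of (col v) i"
  have valid: "\<forall>l \<in> set (base_word s c). valid_letter n l" if "\<forall>(i, s) \<in> set c. i < n" for s c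
    using that by (auto simp: base_word_def)
  have concat: "\<forall>(i, s) \<in> set (concat (map col vs)). i < n"
    using col by auto
  \<comment> \<open>Between the two letters \<open>Top False\<close> a base element moves to the
    second coordinate; the letters cancel at the top, the generator having order 2.\<close>
  have c0: "word_value n (base_word True b @ [Top False] @ base_word False b @
      base_word True (concat (map col vs)) @ [Top False]) =
      elt n 0 (\<lambda>i. - vec_of b i) (\<lambda>i. vec_of b i - ?S i)"
    using valid [OF b] valid [OF concat]
    by (simp add: word_value_append [of _ n] ball_Un word_value_Top word_value_Nil word_value_base_word [OF b]
        word_value_base_word [OF concat] elt_mult elt_eq_iff vec_of_concat o_def)
  have cs: "map (word_value n) (system_words col vs b) =
      map (\<lambda>(u, v). elt n 0 u v)
        ((\<lambda>i. - vec_of b i, \<lambda>i. vec_of b i - ?S i) # map (\<lambda>v. (vec_of (col v), \<lambda>_. 0)) vs)"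
    unfolding system_words_def using c0 col by (simp add: word_value_base_word)
  have split: "(\<Sum>(v, s)\<leftarrow>zip vs ss. if s then 0 else vec_of (col v) i) +
      (\<Sum>(v, s)\<leftarrow>zip vs ss. if s then vec_of (col v) i else 0) = ?S i" if "length ss = length vs" for ss i
    using that by (induction ss vs rule: list_induct2) auto
  \<comment> \<open>As the variables are distinct, a list of choices can be read as a function of
    the variable.\<close>
  have pick: "\<exists>y. \<forall>i. (\<Sum>(v, s)\<leftarrow>zip vs ss. if s then vec_of (col v) i else 0) =
      (\<Sum>v\<leftarrow>vs. if y v then vec_of (col v) i else 0)" if l: "length ss = length vs" for ss
  proof -
    define y where "y v = the (map_of (zip vs ss) v)" for v
    have "y (vs ! j) = ss ! j" if "j < length vs" for j
      using that l dist by (simp add: y_def map_of_zip_nth)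
    then have "ss = map y vs"
      using l by (intro nth_equalityI) simp_all
    then have "(\<Sum>(v, s)\<leftarrow>zip vs ss. if s then vec_of (col v) i else 0) =
      (\<Sum>v\<leftarrow>vs. if y v then vec_of (col v) i else 0)" for i
      by (simp add: zip_map2 zip_same_conv_map o_def case_prod_unfold cong: if_cong)
    then show ?thesis by blast
  qed
  have zipm: "zip (map (\<lambda>v. (vec_of (col v), \<lambda>_. 0 :: int)) vs) ss = map (\<lambda>(v, s). ((vec_of (col v), \<lambda>_. 0), s)) (zip vs ss)" for ss :: "bool list"
    by (simp add: zip_map1 case_prod_unfold)
  let ?ps = "(\<lambda>i. - vec_of b i, \<lambda>i. vec_of b i - ?S i) # map (\<lambda>v. (vec_of (col v), \<lambda>_. 0)) vs"
  have sums: "(\<Sum>((u, v), s)\<leftarrow>zip ?ps (s0 # ss). if s then v i else u i) =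
      (if s0 then vec_of b i - ?S i else - vec_of b i) + (\<Sum>(v, s)\<leftarrow>zip vs ss. if s then 0 else vec_of (col v) i)"
    "(\<Sum>((u, v), s)\<leftarrow>zip ?ps (s0 # ss). if s then u i else v i) =
      (if s0 then - vec_of b i else vec_of b i - ?S i) + (\<Sum>(v, s)\<leftarrow>zip vs ss. if s then vec_of (col v) i else 0)"
    for s0 ss i
    by (simp_all add: zipm o_def case_prod_unfold cong: if_cong)
  have ex_Cons: "(\<exists>ss. length ss = length ?ps \<and> Q ss) \<longleftrightarrow> (\<exists>s0 ss. length ss = length vs \<and> Q (s0 # ss))"
    for Q :: "bool list \<Rightarrow> bool"
    by (auto simp: length_Suc_conv)
  show ?thesis
    unfolding cs spherical_solvable_elt_iff ex_Cons sums
  proof (safe)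
    fix s0 ss
    assume l: "length ss = length vs" and eq: "\<forall>i<n.
      (if s0 then vec_of b i - ?S i else - vec_of b i) + (\<Sum>(v, s)\<leftarrow>zip vs ss. if s then 0 else vec_of (col v) i) = 0 \<and>
      (if s0 then - vec_of b i else vec_of b i - ?S i) + (\<Sum>(v, s)\<leftarrow>zip vs ss. if s then vec_of (col v) i else 0) = 0"
    show "\<exists>y. \<forall>i<n. (\<Sum>v\<leftarrow>vs. if y v then vec_of (col v) i else 0) = vec_of b i"
    proof (cases s0)
      case True
      then have "(\<Sum>(v, s)\<leftarrow>zip vs ss. if s then vec_of (col v) i else 0) = vec_of b i" if "i < n" for i
        using eq that by simp
      then show ?thesis using pick [OF l] by metis
    next
      case False
      have "zip vs (map Not ss) = map (\<lambda>(v, s). (v, \<not> s)) (zip vs ss)"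
        by (simp add: zip_map2)
      moreover have if_Not: "(if \<not> s then a else 0) = (if s then 0 else a)" for s and a :: int
        by simp
      ultimately have "(\<Sum>(v, s)\<leftarrow>zip vs (map Not ss). if s then vec_of (col v) i else 0) = vec_of b i"
        if "i < n" for i
        using eq that False by (simp add: o_def case_prod_unfold if_Not cong: if_cong)
      moreover have "length (map Not ss) = length vs"
        using l by simp
      ultimately show ?thesis using pick [of "map Not ss"] by metis
    qed
  next
    fix y assume y: "\<forall>i<n. (\<Sum>v\<leftarrow>vs. if y v then vec_of (col v) i else 0) = vec_of b i"
    let ?ss = "map y vs"
    have z: "zip vs ?ss = map (\<lambda>v. (v, y v)) vs"
      by (simp add: zip_map2 zip_same_conv_map)
    have eq: "(\<Sum>(v, s)\<leftarrow>zip vs ?ss. if s then vec_of (col v) i else 0) = vec_of b i" if "i < n" for i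
      using y that by (simp add: z o_def cong: if_cong)
    have "(\<Sum>(v, s)\<leftarrow>zip vs ?ss. if s then 0 else vec_of (col v) i) = ?S i - vec_of b i" if "i < n" for i
      using split [of ?ss i] eq [OF that] by simp
    then show "\<exists>s0 ss. length ss = length vs \<and> (\<forall>i<n.
      (if s0 then vec_of b i - ?S i else - vec_of b i) + (\<Sum>(v, s)\<leftarrow>zip vs ss. if s then 0 else vec_of (col v) i) = 0 \<and>
      (if s0 then - vec_of b i else vec_of b i - ?S i) + (\<Sum>(v, s)\<leftarrow>zip vs ss. if s then vec_of (col v) i else 0) = 0)"
      using eq by (intro exI [of _ True] exI [of _ ?ss]) simp
  qed
qed

section \<open>The linear system of a computation\<close>

lemma sum_list_rev_upt: "(\<Sum>i\<leftarrow>rev [0..<n]. f i) = (\<Sum>i<n. f i :: int)"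
  by (induction n) (simp_all add: add.commute)

lemma sum_list_upt: "(\<Sum>i\<leftarrow>[0..<n]. f i) = (\<Sum>i<n. f i :: int)"
  by (induction n) simp_all

lemma sum_list_concat_map:
  "(\<Sum>v\<leftarrow>concat (map f xs). g v) = (\<Sum>x\<leftarrow>xs. \<Sum>v\<leftarrow>f x. g v)"
  by (induction xs) simp_all

lemma vec_of_concat_map: "vec_of (concat (map f xs)) r = (\<Sum>x\<leftarrow>xs. vec_of (f x) r)"
  by (induction xs) simp_all

text \<open>Each row is a conservation law. \<open>St\<close>, \<open>Cont\<close>,
  \<open>Head\<close>: state, cell symbol and head position produced for time \<open>t\<close> are
  those consumed by step \<open>t\<close>. \<open>Link\<close>: a transition in use has one position
  on every tape. \<open>One\<close>: a certificate cell has one symbol. \<open>Mon\<close>: a unit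
  of flow enters at the length of the certificate and passes through all blank cells up to
  \<open>Q\<close>.\<close>

datatype row = St nat nat | Link nat nat nat | Cont nat nat nat nat | Head nat nat nat
  | One nat | Mon nat

datatype var = VA nat nat | VH nat nat nat nat | VN nat nat nat nat | VU nat nat | VS nat
  | FSt nat | FCont nat nat nat | FHead nat nat

text \<open>The 0-1 linear system describing \<open>T\<close> steps of a machine with \<open>k\<close> tapes whose transitions are
  numbered by \<open>{..<NA}\<close>; head moves are encoded by 0, 1, 2, and cells by their distance from the left
  end of a window of width \<open>W\<close> in which the heads start at \<open>org\<close>. The certificate occupies the cells
  of tape 1 from \<open>org\<close> to \<open>org + Q - 1\<close>.

  \<open>VA t a\<close>: transition \<open>a\<close> is used at time \<open>t\<close>. \<open>VH t j p a\<close>: moreover head \<open>j\<close> is at \<open>p\<close>.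
  \<open>VN t j p s\<close>: head \<open>j\<close> is not at \<open>p\<close>, where symbol \<open>s\<close> is written. \<open>VU i s\<close>: symbol \<open>i\<close> of the
  certificate is \<open>s\<close>. \<open>VS i\<close>: the certificate has length \<open>i\<close>. The remaining variables are slack
  for the rows at time \<open>T\<close>.\<close>

locale tableau =
  fixes k NA ns G T Q :: nat
    and src dst :: "nat \<Rightarrow> nat" and rd wr mv :: "nat \<Rightarrow> nat \<Rightarrow> nat"
    and x :: "bool list"
  assumes T: "0 < T" and k: "2 \<le> k" and G: "3 \<le> G"
    and src: "\<And>a. a < NA \<Longrightarrow> src a \<le> ns" and dst: "\<And>a. a < NA \<Longrightarrow> dst a \<le> ns"
    and rd: "\<And>a j. a < NA \<Longrightarrow> j < k \<Longrightarrow> rd a j < G"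
    and wr: "\<And>a j. a < NA \<Longrightarrow> j < k \<Longrightarrow> wr a j < G"
    and mv: "\<And>a j. a < NA \<Longrightarrow> j < k \<Longrightarrow> mv a j \<le> 2"
    and det: "\<And>a a'. a < NA \<Longrightarrow> a' < NA \<Longrightarrow> src a = src a' \<Longrightarrow> (\<And>j. j < k \<Longrightarrow> rd a j = rd a' j) \<Longrightarrow> a = a'"
begin

text \<open>A head moves at most \<open>T\<close> cells in either direction, hence the margins of
  width \<open>T + 1\<close> on both sides of the certificate region. Input cells beyond the window
  are out of reach.\<close>

abbreviation org :: nat where "org \<equiv> Suc T"
abbreviation W :: nat where "W \<equiv> org + (Q + org)"

text \<open>Moves are coded by 0, 1, 2, so the new position is \<open>p + mv a j - 1\<close>.
  \<open>Head\<close> rows are numbered one above the position, which avoids the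
  subtraction.\<close>

fun col :: "var \<Rightarrow> (row \<times> bool) list" where
  "col (VA t a) = [(St (Suc t) (dst a), False), (St t (src a), True)] @
     concat (map (\<lambda>j. [(Link t j a, True)]) [0..<k])"
| "col (VH t j p a) = [(Link t j a, False), (Cont (Suc t) j p (wr a j), False), (Cont t j p (rd a j), True),
     (Head (Suc t) j (p + mv a j), False), (Head t j (Suc p), True)]"
| "col (VN t j p s) = [(Cont (Suc t) j p s, False), (Cont t j p s, True)]"
| "col (VU i s) = [(Cont 0 1 (org + i) s, False), (One i, False)] @
     (if s = 0 then [(Mon (Suc i), False), (Mon i, True)] else [])"
| "col (VS i) = [(Mon i, False)]"
| "col (FSt q) = [(St T q, True)]"
| "col (FCont j p s) = [(Cont T j p s, True)]"
| "col (FHead j p) = [(Head T j p, True)]"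

definition vars :: "var list" where
  "vars =
     concat (map (\<lambda>t. concat (map (\<lambda>a. [VA t a]) [0..<NA])) (rev [0..<T])) @
     concat (map (\<lambda>t. concat (map (\<lambda>p. concat (map (\<lambda>j. concat (map (\<lambda>a. [VH t j p a]) [0..<NA])) [0..<k]))
       (rev [0..<W]))) (rev [0..<T])) @
     concat (map (\<lambda>t. concat (map (\<lambda>p. concat (map (\<lambda>j. concat (map (\<lambda>s. [VN t j p s]) [0..<G])) [0..<k]))
       (rev [0..<W]))) (rev [0..<T])) @
     concat (map (\<lambda>i. concat (map (\<lambda>s. [VU i s]) [0..<3])) (rev [0..<Q])) @
     concat (map (\<lambda>i. [VS i]) (rev [0..<Suc Q])) @
     concat (map (\<lambda>q. [FSt q]) [0..<Suc ns]) @
     concat (map (\<lambda>p. concat (map (\<lambda>j. concat (map (\<lambda>s. [FCont j p s]) [0..<G])) [0..<k])) (rev [0..<W])) @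
     concat (map (\<lambda>p. concat (map (\<lambda>j. [FHead j p]) [0..<k])) (rev [0..<W + 2]))"

text \<open>The initial data are negative, since they supply what step 0 consumes; certificate cells
  are omitted, being supplied by \<open>VU\<close>. The positive entry \<open>Cont T 0 org 2\<close>
  is acceptance: slack only subtracts, so some column has to produce symbol 2 in the first output
  cell.\<close>

definition rhs :: "(row \<times> bool) list" where
  "rhs =
     [(Cont T 0 org 2, False), (St 0 0, True), (Mon Q, False)] @
     concat (map (\<lambda>j. [(Head 0 j (Suc org), True)]) [0..<k]) @
     concat (map (\<lambda>i. [(One i, False)]) (rev [0..<Q])) @
     concat (map (\<lambda>i. concat (map (\<lambda>j. [(Cont 0 j i 0, True)]) [0..<k])) (rev [0..<org])) @
     concat (map (\<lambda>i. [(Cont 0 0 (org + i) (contents x (int i)), True)]) (rev [0..<Q + org])) @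
     concat (map (\<lambda>i. [(Cont 0 1 (org + (Q + i)) 0, True)]) (rev [0..<org])) @
     concat (map (\<lambda>i. concat (map (\<lambda>j. [(Cont 0 j (org + i) 0, True)]) [2..<k])) (rev [0..<Q + org]))"

definition solution :: "(var \<Rightarrow> bool) \<Rightarrow> bool" where
  "solution y \<longleftrightarrow> (\<forall>r. (\<Sum>v\<leftarrow>vars. if y v then vec_of (col v) r else 0) = vec_of rhs r)"

definition init :: "bool list \<Rightarrow> nat \<Rightarrow> nat \<Rightarrow> nat" where
  "init u j p = (if p < org then 0 else if j = 0 then contents x (int (p - org))
     else if j = 1 then contents u (int (p - org)) else 0)"

definition run :: "bool list \<Rightarrow> (nat \<Rightarrow> nat) \<Rightarrow> (nat \<Rightarrow> nat) \<Rightarrow> (nat \<Rightarrow> nat \<Rightarrow> nat \<Rightarrow> nat) \<Rightarrow> (nat \<Rightarrow> nat \<Rightarrow> nat) \<Rightarrow> bool" where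
  "run u q act c h \<longleftrightarrow>
     q 0 = 0 \<and> (\<forall>j<k. h 0 j = org) \<and> (\<forall>j<k. \<forall>p<W. c 0 j p = init u j p) \<and>
     (\<forall>t<T. act t < NA \<and> src (act t) = q t \<and> q (Suc t) = dst (act t) \<and>
        (\<forall>j<k. rd (act t) j = c t j (h t j) \<and> Suc (h (Suc t) j) = h t j + mv (act t) j \<and>
           (\<forall>p<W. c (Suc t) j p = (if p = h t j then wr (act t) j else c t j p))))"

text \<open>The coefficient at \<open>r\<close> of the formal unit vector \<open>r'\<close>. With
  \<open>r\<close> arbitrary but fixed, an identity between formal sums of rows becomes one between
  integers.\<close>

definition \<delta> :: "row \<Rightarrow> row \<Rightarrow> int" where
  "\<delta> r r' = (if r' = r then 1 else 0)"

definition z :: "(var \<Rightarrow> bool) \<Rightarrow> var \<Rightarrow> int" where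
  "z y v = (if y v then 1 else 0)"

lemma vec_of_\<delta>: "vec_of ((r', s) # c) r = (if s then - \<delta> r r' else \<delta> r r') + vec_of c r"
  by (simp add: \<delta>_def)

lemma vec_of_map_link: "vec_of (concat (map (\<lambda>j. [(f j, s)]) js)) r = (\<Sum>j\<leftarrow>js. if s then - \<delta> r (f j) else \<delta> r (f j))"
  by (induction js) (simp_all add: \<delta>_def)

lemma sum_vars:
  "(\<Sum>v\<leftarrow>vars. if y v then vec_of (col v) r else 0) =
     (\<Sum>t<T. \<Sum>a<NA. z y (VA t a) * (\<delta> r (St (Suc t) (dst a)) - \<delta> r (St t (src a)) - (\<Sum>j<k. \<delta> r (Link t j a)))) +
     (\<Sum>t<T. \<Sum>p<W. \<Sum>j<k. \<Sum>a<NA. z y (VH t j p a) * (\<delta> r (Link t j a) + (\<delta> r (Cont (Suc t) j p (wr a j)) -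
        \<delta> r (Cont t j p (rd a j))) + (\<delta> r (Head (Suc t) j (p + mv a j)) - \<delta> r (Head t j (Suc p))))) +
     (\<Sum>t<T. \<Sum>p<W. \<Sum>j<k. \<Sum>s<G. z y (VN t j p s) * (\<delta> r (Cont (Suc t) j p s) - \<delta> r (Cont t j p s))) +
     (\<Sum>i<Q. \<Sum>s<3. z y (VU i s) * (\<delta> r (Cont 0 1 (org + i) s) + \<delta> r (One i) +
        (if s = 0 then \<delta> r (Mon (Suc i)) - \<delta> r (Mon i) else 0))) +
     (\<Sum>i<Suc Q. z y (VS i) * \<delta> r (Mon i)) -
     (\<Sum>q<Suc ns. z y (FSt q) * \<delta> r (St T q)) -
     (\<Sum>p<W. \<Sum>j<k. \<Sum>s<G. z y (FCont j p s) * \<delta> r (Cont T j p s)) -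
     (\<Sum>p<W + 2. \<Sum>j<k. z y (FHead j p) * \<delta> r (Head T j p))"
proof -
  have if_z: "(if y v then a else 0) = z y v * a" for v a
    by (simp add: z_def)
  have cols:
    "vec_of (col (VA t a)) r = \<delta> r (St (Suc t) (dst a)) - \<delta> r (St t (src a)) - (\<Sum>j<k. \<delta> r (Link t j a))"
    "vec_of (col (VH t j p a)) r = \<delta> r (Link t j a) + (\<delta> r (Cont (Suc t) j p (wr a j)) -
        \<delta> r (Cont t j p (rd a j))) + (\<delta> r (Head (Suc t) j (p + mv a j)) - \<delta> r (Head t j (Suc p)))"
    "vec_of (col (VN t j p s)) r = \<delta> r (Cont (Suc t) j p s) - \<delta> r (Cont t j p s)"
    "vec_of (col (VU i s)) r = \<delta> r (Cont 0 1 (org + i) s) + \<delta> r (One i) +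
        (if s = 0 then \<delta> r (Mon (Suc i)) - \<delta> r (Mon i) else 0)"
    "vec_of (col (VS i)) r = \<delta> r (Mon i)" "vec_of (col (FSt q)) r = - \<delta> r (St T q)"
    "vec_of (col (FCont j p s)) r = - \<delta> r (Cont T j p s)" "vec_of (col (FHead j p)) r = - \<delta> r (Head T j p)"
    for t a j p s i q
    by (simp_all only: col.simps vec_of_simps(3) vec_of_map_link sum_list_upt if_True if_False sum_negf
        vec_of_\<delta> vec_of_simps(1) if_distrib [where f = "\<lambda>c. vec_of c r"]) simp_all
  show ?thesis
    unfolding vars_def map_append sum_list_append sum_list_concat_map if_z sum_list_rev_upt sum_list_upt
      list.map sum_list.Cons sum_list.Nil add_0_right cols mult_minus_right sum_negf
    by linarith
qed

lemma vec_of_rhs: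
  "vec_of rhs r = \<delta> r (Cont T 0 org 2) - \<delta> r (St 0 0) + \<delta> r (Mon Q) - (\<Sum>j<k. \<delta> r (Head 0 j (Suc org))) +
     (\<Sum>i<Q. \<delta> r (One i)) - (\<Sum>i<org. \<Sum>j<k. \<delta> r (Cont 0 j i 0)) -
     (\<Sum>i<Q + org. \<delta> r (Cont 0 0 (org + i) (contents x (int i)))) -
     (\<Sum>i<org. \<delta> r (Cont 0 1 (org + (Q + i)) 0)) -
     (\<Sum>i<Q + org. \<Sum>j=2..<k. \<delta> r (Cont 0 j (org + i) 0))"
  unfolding rhs_def vec_of_simps(3) vec_of_concat_map
  unfolding vec_of_\<delta> vec_of_simps(1) if_True if_False add_0_right sum_list_rev_upt sum_list_upt
    interv_sum_list_conv_sum_set_nat set_upt atLeast0LessThan sum_negf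
  by linarith

lemma run_bounds:
  assumes run: "run u q act c h" and j: "j < k" and t: "t \<le> T"
  shows "org \<le> h t j + t" "h t j \<le> org + t" "h t j < W"
proof -
  have *: "t \<le> T \<longrightarrow> org \<le> h t j + t \<and> h t j \<le> org + t"
  proof (induction t)
    case 0
    then show ?case using run j by (simp add: run_def)
  next
    case (Suc t)
    show ?case
    proof
      assume "Suc t \<le> T"
      then have "Suc (h (Suc t) j) = h t j + mv (act t) j" "mv (act t) j \<le> 2" "org \<le> h t j + t" "h t j \<le> org + t"
        using run j mv Suc unfolding run_def by auto
      then show "org \<le> h (Suc t) j + Suc t \<and> h (Suc t) j \<le> org + Suc t"
        by linarith
    qed
  qed
  then show "org \<le> h t j + t" "h t j \<le> org + t" "h t j < W"
    using t by auto
qed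

lemma run_symbols:
  assumes run: "run u q act c h" and j: "j < k" and p: "p < W" and t: "t \<le> T"
  shows "c t j p < G"
  using t
proof (induction t)
  case 0
  have "init u j p \<le> 2"
    by (simp add: init_def contents_def)
  then show ?case using run j p G by (auto simp: run_def)
next
  case (Suc t)
  then show ?case using run j p wr by (auto simp: run_def)
qed

lemma run_states:
  assumes run: "run u q act c h" and t: "t \<le> T"
  shows "q t \<le> ns"
  using run t dst by (cases t) (auto simp: run_def)

text \<open>Choosing the variables along a run, the columns of time \<open>t\<close> add up to the difference of the
  formal sums \<open>D\<close> describing the configurations at times \<open>t + 1\<close> and \<open>t\<close>, so everything telescopes.\<close>

lemma solution_of_run:
  assumes run: "run u q act c h" and u: "length u \<le> Q" and acc: "c T 0 org = 2"
  shows "\<exists>y. solution y"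
proof -
  \<comment> \<open>The slack cancels the final configuration except for the accepting cell, where
    the symbol 2 leaves the unit demanded by \<open>rhs\<close>.\<close>
  define y where "y v = (case v of
      VA t a \<Rightarrow> a = act t
    | VH t j p a \<Rightarrow> p = h t j \<and> a = act t
    | VN t j p s \<Rightarrow> p \<noteq> h t j \<and> s = c t j p
    | VU i s \<Rightarrow> s = c 0 1 (org + i)
    | VS i \<Rightarrow> i = length u
    | FSt q' \<Rightarrow> q' = q T
    | FCont j p s \<Rightarrow> s = c T j p \<and> \<not> (j = 0 \<and> p = org)
    | FHead j p \<Rightarrow> p = Suc (h T j))" for v
  have act: "act t < NA" "src (act t) = q t" "q (Suc t) = dst (act t)" if "t < T" for t
    using run that by (auto simp: run_def)
  have step: "rd (act t) j = c t j (h t j)" "Suc (h (Suc t) j) = h t j + mv (act t) j"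
    "\<And>p. p < W \<Longrightarrow> c (Suc t) j p = (if p = h t j then wr (act t) j else c t j p)" if "t < T" "j < k" for t j
    using run that by (auto simp: run_def)
  have zs: "z y (VA t a) = (if a = act t then 1 else 0)"
    "z y (VH t j p a) = (if p = h t j then if a = act t then 1 else 0 else 0)"
    "z y (VN t j p s) = (if s = c t j p then if p = h t j then 0 else 1 else 0)"
    "z y (VU i s) = (if s = c 0 1 (org + i) then 1 else 0)"
    "z y (VS i) = (if i = length u then 1 else 0)"
    "z y (FSt q') = (if q' = q T then 1 else 0)"
    "z y (FCont j p s) = (if s = c T j p then if j = 0 \<and> p = org then 0 else 1 else 0)"
    "z y (FHead j p) = (if p = Suc (h T j) then 1 else 0)"
    for t a j p s i q'
    by (auto simp: z_def y_def)
  have if_mult: "(if P then a else 0) * b = (if P then a * b else (0 :: int))" for P a b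
    by simp
  show ?thesis
  proof (rule exI [of _ y], unfold solution_def, rule allI)
    fix r
    let ?d = "\<delta> r"
    define C where "C t = (\<Sum>p<W. \<Sum>j<k. ?d (Cont t j p (c t j p)))" for t
    define H where "H t = (\<Sum>j<k. ?d (Head t j (Suc (h t j))))" for t
    define D where "D t = ?d (St t (q t)) + C t + H t" for t
    have A: "(\<Sum>a<NA. z y (VA t a) * (?d (St (Suc t) (dst a)) - ?d (St t (src a)) - (\<Sum>j<k. ?d (Link t j a)))) =
        ?d (St (Suc t) (q (Suc t))) - ?d (St t (q t)) - (\<Sum>j<k. ?d (Link t j (act t)))" if "t < T" for t
      using act [OF that] by (simp add: zs if_mult sum.delta)
    \<comment> \<open>The link terms will cancel against \<open>A\<close>, the terms of the scanned
      cells against \<open>N\<close>.\<close>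
    have HH: "(\<Sum>p<W. \<Sum>j<k. \<Sum>a<NA. z y (VH t j p a) * (?d (Link t j a) + (?d (Cont (Suc t) j p (wr a j)) -
        ?d (Cont t j p (rd a j))) + (?d (Head (Suc t) j (p + mv a j)) - ?d (Head t j (Suc p))))) =
        (\<Sum>j<k. ?d (Link t j (act t))) + (\<Sum>j<k. ?d (Cont (Suc t) j (h t j) (wr (act t) j)) - ?d (Cont t j (h t j) (c t j (h t j))))
        + (H (Suc t) - H t)" if t: "t < T" for t
    proof -
      have "(\<Sum>p<W. \<Sum>a<NA. z y (VH t j p a) * (?d (Link t j a) + (?d (Cont (Suc t) j p (wr a j)) -
          ?d (Cont t j p (rd a j))) + (?d (Head (Suc t) j (p + mv a j)) - ?d (Head t j (Suc p))))) =
          ?d (Link t j (act t)) + (?d (Cont (Suc t) j (h t j) (wr (act t) j)) - ?d (Cont t j (h t j) (c t j (h t j)))) +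
          (?d (Head (Suc t) j (Suc (h (Suc t) j))) - ?d (Head t j (Suc (h t j))))" if j: "j < k" for j
        using act [OF t] step [OF t j] run_bounds(3) [OF run j, of t] t
        by (simp add: zs if_mult sum.delta if_distrib [where f = "\<lambda>f. sum f _"] sum.If_cases cong: if_cong)
      then show ?thesis
        unfolding sum.swap [of _ "{..<k}" "{..<W}"] H_def by (simp add: sum.distrib sum_subtractf)
    qed
    \<comment> \<open>\<open>VN\<close> covers all cells but the scanned one, whose change is
      subtracted here and contributed by \<open>HH\<close>.\<close>
    have N: "(\<Sum>p<W. \<Sum>j<k. \<Sum>s<G. z y (VN t j p s) * (?d (Cont (Suc t) j p s) - ?d (Cont t j p s))) =
        C (Suc t) - C t - (\<Sum>j<k. ?d (Cont (Suc t) j (h t j) (wr (act t) j)) - ?d (Cont t j (h t j) (c t j (h t j))))"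
      if t: "t < T" for t
    proof -
      have "(\<Sum>p<W. \<Sum>s<G. z y (VN t j p s) * (?d (Cont (Suc t) j p s) - ?d (Cont t j p s))) =
        (\<Sum>p<W. (?d (Cont (Suc t) j p (c (Suc t) j p)) - ?d (Cont t j p (c t j p)))
          - (if p = h t j then ?d (Cont (Suc t) j (h t j) (wr (act t) j)) - ?d (Cont t j (h t j) (c t j (h t j))) else 0))"
        if j: "j < k" for j
        using run_symbols [OF run j, of _ t] t step(3) [OF t j]
        by (intro sum.cong) (auto simp: zs if_mult)
      also have "\<dots> j = (\<Sum>p<W. ?d (Cont (Suc t) j p (c (Suc t) j p)) - ?d (Cont t j p (c t j p)))
          - (?d (Cont (Suc t) j (h t j) (wr (act t) j)) - ?d (Cont t j (h t j) (c t j (h t j))))" if j: "j < k" for j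
        using run_bounds(3) [OF run j, of t] t by (simp add: sum_subtractf)
      finally show ?thesis
        unfolding C_def sum.swap [of _ "{..<k}" "{..<W}"] by (simp add: sum_subtractf)
    qed
    have U: "(\<Sum>s<3. z y (VU i s) * (?d (Cont 0 1 (org + i) s) + ?d (One i) +
        (if s = 0 then ?d (Mon (Suc i)) - ?d (Mon i) else 0))) =
        ?d (Cont 0 1 (org + i) (c 0 1 (org + i))) + ?d (One i) + (if length u \<le> i then ?d (Mon (Suc i)) - ?d (Mon i) else 0)"
      if "i < Q" for i
    proof -
      have c: "c 0 1 (org + i) = contents u (int i)"
        using run k that by (simp add: run_def init_def)
      then have "c 0 1 (org + i) < 3" "c 0 1 (org + i) = 0 \<longleftrightarrow> length u \<le> i"
        by (auto simp: contents_def)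
      then show ?thesis by (simp add: zs if_mult)
    qed
    \<comment> \<open>The blank cells of the certificate region telescope, starting from the length
      of the certificate.\<close>
    have M: "(\<Sum>i<n. if length u \<le> i then ?d (Mon (Suc i)) - ?d (Mon i) else 0) =
        (if length u \<le> n then ?d (Mon n) - ?d (Mon (length u)) else 0)" for n
      by (induction n) (auto simp: le_Suc_eq)
    have S: "(\<Sum>i<Suc Q. z y (VS i) * ?d (Mon i)) = ?d (Mon (length u))"
      using u by (simp add: zs if_mult sum.delta del: sum.lessThan_Suc)
    have F1: "(\<Sum>q<Suc ns. z y (FSt q) * ?d (St T q)) = ?d (St T (q T))"
      using run_states [OF run, of T] by (simp add: zs if_mult sum.delta del: sum.lessThan_Suc)
    have F2: "(\<Sum>p<W. \<Sum>j<k. \<Sum>s<G. z y (FCont j p s) * ?d (Cont T j p s)) = C T - ?d (Cont T 0 org 2)"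
    proof -
      have "(\<Sum>j<k. \<Sum>s<G. z y (FCont j p s) * ?d (Cont T j p s)) =
          (\<Sum>j<k. ?d (Cont T j p (c T j p)) - (if j = 0 then if p = org then ?d (Cont T 0 org 2) else 0 else 0))" if "p < W" for p
        using run_symbols [OF run _ that, of _ T] acc by (intro sum.cong) (auto simp: zs if_mult)
      also have "\<dots> p = (\<Sum>j<k. ?d (Cont T j p (c T j p))) - (if p = org then ?d (Cont T 0 org 2) else 0)" for p
        using k by (simp add: sum_subtractf)
      finally show ?thesis
        unfolding C_def by (simp add: sum_subtractf)
    qed
    have F3: "(\<Sum>p<W + 2. \<Sum>j<k. z y (FHead j p) * ?d (Head T j p)) = H T"
    proof -
      have "Suc (h T j) < W + 2" if "j < k" for j
        using run_bounds(3) [OF run that, of T] by simp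
      then show ?thesis
        unfolding sum.swap [of _ "{..<k}" "{..<W + 2}"] H_def by (simp add: zs if_mult sum.delta del: sum.lessThan_Suc)
    qed
    have tele: "(\<Sum>t<T. D (Suc t) - D t) = D T - D 0"
      by (rule sum_lessThan_telescope)
    \<comment> \<open>The initial cells are those listed in \<open>rhs\<close> together with the
      certificate cells, which cancel against \<open>U\<close>.\<close>
    have init: "C 0 = (\<Sum>i<org. \<Sum>j<k. ?d (Cont 0 j i 0)) + (\<Sum>i<Q. ?d (Cont 0 1 (org + i) (c 0 1 (org + i)))) +
       (\<Sum>i<Q + org. ?d (Cont 0 0 (org + i) (contents x (int i)))) +
       (\<Sum>i<org. ?d (Cont 0 1 (org + (Q + i)) 0)) + (\<Sum>i<Q + org. \<Sum>j=2..<k. ?d (Cont 0 j (org + i) 0))"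
    proof -
      have split: "(\<Sum>p<m + n. f p) = (\<Sum>p<m. f p) + (\<Sum>p<n. f (m + p) :: int)" for m n :: nat and f
        by (induction n) simp_all
      have c0: "c 0 j p = init u j p" if "j < k" "p < W" for j p
        using run that by (simp add: run_def)
      have "{..<k} = {0, 1} \<union> {2..<k}"
        using k by auto
      then have js: "(\<Sum>j<k. f j) = f 0 + f 1 + (\<Sum>j=2..<k. f j :: int)" for f
        by (simp add: sum.union_disjoint)
      have left: "(\<Sum>j<k. ?d (Cont 0 j i (c 0 j i))) = (\<Sum>j<k. ?d (Cont 0 j i 0))" if "i < org" for i
        using that by (intro sum.cong) (auto simp: c0 init_def)
      have right: "(\<Sum>j<k. ?d (Cont 0 j (org + i) (c 0 j (org + i)))) =
          ?d (Cont 0 0 (org + i) (contents x (int i))) + ?d (Cont 0 1 (org + i) (c 0 1 (org + i))) +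
          (\<Sum>j=2..<k. ?d (Cont 0 j (org + i) 0))" if "i < Q + org" for i
      proof -
        have "(\<Sum>j=2..<k. ?d (Cont 0 j (org + i) (c 0 j (org + i)))) = (\<Sum>j=2..<k. ?d (Cont 0 j (org + i) 0))"
          using that by (intro sum.cong) (auto simp: c0 init_def)
        then show ?thesis
          unfolding js using k that by (simp add: c0 init_def)
      qed
      have blank: "c 0 1 (org + (Q + i)) = 0" if "i < org" for i
      proof -
        have "c 0 1 (org + (Q + i)) = contents u (int (Q + i))"
          using c0 [of 1 "org + (Q + i)"] that k by (simp add: init_def)
        then show ?thesis using u by (simp add: contents_def)
      qed
      have "C 0 = (\<Sum>i<org. \<Sum>j<k. ?d (Cont 0 j i 0)) + (\<Sum>i<Q + org. ?d (Cont 0 0 (org + i) (contents x (int i))) +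
          ?d (Cont 0 1 (org + i) (c 0 1 (org + i))) + (\<Sum>j=2..<k. ?d (Cont 0 j (org + i) 0)))"
        unfolding C_def split [of _ org "Q + org"] using left right by (simp del: sum.lessThan_Suc)
      moreover have "(\<Sum>i<Q + org. ?d (Cont 0 1 (org + i) (c 0 1 (org + i)))) =
          (\<Sum>i<Q. ?d (Cont 0 1 (org + i) (c 0 1 (org + i)))) + (\<Sum>i<org. ?d (Cont 0 1 (org + (Q + i)) 0))"
        unfolding split [of _ Q org] using blank by (simp del: sum.lessThan_Suc)
      ultimately show ?thesis
        by (simp add: sum.distrib del: sum.lessThan_Suc)
    qed
    have h0: "H 0 = (\<Sum>j<k. ?d (Head 0 j (Suc org)))" "q 0 = 0"
      using run by (auto simp: H_def run_def)
    have AHN: "(\<Sum>t<T. ?d (St (Suc t) (q (Suc t))) - ?d (St t (q t)) - (\<Sum>j<k. ?d (Link t j (act t)))) +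
       (\<Sum>t<T. (\<Sum>j<k. ?d (Link t j (act t))) + (\<Sum>j<k. ?d (Cont (Suc t) j (h t j) (wr (act t) j)) -
          ?d (Cont t j (h t j) (c t j (h t j)))) + (H (Suc t) - H t)) +
       (\<Sum>t<T. C (Suc t) - C t - (\<Sum>j<k. ?d (Cont (Suc t) j (h t j) (wr (act t) j)) - ?d (Cont t j (h t j) (c t j (h t j))))) =
       D T - D 0"
      unfolding tele [symmetric] by (simp add: D_def sum.distrib sum_subtractf)
    have "(\<Sum>t<T. \<Sum>a<NA. z y (VA t a) * (?d (St (Suc t) (dst a)) - ?d (St t (src a)) - (\<Sum>j<k. ?d (Link t j a)))) + (\<Sum>t<T. \<Sum>p<W. \<Sum>j<k. \<Sum>a<NA. z y (VH t j p a) * (?d (Link t j a) + (?d (Cont (Suc t) j p (wr a j)) -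
        ?d (Cont t j p (rd a j))) + (?d (Head (Suc t) j (p + mv a j)) - ?d (Head t j (Suc p))))) + (\<Sum>t<T. \<Sum>p<W. \<Sum>j<k. \<Sum>s<G. z y (VN t j p s) * (?d (Cont (Suc t) j p s) - ?d (Cont t j p s))) = D T - D 0"
      unfolding AHN [symmetric]
      using sum.cong [OF refl A, of "{..<T}"] sum.cong [OF refl HH, of "{..<T}"] sum.cong [OF refl N, of "{..<T}"]
      by simp
    moreover have "(\<Sum>i<Q. \<Sum>s<3. z y (VU i s) * (?d (Cont 0 1 (org + i) s) + ?d (One i) +
        (if s = 0 then ?d (Mon (Suc i)) - ?d (Mon i) else 0))) = (\<Sum>i<Q. ?d (Cont 0 1 (org + i) (c 0 1 (org + i)))) + (\<Sum>i<Q. ?d (One i)) +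
        (?d (Mon Q) - ?d (Mon (length u)))"
      using sum.cong [OF refl U, of "{..<Q}"] M [of Q] u by (simp add: sum.distrib)
    ultimately show "(\<Sum>v\<leftarrow>vars. if y v then vec_of (col v) r else 0) = vec_of rhs r"
      unfolding sum_vars vec_of_rhs S F1 F2 F3 using init h0 unfolding D_def by simp
  qed
qed

end

section \<open>From solutions back to runs\<close>

lemma sum_eq_1_01:
  fixes n :: nat
  assumes "(\<Sum>a<n. f a) = (1 :: int)" "\<And>a. f a = 0 \<or> f a = 1"
  shows "\<exists>b<n. \<forall>a<n. f a = (if a = b then 1 else 0)"
proof -
  have nonneg: "0 \<le> f a" for a
    using assms(2) [of a] by auto
  have "\<exists>b<n. f b = 1"
  proof (rule ccontr)
    assume "\<not> ?thesis"
    then have "(\<Sum>a<n. f a) = 0"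
      using assms(2) by (intro sum.neutral) auto
    then show False using assms(1) by simp
  qed
  then obtain b where b: "b < n" "f b = 1" by blast
  then have "(\<Sum>a\<in>{..<n} - {b}. f a) = 0"
    using assms(1) sum.remove [of "{..<n}" b f] by simp
  then have "\<forall>a\<in>{..<n} - {b}. f a = 0"
    using nonneg sum_nonneg_eq_0_iff [of "{..<n} - {b}" f] by simp
  then show ?thesis
    using b by (intro exI [of _ b]) auto
qed

lemma sum_eq_0_01:
  fixes n :: nat
  assumes "(\<Sum>a<n. f a) = (0 :: int)" "\<And>a. f a = 0 \<or> f a = 1" "a < n"
  shows "f a = 0"
proof -
  have "0 \<le> f a" for a
    using assms(2) [of a] by auto
  then show ?thesis
    using assms(1,3) sum_nonneg_eq_0_iff [of "{..<n}" f] by simp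
qed

lemma mult_if: "a * (if P then 1 else 0) = (if P then a else (0 :: int))" "a * (if P then b else 0) = (if P then a * b else (0 :: int))"
  by simp_all

lemma if_conj: "(if P \<and> P' then a else 0) = (if P then if P' then a else 0 else (0 :: int))"
  by simp

lemma sum_if: "(\<Sum>a\<in>S. if P then f a else 0) = (if P then \<Sum>a\<in>S. f a else (0 :: int))"
  by simp

context tableau
begin

lemma z_01: "z y v = 0 \<or> z y v = 1"
  by (simp add: z_def)

lemmas row_simps = \<delta>_def mult_if if_conj sum_if ring_distribs sum.distrib sum_subtractf sum_negf

context
  fixes y assumes y: "solution y"
begin

text \<open>All constraints that follow are this equation at a single row \<open>r\<close>, where
  most terms vanish.\<close>

lemma rows:
  "(\<Sum>t<T. \<Sum>a<NA. z y (VA t a) * (\<delta> r (St (Suc t) (dst a)) - \<delta> r (St t (src a)) - (\<Sum>j<k. \<delta> r (Link t j a)))) +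
     (\<Sum>t<T. \<Sum>p<W. \<Sum>j<k. \<Sum>a<NA. z y (VH t j p a) * (\<delta> r (Link t j a) + (\<delta> r (Cont (Suc t) j p (wr a j)) -
        \<delta> r (Cont t j p (rd a j))) + (\<delta> r (Head (Suc t) j (p + mv a j)) - \<delta> r (Head t j (Suc p))))) +
     (\<Sum>t<T. \<Sum>p<W. \<Sum>j<k. \<Sum>s<G. z y (VN t j p s) * (\<delta> r (Cont (Suc t) j p s) - \<delta> r (Cont t j p s))) +
     (\<Sum>i<Q. \<Sum>s<3. z y (VU i s) * (\<delta> r (Cont 0 1 (org + i) s) + \<delta> r (One i) +
        (if s = 0 then \<delta> r (Mon (Suc i)) - \<delta> r (Mon i) else 0))) +
     (\<Sum>i<Suc Q. z y (VS i) * \<delta> r (Mon i)) -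
     (\<Sum>q<Suc ns. z y (FSt q) * \<delta> r (St T q)) -
     (\<Sum>p<W. \<Sum>j<k. \<Sum>s<G. z y (FCont j p s) * \<delta> r (Cont T j p s)) -
     (\<Sum>p<W + 2. \<Sum>j<k. z y (FHead j p) * \<delta> r (Head T j p)) =
   \<delta> r (Cont T 0 org 2) - \<delta> r (St 0 0) + \<delta> r (Mon Q) - (\<Sum>j<k. \<delta> r (Head 0 j (Suc org))) +
     (\<Sum>i<Q. \<delta> r (One i)) - (\<Sum>i<org. \<Sum>j<k. \<delta> r (Cont 0 j i 0)) -
     (\<Sum>i<Q + org. \<delta> r (Cont 0 0 (org + i) (contents x (int i)))) -
     (\<Sum>i<org. \<delta> r (Cont 0 1 (org + (Q + i)) 0)) -
     (\<Sum>i<Q + org. \<Sum>j=2..<k. \<delta> r (Cont 0 j (org + i) 0))"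
  unfolding sum_vars [symmetric] vec_of_rhs [symmetric] using y unfolding solution_def by blast

lemma row_Link:
  assumes "t < T" "j < k" "a < NA"
  shows "(\<Sum>p<W. z y (VH t j p a)) = z y (VA t a)"
  using rows [of "Link t j a"] assms by (simp add: row_simps del: sum.lessThan_Suc cong: if_cong)

lemma row_St:
  assumes "Suc t < T" "q \<le> ns"
  shows "(\<Sum>a<NA. if dst a = q then z y (VA t a) else 0) = (\<Sum>a<NA. if src a = q then z y (VA (Suc t) a) else 0)"
  using rows [of "St (Suc t) q"] assms by (simp add: row_simps del: sum.lessThan_Suc cong: if_cong)

lemma row_St_0:
  assumes "q \<le> ns"
  shows "(\<Sum>a<NA. if src a = q then z y (VA 0 a) else 0) = (if q = 0 then 1 else 0)"
  using rows [of "St 0 q"] assms T by (simp add: row_simps del: sum.lessThan_Suc cong: if_cong)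

lemma row_Head:
  assumes "Suc t < T" "j < k" "p < W"
  shows "(\<Sum>p'<W. \<Sum>a<NA. if p' + mv a j = Suc p then z y (VH t j p' a) else 0) = (\<Sum>a<NA. z y (VH (Suc t) j p a))"
  using rows [of "Head (Suc t) j (Suc p)"] assms by (simp add: row_simps del: sum.lessThan_Suc cong: if_cong)

lemma row_Head_0:
  assumes "j < k" "p < W"
  shows "(\<Sum>a<NA. z y (VH 0 j p a)) = (if p = org then 1 else 0)"
  using rows [of "Head 0 j (Suc p)"] assms T by (simp add: row_simps del: sum.lessThan_Suc cong: if_cong)

lemma row_Cont:
  assumes "Suc t < T" "j < k" "p < W" "s < G"
  shows "(\<Sum>a<NA. if wr a j = s then z y (VH t j p a) else 0) + z y (VN t j p s) =
    (\<Sum>a<NA. if rd a j = s then z y (VH (Suc t) j p a) else 0) + z y (VN (Suc t) j p s)"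
  using rows [of "Cont (Suc t) j p s"] assms by (simp add: row_simps del: sum.lessThan_Suc cong: if_cong)

text \<open>Only an inequality, since slack may absorb a further unit.\<close>

lemma row_Cont_T:
  assumes "T = Suc t"
  shows "(\<Sum>a<NA. if wr a 0 = 2 then z y (VH t 0 org a) else 0) + z y (VN t 0 org 2) \<ge> 1"
  using rows [of "Cont (Suc t) 0 org 2"] assms k G z_01 [of y "FCont 0 org 2"]
  by (auto simp: row_simps simp del: sum.lessThan_Suc cong: if_cong)

lemma row_One:
  assumes "i < Q"
  shows "z y (VU i 0) + z y (VU i 1) + z y (VU i 2) = 1"
  using rows [of "One i"] assms by (simp add: row_simps lessThan_Suc numeral_3_eq_3 numeral_2_eq_2 cong: if_cong)

text \<open>Conservation of the flow. As \<open>VS\<close> is nonnegative, a blank is followed by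
  blanks.\<close>

lemma row_Mon:
  assumes "Suc i < Q"
  shows "z y (VU i 0) + z y (VS (Suc i)) = z y (VU (Suc i) 0)"
  using rows [of "Mon (Suc i)"] assms by (simp add: row_simps del: sum.lessThan_Suc cong: if_cong)

lemma row_Cont_0_left:
  assumes "j < k" "p < org" "s < G"
  shows "(\<Sum>a<NA. if rd a j = s then z y (VH 0 j p a) else 0) + z y (VN 0 j p s) = (if s = 0 then 1 else 0)"
  using rows [of "Cont 0 j p s"] assms T by (simp add: row_simps del: sum.lessThan_Suc cong: if_cong)

lemma row_Cont_0_right:
  assumes "j < k" "i < Q + org" "s < G" "j \<noteq> 1"
  shows "(\<Sum>a<NA. if rd a j = s then z y (VH 0 j (org + i) a) else 0) + z y (VN 0 j (org + i) s) =
    (if s = (if j = 0 then contents x (int i) else 0) then 1 else 0)"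
proof (cases "j = 0")
  case True
  then show ?thesis
    using rows [of "Cont 0 j (org + i) s"] assms T
    by (cases "s = contents x (int i)") (simp_all add: row_simps del: sum.lessThan_Suc cong: if_cong)
next
  case False
  then have "2 \<le> j" using assms by simp
  then show ?thesis
    using rows [of "Cont 0 j (org + i) s"] assms T by (simp add: row_simps del: sum.lessThan_Suc cong: if_cong)
qed

lemma row_Cont_0_certificate:
  assumes "i < Q" "s < G"
  shows "(\<Sum>a<NA. if rd a 1 = s then z y (VH 0 1 (org + i) a) else 0) + z y (VN 0 1 (org + i) s) =
    (if s < 3 then z y (VU i s) else 0)"
proof -
  have "Q + i' \<noteq> i" for i' using assms by simp
  then show ?thesis
    using rows [of "Cont 0 1 (org + i) s"] assms k T by (simp add: row_simps del: sum.lessThan_Suc cong: if_cong)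
qed

lemma row_Cont_0_beyond:
  assumes "i < org" "s < G"
  shows "(\<Sum>a<NA. if rd a 1 = s then z y (VH 0 1 (org + (Q + i)) a) else 0) + z y (VN 0 1 (org + (Q + i)) s) =
    (if s = 0 then 1 else 0)"
  using rows [of "Cont 0 1 (org + (Q + i)) s"] assms k T by (simp add: row_simps del: sum.lessThan_Suc cong: if_cong)

text \<open>The position of the first blank; admitting \<open>Q\<close> makes \<open>LEAST\<close>
  meaningful when there is none.\<close>

definition cert_length :: nat where
  "cert_length = (LEAST i. Q \<le> i \<or> y (VU i 0))"

definition certificate :: "bool list" where
  "certificate = map (\<lambda>i. y (VU i 2)) [0..<cert_length]"

lemma cert_length_le: "cert_length \<le> Q"
  unfolding cert_length_def by (rule Least_le) simp

lemma length_certificate: "length certificate \<le> Q"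
  using cert_length_le by (simp add: certificate_def)

lemma VU_0_mono:
  assumes "cert_length \<le> i" "i < Q"
  shows "y (VU i 0)"
  using assms
proof (induction i rule: dec_induct)
  case base
  have "Q \<le> cert_length \<or> y (VU cert_length 0)"
    unfolding cert_length_def by (rule LeastI [of _ Q]) simp
  then show ?case using base by simp
next
  case (step i)
  then show ?case
    using row_Mon [of i] z_01 [of y "VS (Suc i)"] by (auto simp: z_def split: if_splits)
qed

lemma VU_certificate:
  assumes i: "i < Q" and s: "s < 3"
  shows "z y (VU i s) = (if s = contents certificate (int i) then 1 else 0)"
proof -
  have s': "s = 0 \<or> s = 1 \<or> s = 2"
    using s by auto
  show ?thesis
  proof (cases "i < cert_length")
    case True
    then have "\<not> y (VU i 0)"
      using not_less_Least [of i "\<lambda>i. Q \<le> i \<or> y (VU i 0)"] by (simp add: cert_length_def)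
    moreover have "contents certificate (int i) = (if y (VU i 2) then 2 else 1)"
      using True by (simp add: contents_def certificate_def)
    ultimately show ?thesis
      using s' row_One [OF i] by (auto simp: z_def split: if_splits)
  next
    case False
    then have "y (VU i 0)"
      using VU_0_mono i by simp
    moreover have "contents certificate (int i) = 0"
      using False by (simp add: contents_def certificate_def)
    ultimately show ?thesis
      using s' row_One [OF i] by (auto simp: z_def split: if_splits)
  qed
qed

text \<open>The induction hypothesis. It speaks only of the sums in which columns of step
  \<open>t\<close> enter rows of time \<open>t\<close>, because these are what the past determines
  directly.\<close>

definition agrees :: "(nat \<Rightarrow> nat) \<Rightarrow> (nat \<Rightarrow> nat \<Rightarrow> nat \<Rightarrow> nat) \<Rightarrow> (nat \<Rightarrow> nat \<Rightarrow> nat) \<Rightarrow> nat \<Rightarrow> bool" where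
  "agrees q c h t \<longleftrightarrow>
     (\<forall>q'\<le>ns. (\<Sum>a<NA. if src a = q' then z y (VA t a) else 0) = (if q' = q t then 1 else 0)) \<and>
     (\<forall>j<k. \<forall>p<W. (\<Sum>a<NA. z y (VH t j p a)) = (if p = h t j then 1 else 0)) \<and>
     (\<forall>j<k. \<forall>p<W. \<forall>s<G. (\<Sum>a<NA. if rd a j = s then z y (VH t j p a) else 0) + z y (VN t j p s) =
        (if s = c t j p then 1 else 0))"

lemma agrees_0:
  assumes run: "run certificate q act c h"
  shows "agrees q c h 0"
proof -
  have init: "c 0 j p = init certificate j p" if "j < k" "p < W" for j p
    using run that by (simp add: run_def)
  have "(\<Sum>a<NA. if rd a j = s then z y (VH 0 j p a) else 0) + z y (VN 0 j p s) =
        (if s = c 0 j p then 1 else 0)" if j: "j < k" and p: "p < W" and s: "s < G" for j p s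
  proof -
    consider "p < org" | i where "p = org + i" "i < Q + org" "j \<noteq> 1"
      | i where "p = org + i" "i < Q" "j = 1" | i where "p = org + (Q + i)" "i < org" "j = 1"
    proof -
      assume cases: "p < org \<Longrightarrow> thesis" "\<And>i. p = org + i \<Longrightarrow> i < Q + org \<Longrightarrow> j \<noteq> 1 \<Longrightarrow> thesis"
        "\<And>i. p = org + i \<Longrightarrow> i < Q \<Longrightarrow> j = 1 \<Longrightarrow> thesis" "\<And>i. p = org + (Q + i) \<Longrightarrow> i < org \<Longrightarrow> j = 1 \<Longrightarrow> thesis"
      show thesis
      proof (cases "p < org")
        case False
        then obtain i where i: "p = org + i" using le_Suc_ex by (metis not_less)
        show thesis
        proof (cases "j = 1")
          case True
          show thesis
          proof (cases "i < Q")
            case False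
            then obtain i' where "i = Q + i'" using le_Suc_ex by (metis not_less)
            then show thesis using cases(4) [of i'] i True p by simp
          qed (use cases(3) i True in blast)
        qed (use cases(2) [of i] i p in simp)
      qed (use cases(1) in blast)
    qed
    then show ?thesis
    proof cases
      case 1
      then show ?thesis
        using row_Cont_0_left [OF j 1 s] init [OF j p] by (simp add: init_def)
    next
      case 2
      then show ?thesis
        using row_Cont_0_right [OF j 2(2) s 2(3)] init [OF j p] 2 by (simp add: init_def cong: if_cong)
    next
      case 3
      have "contents certificate (int i) < 3"
        by (simp add: contents_def)
      then show ?thesis
        using 3 row_Cont_0_certificate [OF 3(2) s] VU_certificate [OF 3(2), of s] init [OF j p]
        by (auto simp: init_def cong: if_cong)
    next
      case 4
      have "contents certificate (int (Q + i)) = 0"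
        using length_certificate by (simp add: contents_def)
      then show ?thesis
        using 4 row_Cont_0_beyond [OF 4(2) s] init [OF j p] by (simp add: init_def cong: if_cong)
    qed
  qed
  moreover have "q 0 = 0" "\<forall>j<k. h 0 j = org"
    using run by (auto simp: run_def)
  ultimately show ?thesis
    using row_St_0 row_Head_0 unfolding agrees_def by simp
qed

text \<open>The head row of tape 0 admits exactly one transition \<open>b\<close>. The links carry
  \<open>b\<close> over to \<open>VA\<close> and to the other tapes, the state rows give its source,
  and the cell rows at the heads give the symbols it reads. By determinism \<open>b\<close> is the
  transition of the run.\<close>

lemma agrees_values:
  assumes run: "run certificate q act c h" and t: "t < T" and agrees: "agrees q c h t"
  shows "\<And>a. a < NA \<Longrightarrow> z y (VA t a) = (if a = act t then 1 else 0)"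
    "\<And>j p a. j < k \<Longrightarrow> p < W \<Longrightarrow> a < NA \<Longrightarrow>
       z y (VH t j p a) = (if p = h t j then if a = act t then 1 else 0 else 0)"
    "\<And>j p s. j < k \<Longrightarrow> p < W \<Longrightarrow> s < G \<Longrightarrow>
       z y (VN t j p s) = (if p = h t j then 0 else if s = c t j p then 1 else 0)"
proof -
  have st: "(\<Sum>a<NA. if src a = q' then z y (VA t a) else 0) = (if q' = q t then 1 else 0)" if "q' \<le> ns" for q'
    using agrees that unfolding agrees_def by blast
  have hd: "(\<Sum>a<NA. z y (VH t j p a)) = (if p = h t j then 1 else 0)" if "j < k" "p < W" for j p
    using agrees that unfolding agrees_def by blast
  have ct: "(\<Sum>a<NA. if rd a j = s then z y (VH t j p a) else 0) + z y (VN t j p s) =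
        (if s = c t j p then 1 else 0)" if "j < k" "p < W" "s < G" for j p s
    using agrees that unfolding agrees_def by blast
  have hW: "h t j < W" if "j < k" for j
    using run_bounds(3) [OF run that, of t] t by simp
  have off: "z y (VH t j p a) = 0" if "j < k" "p < W" "a < NA" "p \<noteq> h t j" for j p a
    using hd [OF that(1,2)] sum_eq_0_01 [of "\<lambda>a. z y (VH t j p a)", OF _ z_01 that(3)] that(4) by simp
  have on: "z y (VH t j (h t j) a) = z y (VA t a)" if "j < k" "a < NA" for j a
  proof -
    have "(\<Sum>p<W. z y (VH t j p a)) = (\<Sum>p<W. if p = h t j then z y (VH t j (h t j) a) else 0)"
      using off that by (intro sum.cong) auto
    then show ?thesis
      using row_Link [OF t that] hW [OF that(1)] by (simp del: sum.lessThan_Suc)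
  qed
  have k0: "0 < k" using k by simp
  have "(\<Sum>a<NA. z y (VH t 0 (h t 0) a)) = 1"
    using hd [OF k0 hW [OF k0]] by simp
  then obtain b where b: "b < NA" "\<And>a. a < NA \<Longrightarrow> z y (VH t 0 (h t 0) a) = (if a = b then 1 else 0)"
    using sum_eq_1_01 [of "\<lambda>a. z y (VH t 0 (h t 0) a)" NA, OF _ z_01] by blast
  have VA: "z y (VA t a) = (if a = b then 1 else 0)" if "a < NA" for a
    using b(2) [OF that] on [OF k0 that] by simp
  have VH: "z y (VH t j p a) = (if p = h t j then if a = b then 1 else 0 else 0)" if "j < k" "p < W" "a < NA" for j p a
    using on off VA that by (cases "p = h t j") simp_all
  have pick: "(\<Sum>a<NA. if P a then z y (f a) else 0) = (if P b then 1 else 0)"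
    if "\<And>a. a < NA \<Longrightarrow> z y (f a) = (if a = b then 1 else 0)" for P f
  proof -
    have "(\<Sum>a<NA. if P a then z y (f a) else 0) = (\<Sum>a<NA. if a = b then if P b then 1 else 0 else 0)"
      using that by (intro sum.cong) auto
    then show ?thesis using b(1) by simp
  qed
  have "src b = q t"
    using st [OF src [OF b(1)]] pick [of "\<lambda>a. VA t a" "\<lambda>a. src a = src b"] VA by (simp split: if_splits)
  \<comment> \<open>At \<open>s = rd b j\<close> the left side is at least 1. So \<open>b\<close>
    reads the scanned symbol, and nothing is left for \<open>VN\<close> under the head.\<close>
  moreover have ct': "(if rd b j = s then 1 else 0) + z y (VN t j (h t j) s) = (if s = c t j (h t j) then 1 else 0)"
    if "j < k" "s < G" for j s
    using ct [OF that(1) hW [OF that(1)] that(2)] pick [of "VH t j (h t j)" "\<lambda>a. rd a j = s"] VH hW that by simp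
  then have rdb: "rd b j = c t j (h t j)" if "j < k" for j
    using ct' [OF that rd [OF b(1) that]] z_01 [of y "VN t j (h t j) (rd b j)"] by (auto split: if_splits)
  moreover have "act t < NA" "src (act t) = q t" "\<forall>j<k. rd (act t) j = c t j (h t j)"
    using run t by (auto simp: run_def)
  ultimately have eq: "b = act t"
    using det [OF b(1), of "act t"] by simp
  show "z y (VA t a) = (if a = act t then 1 else 0)" if "a < NA" for a
    using VA that eq by simp
  show "z y (VH t j p a) = (if p = h t j then if a = act t then 1 else 0 else 0)" if "j < k" "p < W" "a < NA" for j p a
    using VH that eq by simp
  show "z y (VN t j p s) = (if p = h t j then 0 else if s = c t j p then 1 else 0)" if "j < k" "p < W" "s < G" for j p s
  proof (cases "p = h t j")
    case True
    then show ?thesis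
      using ct' [OF that(1,3)] rdb [OF that(1)] z_01 [of y "VN t j p s"] by (auto split: if_splits)
  next
    case False
    then have "(\<Sum>a<NA. if rd a j = s then z y (VH t j p a) else 0) = 0"
      using off that by (intro sum.neutral) auto
    then show ?thesis using ct [OF that] False by simp
  qed
qed

lemma sum_VH:
  assumes run: "run certificate q act c h" and t: "t < T" and agrees: "agrees q c h t" and j: "j < k" and p: "p < W"
  shows "(\<Sum>a<NA. if P a then z y (VH t j p a) else 0) = (if p = h t j \<and> P (act t) then 1 else 0)"
proof -
  have "(\<Sum>a<NA. if P a then z y (VH t j p a) else 0) =
      (\<Sum>a<NA. if a = act t then if p = h t j \<and> P (act t) then 1 else 0 else 0)"
    using agrees_values(2) [OF run t agrees j p] by (intro sum.cong) auto
  moreover have "act t < NA"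
    using run t by (simp add: run_def)
  ultimately show ?thesis by simp
qed

text \<open>A row of time \<open>t + 1\<close> equates sums over step \<open>t\<close>, known by
  \<open>agrees_values\<close>, with the sums over step \<open>t + 1\<close> that
  \<open>agrees\<close> is about.\<close>

lemma agrees_Suc:
  assumes run: "run certificate q act c h" and t: "Suc t < T" and agrees: "agrees q c h t"
  shows "agrees q c h (Suc t)"
proof -
  have t': "t < T" using t by simp
  note vals = agrees_values [OF run t' agrees]
  note VH = sum_VH [OF run t' agrees]
  have act: "act t < NA" "q (Suc t) = dst (act t)"
    using run t' by (auto simp: run_def)
  have step: "Suc (h (Suc t) j) = h t j + mv (act t) j"
    "\<And>p. p < W \<Longrightarrow> c (Suc t) j p = (if p = h t j then wr (act t) j else c t j p)" if "j < k" for j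
    using run t' that by (auto simp: run_def)
  have hW: "h t j < W" if "j < k" for j
    using run_bounds(3) [OF run that, of t] t by simp
  have "(\<Sum>a<NA. if src a = q' then z y (VA (Suc t) a) else 0) = (if q' = q (Suc t) then 1 else 0)" if "q' \<le> ns" for q'
  proof -
    have "(\<Sum>a<NA. if dst a = q' then z y (VA t a) else 0) = (\<Sum>a<NA. if a = act t then if dst (act t) = q' then 1 else 0 else 0)"
      using vals(1) by (intro sum.cong) auto
    then show ?thesis
      using row_St [OF t that] act by auto
  qed
  moreover have "(\<Sum>a<NA. z y (VH (Suc t) j p a)) = (if p = h (Suc t) j then 1 else 0)" if "j < k" "p < W" for j p
  proof -
    have "(\<Sum>p'<W. \<Sum>a<NA. if p' + mv a j = Suc p then z y (VH t j p' a) else 0) =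
        (\<Sum>p'<W. if p' = h t j then if h t j + mv (act t) j = Suc p then 1 else 0 else 0)"
      using VH [OF that(1)] by (intro sum.cong) auto
    then show ?thesis
      using row_Head [OF t that] hW [OF that(1)] step(1) [OF that(1)] by (auto simp del: sum.lessThan_Suc)
  qed
  moreover have "(\<Sum>a<NA. if rd a j = s then z y (VH (Suc t) j p a) else 0) + z y (VN (Suc t) j p s) =
        (if s = c (Suc t) j p then 1 else 0)" if "j < k" "p < W" "s < G" for j p s
    using row_Cont [OF t that] VH [OF that(1,2), of "\<lambda>a. wr a j = s"] vals(3) [OF that] step(2) [OF that(1,2)]
    by (auto split: if_splits)
  ultimately show ?thesis
    unfolding agrees_def by blast
qed

text \<open>The variables of the last step \<open>T - 1\<close> are fixed by the run, so the symbol
  2 demanded by \<open>row_Cont_T\<close> is present in the run.\<close>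

lemma run_certificate_accepting:
  assumes run: "run certificate q act c h"
  shows "c T 0 org = 2"
proof -
  obtain t where t: "T = Suc t"
    using T by (cases T) auto
  have "t' < T \<longrightarrow> agrees q c h t'" for t'
    by (induction t') (use agrees_0 [OF run] agrees_Suc [OF run] in auto)
  then have "agrees q c h t"
    using t by simp
  have t': "t < T" and k0: "0 < k" and W: "org < W"
    using t k by simp_all
  have cT: "c T = c (Suc t)"
    using t by (rule arg_cong)
  have "c T 0 org = (if org = h t 0 then wr (act t) 0 else c t 0 org)"
    unfolding cT using run t' k0 W unfolding run_def by blast
  then show ?thesis
    using row_Cont_T [OF t] sum_VH [OF run t' \<open>agrees q c h t\<close> k0 W, of "\<lambda>a. wr a 0 = 2"]
      agrees_values(3) [OF run t' \<open>agrees q c h t\<close> k0 W, of 2] G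
    by (auto split: if_splits)
qed

end

lemma solution_iff:
  assumes "\<And>u. length u \<le> Q \<Longrightarrow> \<exists>q act c h. run u q act c h \<and> (c T 0 org = 2 \<longleftrightarrow> R u)"
  shows "(\<exists>y. solution y) \<longleftrightarrow> (\<exists>u. length u \<le> Q \<and> R u)"
proof
  assume "\<exists>y. solution y"
  then obtain y where y: "solution y" by blast
  show "\<exists>u. length u \<le> Q \<and> R u"
    using assms [OF length_certificate [OF y]] run_certificate_accepting [OF y] length_certificate [OF y] by blast
next
  assume "\<exists>u. length u \<le> Q \<and> R u"
  then show "\<exists>y. solution y"
    using assms solution_of_run by blast
qed

end

section \<open>Numbering the equations\<close>

lemma mixed_radix_less: "a < n \<Longrightarrow> b < m \<Longrightarrow> a + n * b < n * (m :: nat)"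
proof -
  assume a: "a < n" and b: "b < m"
  have "a + n * b < n * Suc b" using a by simp
  also have "\<dots> \<le> n * m" using b by (intro mult_le_mono2) simp
  finally show ?thesis .
qed

lemma mixed_radix_inject: "a < n \<Longrightarrow> a' < n \<Longrightarrow> a + n * b = a' + n * (b' :: nat) \<longleftrightarrow> a = a' \<and> b = b'"
  by (metis add_left_imp_eq div_mult_self2 mod_less mod_mult_self2 mult_cancel1 gr_implies_not0)

lemma distinct_concat_map:
  assumes "distinct xs" "\<And>a. a \<in> set xs \<Longrightarrow> distinct (f a)"
    "\<And>a b. a \<noteq> b \<Longrightarrow> set (f a) \<inter> set (f b) = {}"
  shows "distinct (concat (map f xs))"
  using assms by (induction xs) fastforce+

lemma vec_of_map_inj:
  assumes "inj_on f V" "fst ` set c \<subseteq> V" "r \<in> V"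
  shows "vec_of (map (\<lambda>(r, s). (f r, s)) c) (f r) = vec_of c r"
  using assms(2)
proof (induction c)
  case (Cons p c)
  then show ?case
    using assms(1,3) by (cases p) (auto simp: inj_on_eq_iff)
qed simp

lemma vec_of_eq_0: "r \<notin> fst ` set c \<Longrightarrow> vec_of c r = 0"
  by (induction c) (auto split: prod.splits)

context tableau
begin

text \<open>Apart from time and position, a row ranges over a finite set depending on the machine
  only. Its size is the innermost radix of the numbering, and row numbers are polynomial expressions
  in the loop variables.\<close>

definition kinds :: nat where
  "kinds = Suc ns + k * NA + k * G + k + 2"

definition pos :: "nat \<Rightarrow> nat \<Rightarrow> nat \<Rightarrow> nat" where
  "pos \<kappa> t p = \<kappa> + kinds * (p + (W + 2) * t)"

fun kind :: "row \<Rightarrow> nat" where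
  "kind (St t q) = q"
| "kind (Link t j a) = Suc ns + (j + k * a)"
| "kind (Cont t j p s) = Suc ns + k * NA + (j + k * s)"
| "kind (Head t j p) = Suc ns + k * NA + k * G + j"
| "kind (One i) = Suc ns + k * NA + k * G + k"
| "kind (Mon i) = Suc (Suc ns + k * NA + k * G + k)"

fun row_time :: "row \<Rightarrow> nat" where
  "row_time (St t q) = t"
| "row_time (Link t j a) = t"
| "row_time (Cont t j p s) = t"
| "row_time (Head t j p) = t"
| "row_time (One i) = 0"
| "row_time (Mon i) = 0"

fun row_pos :: "row \<Rightarrow> nat" where
  "row_pos (St t q) = 0"
| "row_pos (Link t j a) = 0"
| "row_pos (Cont t j p s) = p"
| "row_pos (Head t j p) = p"
| "row_pos (One i) = i"
| "row_pos (Mon i) = i"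

text \<open>\<open>W + 2\<close> for \<open>Head\<close>, since its numbers are one above the
  position and a move to the right adds another one.\<close>

fun valid_row :: "row \<Rightarrow> bool" where
  "valid_row (St t q) \<longleftrightarrow> t \<le> T \<and> q \<le> ns"
| "valid_row (Link t j a) \<longleftrightarrow> t \<le> T \<and> j < k \<and> a < NA"
| "valid_row (Cont t j p s) \<longleftrightarrow> t \<le> T \<and> j < k \<and> p < W \<and> s < G"
| "valid_row (Head t j p) \<longleftrightarrow> t \<le> T \<and> j < k \<and> p < W + 2"
| "valid_row (One i) \<longleftrightarrow> i \<le> Q"
| "valid_row (Mon i) \<longleftrightarrow> i \<le> Q"

definition idx :: "row \<Rightarrow> nat" where
  "idx r = pos (kind r) (row_time r) (row_pos r)"

definition num_rows :: nat where
  "num_rows = kinds * ((W + 2) * Suc T)"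

lemma valid_row_bounds:
  assumes "valid_row r"
  shows "kind r < kinds" "row_pos r < W + 2" "row_time r < Suc T"
proof -
  have "j + k * a < k * m" if "j < k" "a < m" for j a m
    using that by (rule mixed_radix_less)
  note bound = this [of _ _ NA] this [of _ _ G]
  show "kind r < kinds"
    using assms by (cases r) (auto simp: kinds_def dest: bound)
  show "row_pos r < W + 2" "row_time r < Suc T"
    using assms by (cases r; simp)+
qed

lemma idx_less: "valid_row r \<Longrightarrow> idx r < num_rows"
  using valid_row_bounds [of r] unfolding idx_def pos_def num_rows_def
  by (intro mixed_radix_less) auto

lemma row_eqI:
  assumes "valid_row r" "valid_row r'" "kind r = kind r'" "row_time r = row_time r'" "row_pos r = row_pos r'"
  shows "r = r'"
proof -
  have bound: "j + k * a < k * NA" if "j < k" "a < NA" for j a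
    using that by (rule mixed_radix_less)
  have bound': "j + k * s < k * G" if "j < k" "s < G" for j s
    using that by (rule mixed_radix_less)
  have inj: "j + k * a = j' + k * a' \<longleftrightarrow> j = j' \<and> a = a'" if "j < k" "j' < k" for j j' a a'
    using that by (rule mixed_radix_inject)
  show ?thesis
    using assms
    by (cases r; cases r') (auto simp: inj dest: bound bound')
qed

lemma inj_on_idx: "inj_on idx {r. valid_row r}"
proof (rule inj_onI)
  fix r r' assume r: "r \<in> {r. valid_row r}" and r': "r' \<in> {r. valid_row r}" and eq: "idx r = idx r'"
  note b = valid_row_bounds [of r] valid_row_bounds [of r']
  have "kind r = kind r' \<and> row_pos r + (W + 2) * row_time r = row_pos r' + (W + 2) * row_time r'"
    using eq b r r' unfolding idx_def pos_def by (subst (asm) mixed_radix_inject) auto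
  moreover from this have "row_pos r = row_pos r' \<and> row_time r = row_time r'"
    using b r r' by (subst (asm) mixed_radix_inject) auto
  ultimately show "r = r'"
    using row_eqI r r' by blast
qed

lemma valid_col:
  assumes "v \<in> set vars"
  shows "\<forall>(r, s) \<in> set (col v). valid_row r"
proof -
  have mv': "p + mv a j < W + 2" if "a < NA" "j < k" "p < W" for p a j
    using mv [OF that(1,2)] that by simp
  show ?thesis
    using assms src dst rd wr mv' k G
    by (auto simp: vars_def simp del: add_Suc_right add_2_eq_Suc')
qed

lemma valid_rhs: "\<forall>(r, s) \<in> set rhs. valid_row r"
proof -
  have "contents x i < G" for i
    using G by (simp add: contents_def)
  then show ?thesis
    using k G by (auto simp: rhs_def)
qed

lemma distinct_vars: "distinct vars"
  unfolding vars_def distinct_append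
  by (intro conjI distinct_concat_map) auto

definition indexed :: "(row \<times> bool) list \<Rightarrow> (nat \<times> bool) list" where
  "indexed c = map (\<lambda>(r, s). (idx r, s)) c"

lemma indexed_less:
  assumes "\<forall>(r, s) \<in> set c. valid_row r"
  shows "\<forall>(i, s) \<in> set (indexed c). i < num_rows"
  using assms idx_less by (auto simp: indexed_def)

definition equation_words :: "letter list list" where
  "equation_words = system_words (\<lambda>v. indexed (col v)) vars (indexed rhs)"

text \<open>The numbering is injective on valid rows but need not be onto. A number of no valid row
  gives the equation 0 = 0, and so does a row that is not valid.\<close>

lemma solution_indexed:
  "(\<forall>i<num_rows. (\<Sum>v\<leftarrow>vars. if y v then vec_of (indexed (col v)) i else 0) = vec_of (indexed rhs) i) \<longleftrightarrow>
     solution y" (is "?L \<longleftrightarrow> _")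
proof -
  have valid: "vec_of (indexed c) (idx r) = vec_of c r" if "\<forall>(r, s) \<in> set c. valid_row r" "valid_row r" for c r
    unfolding indexed_def by (rule vec_of_map_inj [OF inj_on_idx]) (use that in auto)
  have invalid: "vec_of c r = 0" if "\<forall>(r, s) \<in> set c. valid_row r" "\<not> valid_row r" for c r
    by (rule vec_of_eq_0) (use that in auto)
  have no_row: "vec_of (indexed c) i = 0" if "\<forall>(r, s) \<in> set c. valid_row r" "\<And>r. valid_row r \<Longrightarrow> idx r \<noteq> i" for c i
    by (rule vec_of_eq_0) (use that in \<open>fastforce simp: indexed_def\<close>)
  have sum_valid: "(\<Sum>v\<leftarrow>vars. if y v then vec_of (indexed (col v)) (idx r) else 0) =
      (\<Sum>v\<leftarrow>vars. if y v then vec_of (col v) r else 0)" if "valid_row r" for r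
    using valid valid_col that by (intro arg_cong [where f = sum_list] map_cong) auto
  have sum_0: "(\<Sum>v\<leftarrow>vs. if y v then f v else 0) = 0" if "\<And>v. v \<in> set vs \<Longrightarrow> f v = 0"
    for f :: "var \<Rightarrow> int" and vs
    using that by (induction vs) auto
  show ?thesis
  proof
    assume L: ?L
    show "solution y"
      unfolding solution_def
    proof
      fix r
      show "(\<Sum>v\<leftarrow>vars. if y v then vec_of (col v) r else 0) = vec_of rhs r"
      proof (cases "valid_row r")
        case True
        then show ?thesis
          using L idx_less [OF True] sum_valid [OF True] valid [OF valid_rhs True] by simp
      next
        case False
        then show ?thesis
          using invalid [OF valid_rhs False] invalid valid_col sum_0 [of vars "\<lambda>v. vec_of (col v) r"] by simp
      qed
    qed
  next
    assume sol: "solution y"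
    show ?L
    proof (intro allI impI)
      fix i assume "i < num_rows"
      show "(\<Sum>v\<leftarrow>vars. if y v then vec_of (indexed (col v)) i else 0) = vec_of (indexed rhs) i"
      proof (cases "\<exists>r. valid_row r \<and> idx r = i")
        case True
        then obtain r where "valid_row r" "idx r = i" by blast
        then show ?thesis
          using sol sum_valid valid [OF valid_rhs] unfolding solution_def by auto
      next
        case False
        then show ?thesis
          using no_row [OF valid_rhs, of i] no_row [of _ i] valid_col sum_0 [of vars "\<lambda>v. vec_of (indexed (col v)) i"] by simp
      qed
    qed
  qed
qed

lemma equation_solvable_iff:
  "encode_equation num_rows equation_words \<in> spherical_problem \<longleftrightarrow> (\<exists>y. solution y)"
proof -
  have base: "\<forall>l \<in> set (base_word s (indexed c)). valid_letter num_rows l" if "\<forall>(r, s) \<in> set c. valid_row r" for s c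
    using indexed_less [OF that] by (auto simp: base_word_def)
  have "\<forall>w \<in> set equation_words. \<forall>l \<in> set w. valid_letter num_rows l"
  proof -
    have "\<forall>l \<in> set (base_word s (concat (map (\<lambda>v. indexed (col v)) vars))). valid_letter num_rows l" for s
      using base [OF valid_col] by (fastforce simp: base_word_def)
    then show ?thesis
      using base [OF valid_col] base [OF valid_rhs] by (auto simp: equation_words_def system_words_def)
  qed
  moreover have "equation_words \<noteq> []"
    by (simp add: equation_words_def system_words_def)
  ultimately have "encode_equation num_rows equation_words \<in> spherical_problem \<longleftrightarrow>
      spherical_solvable (Zn_wr_Z2 num_rows) (map (word_value num_rows) equation_words)"
    by (auto simp: spherical_problem_def encode_equation_inject)
  also have "\<dots> \<longleftrightarrow> (\<exists>y. solution y)"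
    unfolding equation_words_def solution_indexed [symmetric]
    by (rule spherical_solvable_system_words)
      (use indexed_less [OF valid_rhs] indexed_less [OF valid_col] distinct_vars in auto)
  finally show ?thesis .
qed

end

section \<open>Generating the equation\<close>

lemma computes_cong:
  assumes "\<And>x e. length e = n \<Longrightarrow> E x e = F x e" "computes n F"
  shows "computes n E"
  using assms unfolding computes_def pushes_def by simp

lemma computes_last: "computes (Suc n) (\<lambda>x e. last e)"
  by (rule computes_cong [OF _ computes_var [OF lessI]]) (subst last_conv_nth; auto)

lemma computes_last_butlast: "computes (Suc (Suc n)) (\<lambda>x e. last (butlast e))"
  by (rule computes_cong [OF _ computes_var [OF less_SucI [OF lessI]]]) (subst last_conv_nth; auto simp: butlast_conv_take)

text \<open>The innermost loop variable is the top of the stack, and \<open>butlast e\<close> holds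
  the enclosing ones. The equation nests at most two such loops, so \<open>last e\<close> and
  \<open>last (butlast e)\<close> are the only variables to be computed.\<close>

lemma emits_loop:
  assumes "computes n E" "emits (Suc n) (\<lambda>x e. F x (butlast e) (last e))"
  shows "emits n (\<lambda>x e. concat (map (F x e) (rev [0..<E x e])))"
  using emits_for [OF assms] by simp

text \<open>\<open>P\<close> is a condition on unrolled indices, decided when the program is
  built.\<close>

lemma emits_if:
  assumes "P \<Longrightarrow> emits n F" "\<not> P \<Longrightarrow> emits n H"
  shows "emits n (\<lambda>x e. if P then F x e else H x e)"
  using assms by (cases P) simp_all

lemma concat_map_concat_map: "concat (map f (concat (map g xs))) = concat (map (\<lambda>a. concat (map f (g a))) xs)"
  by (induction xs) simp_all

lemma encode_list_concat: "encode_list enc xs = concat (map (\<lambda>a. True # enc a) xs) @ [False]"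
  by (induction xs) simp_all

text \<open>The machine tables are fixed; of the parameters of the tableau only the number of steps
  and the certificate bound vary with the input and have to be computed.\<close>

locale generator =
  fixes k NA ns G :: nat
    and src dst :: "nat \<Rightarrow> nat" and rd wr mv :: "nat \<Rightarrow> nat \<Rightarrow> nat"
    and Tf Qf :: "bool list \<Rightarrow> nat"
  assumes tableau: "\<And>x. tableau k NA ns G (Tf x) src dst rd wr mv"
    and Tf: "\<And>n. computes n (\<lambda>x e. Tf x)" and Qf: "\<And>n. computes n (\<lambda>x e. Qf x)"
begin

sublocale tab: tableau k NA ns G "Tf x" "Qf x" src dst rd wr mv x for x
  by (rule tableau)

lemmas computes_intros = computes_const computes_add computes_mult computes_Suc computes_last
  computes_last_butlast computes_input Tf Qf

text \<open>The code of a word without its end marker, so that pieces of one word can be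
  concatenated.\<close>

definition code :: "bool \<Rightarrow> bool list \<Rightarrow> (row \<times> bool) list \<Rightarrow> bool list" where
  "code s x c = concat (map (\<lambda>(r, s'). True # encode_letter (Base (tab.idx x r) (s' \<noteq> s))) c)"

lemma base_word_append:
  "base_word s [] = []" "base_word s (c @ d) = base_word s c @ base_word s d"
  by (simp_all add: base_word_def)

lemma code_base_word:
  "concat (map (\<lambda>l. True # encode_letter l) (base_word s (tab.indexed x c))) = code s x c"
  by (simp add: code_def base_word_def tab.indexed_def o_def case_prod_unfold)

lemma code_simps:
  "code s x [] = []"
  "code s x (p # c) = True # encode_letter (Base (tab.idx x (fst p)) (snd p \<noteq> s)) @ code s x c"
  "code s x (c @ d) = code s x c @ code s x d"
  "code s x (concat (map f L)) = concat (map (\<lambda>a. code s x (f a)) L)"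
  "code s x (if P then c else d) = (if P then code s x c else code s x d)"
  by (simp_all add: code_def case_prod_unfold concat_map_concat_map)

lemma emits_Cons: "emits n F \<Longrightarrow> emits n (\<lambda>x e. b # F x e)"
  using emits_append [OF emits_const [of n "[b]"]] by simp

lemma emits_letter:
  assumes "computes n E"
  shows "emits n (\<lambda>x e. encode_letter (Base (E x e) s))"
  using emits_append [OF emits_replicate [OF assms, of True] emits_const [of n "[False]"]]
  by (simp add: emits_Cons)

lemma emits_code_Nil: "emits n (\<lambda>x e. code s x [])"
  by (simp add: code_simps emits_Nil)

lemma emits_code_Cons:
  assumes "computes n (\<lambda>x e. tab.idx x (r x e))" "emits n (\<lambda>x e. code s x (c x e))"
  shows "emits n (\<lambda>x e. code s x ((r x e, s') # c x e))"
  unfolding code_simps append_Cons fst_conv snd_conv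
  by (intro emits_Cons emits_append emits_letter assms)

lemmas idx_unfold = tab.idx_def tab.pos_def tab.kinds_def tab.kind.simps tab.row_time.simps tab.row_pos.simps

text \<open>All columns are printed twice, inside the first word and as words of their own; the
  delimiters \<open>pre\<close> and \<open>post\<close> distinguish the two passes.\<close>

lemma emits_vars:
  "emits 0 (\<lambda>x e. concat (map (\<lambda>v. pre @ code s x (tab.col x v) @ post) (tab.vars x)))"
  unfolding tab.vars_def map_append concat_append concat_map_concat_map list.map concat.simps append_Nil2
    tab.col.simps code_simps(3,4,5)
  by (intro emits_append emits_loop emits_concat emits_const emits_code_Cons emits_code_Nil emits_if;
      (unfold idx_unfold)?; intro computes_intros)

lemma emits_rhs: "emits 0 (\<lambda>x e. code s x (tab.rhs x))"
  unfolding tab.rhs_def code_simps(3,4)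
  by (intro emits_append emits_loop emits_concat emits_const emits_code_Cons emits_code_Nil;
      (unfold idx_unfold)?; intro computes_intros)

text \<open>\<open>[True, True, False]\<close> is the letter \<open>Top False\<close> after its
  continuation bit. \<open>[False, True]\<close> ends the rank and opens the first word; the other
  single False bits end a word or the equation.\<close>

lemma encode_equation_words:
  "encode_equation (tab.num_rows x) (tab.equation_words x) =
     (replicate (tab.num_rows x) True @ [False, True]) @ code True x (tab.rhs x) @ [True, True, False] @
     code False x (tab.rhs x) @ concat (map (\<lambda>v. [] @ code True x (tab.col x v) @ []) (tab.vars x)) @
     [True, True, False, False] @
     concat (map (\<lambda>v. [True] @ code False x (tab.col x v) @ [False]) (tab.vars x)) @ [False]"
proof -
  have "concat (map (\<lambda>l. True # encode_letter l) (base_word True (concat (map (\<lambda>v. tab.indexed x (tab.col x v)) vs)))) =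
      concat (map (\<lambda>v. code True x (tab.col x v)) vs)" for vs
    by (induction vs) (simp_all add: code_base_word base_word_append)
  then show ?thesis
    by (simp add: encode_equation_def tab.equation_words_def system_words_def encode_list_concat
        code_base_word o_def)
qed

lemma computes_num_rows: "computes n (\<lambda>x e. tab.num_rows x)"
  unfolding tab.num_rows_def tab.kinds_def by (intro computes_intros)

lemma emits_equation: "emits 0 (\<lambda>x e. encode_equation (tab.num_rows x) (tab.equation_words x))"
  unfolding encode_equation_words
  by (intro emits_append emits_rhs emits_vars emits_const emits_replicate computes_num_rows)

end

section \<open>Verifiers\<close>

locale verifier =
  fixes M :: turing_machine and R :: "bool list \<Rightarrow> bool list \<Rightarrow> bool" and p r :: "nat poly"
  assumes well_formed: "well_formed M" and two_tapes: "2 \<le> num_tapes M"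
    and halts: "\<And>x u. \<exists>t \<le> poly r (length x + length u). halts_with_output M [x, u] t [R x u]"
begin

text \<open>The halting state idles, so that every computation can be prolonged to exactly
  \<open>time x\<close> steps.\<close>

definition trans :: "nat \<Rightarrow> nat list \<Rightarrow> nat \<times> (nat \<times> direction) list" where
  "trans q ss = (if q < num_states M then transition M q ss else (q, map (\<lambda>s. (s, Stay)) ss))"

text \<open>A transition is named by the number of its argument in this list, which includes the
  halting state and so the idle transitions.\<close>

definition args :: "(nat \<times> nat list) list" where
  "args = List.product [0..<Suc (num_states M)] (List.n_lists (num_tapes M) [0..<num_symbols M])"

definition src where "src a = fst (args ! a)"
definition rd where "rd a j = snd (args ! a) ! j"
definition dst where "dst a = fst (trans (src a) (snd (args ! a)))"
definition wr where "wr a j = fst (snd (trans (src a) (snd (args ! a))) ! j)"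
definition mv where "mv a j = nat (shift (snd (snd (trans (src a) (snd (args ! a))) ! j)) + 1)"

lemma trans_wf:
  assumes "q \<le> num_states M" "length ss = num_tapes M" "set ss \<subseteq> {..<num_symbols M}"
  shows "fst (trans q ss) \<le> num_states M" "length (snd (trans q ss)) = num_tapes M"
    "j < num_tapes M \<Longrightarrow> fst (snd (trans q ss) ! j) < num_symbols M"
proof -
  have "fst (trans q ss) \<le> num_states M \<and> length (snd (trans q ss)) = num_tapes M \<and>
      fst ` set (snd (trans q ss)) \<subseteq> {..<num_symbols M}"
  proof (cases "q < num_states M")
    case True
    then show ?thesis
      using well_formed assms unfolding well_formed_def trans_def by (auto simp: case_prod_unfold)
  next
    case False
    then show ?thesis
      using assms by (auto simp: trans_def)
  qed
  then show "fst (trans q ss) \<le> num_states M" "length (snd (trans q ss)) = num_tapes M"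
    "j < num_tapes M \<Longrightarrow> fst (snd (trans q ss) ! j) < num_symbols M"
    by (auto simp: subset_iff image_iff) (metis lessThan_iff nth_mem)
qed

lemma args_nth:
  assumes "a < length args"
  shows "src a \<le> num_states M" "length (snd (args ! a)) = num_tapes M"
    "set (snd (args ! a)) \<subseteq> {..<num_symbols M}"
proof -
  have "args ! a \<in> set args" using assms by simp
  then show "src a \<le> num_states M" "length (snd (args ! a)) = num_tapes M"
    "set (snd (args ! a)) \<subseteq> {..<num_symbols M}"
    by (auto simp: args_def src_def set_n_lists)
qed

lemma args_ex:
  assumes "q \<le> num_states M" "length ss = num_tapes M" "set ss \<subseteq> {..<num_symbols M}"
  shows "\<exists>a < length args. args ! a = (q, ss)"
proof -
  have "(q, ss) \<in> set args"
    using assms by (auto simp: args_def set_n_lists)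
  then show ?thesis by (simp add: in_set_conv_nth)
qed

lemma distinct_args: "distinct args"
  unfolding args_def by (intro distinct_product distinct_n_lists) simp_all

lemma shift_code: "nat (shift d + 1) \<le> 2" "int (nat (shift d + 1)) = shift d + 1"
  by (cases d; simp)+

lemma tableau_machine:
  assumes "0 < T"
  shows "tableau (num_tapes M) (length args) (num_states M) (num_symbols M) T src dst rd wr mv"
proof
  show "3 \<le> num_symbols M"
    using well_formed by (simp add: well_formed_def)
  fix a assume a: "a < length args"
  note nth = args_nth [OF a]
  show "src a \<le> num_states M" "dst a \<le> num_states M"
    using nth trans_wf(1) [OF nth] by (simp_all add: dst_def)
  fix j assume j: "j < num_tapes M"
  show "rd a j < num_symbols M"
    using nth j by (auto simp: rd_def subset_iff)
  show "wr a j < num_symbols M" "mv a j \<le> 2"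
    using trans_wf(3) [OF nth j] shift_code by (simp_all add: wr_def mv_def)
next
  fix a a' assume a: "a < length args" "a' < length args" and eq: "src a = src a'" "\<And>j. j < num_tapes M \<Longrightarrow> rd a j = rd a' j"
  have "snd (args ! a) = snd (args ! a')"
    using args_nth(2) a eq(2) by (intro nth_equalityI) (simp_all add: rd_def)
  then have "args ! a = args ! a'"
    using eq(1) by (simp add: src_def prod_eq_iff)
  then show "a = a'"
    using a distinct_args by (simp add: nth_eq_iff_index_eq)
qed (use assms two_tapes in auto)

section \<open>Computations of the verifier as runs of the tableau\<close>

lemma step_trans:
  assumes "length tps = num_tapes M"
  shows "step M (q, tps) = (fst (trans q (map scanned tps)), map2 update_tape tps (snd (trans q (map scanned tps))))"
proof (cases "q < num_states M")
  case False
  have "update_tape tp (scanned tp, Stay) = tp" for tp :: tape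
    by (cases tp) simp
  then have "map2 update_tape tps (map (\<lambda>s. (s, Stay)) (map scanned tps)) = tps"
    by (intro nth_equalityI) simp_all
  then show ?thesis
    using False by (simp add: trans_def)
qed (simp add: trans_def case_prod_unfold Let_def)

lemma set_map_scanned:
  assumes "\<And>j. j < length tps \<Longrightarrow> scanned (tps ! j) < g"
  shows "set (map scanned tps) \<subseteq> {..<g}"
proof
  fix s assume "s \<in> set (map scanned tps)"
  then obtain j where "j < length tps" "s = scanned (tps ! j)"
    by (metis in_set_conv_nth length_map nth_map)
  then show "s \<in> {..<g}" using assms by simp
qed

definition config :: "bool list \<Rightarrow> bool list \<Rightarrow> nat \<Rightarrow> config" where
  "config x u t = (step M ^^ t) (initial_config M [x, u])"

lemma config_Suc: "config x u (Suc t) = step M (config x u t)"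
  by (simp add: config_def del: step.simps)

lemma config_wf:
  "fst (config x u t) \<le> num_states M \<and> length (snd (config x u t)) = num_tapes M \<and>
     (\<forall>j < num_tapes M. (\<forall>i. fst (snd (config x u t) ! j) i < num_symbols M) \<and>
        \<bar>snd (snd (config x u t) ! j)\<bar> \<le> int t)"
proof (induction t)
  case 0
  have "contents w i < num_symbols M" for w i
    using well_formed by (simp add: contents_def well_formed_def)
  then show ?case
    by (auto simp: config_def initial_config_def)
next
  case (Suc t)
  obtain q tps where qt: "config x u t = (q, tps)" by fastforce
  let ?ss = "map scanned tps"
  have l: "length tps = num_tapes M" and q: "q \<le> num_states M"
    using Suc qt by auto
  have "scanned (tps ! j) < num_symbols M" if "j < num_tapes M" for j
    using Suc that by (cases "tps ! j") (auto simp: qt)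
  then have ss: "set ?ss \<subseteq> {..<num_symbols M}"
    using l by (intro set_map_scanned) simp
  have lss: "length ?ss = num_tapes M"
    using l by simp
  note wf = trans_wf [OF q lss ss]
  have "(\<forall>i. fst (map2 update_tape tps (snd (trans q ?ss)) ! j) i < num_symbols M) \<and>
      \<bar>snd (map2 update_tape tps (snd (trans q ?ss)) ! j)\<bar> \<le> int (Suc t)" if j: "j < num_tapes M" for j
  proof -
    obtain s d where sd: "snd (trans q ?ss) ! j = (s, d)" by fastforce
    obtain c i where ci: "tps ! j = (c, i)" by fastforce
    have "\<bar>shift d\<bar> \<le> 1" by (cases d) simp_all
    moreover have "\<forall>i. c i < num_symbols M" "\<bar>i\<bar> \<le> int t"
      using Suc j ci by (auto simp: qt)
    ultimately show ?thesis
      using wf(3) [OF j] wf(2) l j sd ci by auto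
  qed
  then show ?case
    unfolding config_Suc qt step_trans [OF l] using wf l by simp
qed

definition bound :: "bool list \<Rightarrow> nat" where
  "bound x = poly p (length x)"

text \<open>Enough for every admissible certificate; the successor makes the number of steps
  positive.\<close>

definition time :: "bool list \<Rightarrow> nat" where
  "time x = Suc (poly r (length x + bound x))"

lemma generator_machine:
  "generator (num_tapes M) (length args) (num_states M) (num_symbols M) src dst rd wr mv time bound"
proof (rule generator.intro)
  show "tableau (num_tapes M) (length args) (num_states M) (num_symbols M) (time x) src dst rd wr mv" for x
    by (rule tableau_machine) (simp add: time_def)
  show "computes n (\<lambda>x e. bound x)" for n
    unfolding bound_def by (intro computes_poly computes_length)
  then show "computes n (\<lambda>x e. time x)" for n
    unfolding time_def by (intro computes_Suc computes_poly computes_add computes_length)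
qed

sublocale gen: generator "num_tapes M" "length args" "num_states M" "num_symbols M" src dst rd wr mv time bound
  by (rule generator_machine)

text \<open>A halted configuration no longer changes, so at \<open>time x\<close> the first output
  cell still shows the answer, True being the symbol 2.\<close>

lemma config_halted:
  assumes "length u \<le> bound x"
  shows "fst (snd (config x u (time x)) ! 0) 0 = 2 \<longleftrightarrow> R x u"
proof -
  obtain t where t: "t \<le> poly r (length x + length u)" "halts_with_output M [x, u] t [R x u]"
    using halts by blast
  have "poly r (length x + length u) \<le> time x"
    using assms poly_mono_nat [of "length x + length u" "length x + bound x" r] by (simp add: time_def)
  then obtain d where d: "time x = d + t"
    using t(1) by (metis le_trans le_iff_add add.commute)
  have out: "fst (config x u t) = num_states M" "fst (snd (config x u t) ! 0) = contents [R x u]"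
    using t(2) by (auto simp: halts_with_output_def config_def)
  have "config x u (d + t) = config x u t" for d
  proof (induction d)
    case (Suc d)
    then show ?case
      using out(1) by (cases "config x u t") (simp add: config_Suc)
  qed simp
  then show ?thesis
    using out(2) d by (simp add: contents_def)
qed

lemma run_exists:
  assumes u: "length u \<le> bound x"
  shows "\<exists>q act c h. gen.tab.run x u q act c h \<and> (c (time x) 0 (gen.tab.org x) = 2 \<longleftrightarrow> R x u)"
proof -
  let ?o = "Suc (time x)"
  define q where "q t = fst (config x u t)" for t
  define tps where "tps t = snd (config x u t)" for t
  \<comment> \<open>Cells are renumbered with cell 0 at \<open>?o\<close>; since heads move at most
    one cell per step, natural numbers suffice.\<close>
  define c where "c t j i = fst (tps t ! j) (int i - int ?o)" for t j i
  define h where "h t j = nat (snd (tps t ! j) + int ?o)" for t j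
  define act where "act t = (SOME a. a < length args \<and> args ! a = (q t, map scanned (tps t)))" for t
  have wf: "q t \<le> num_states M" "length (tps t) = num_tapes M"
    "\<And>j i. j < num_tapes M \<Longrightarrow> fst (tps t ! j) i < num_symbols M"
    "\<And>j. j < num_tapes M \<Longrightarrow> \<bar>snd (tps t ! j)\<bar> \<le> int t" for t
    using config_wf [of x u t] by (auto simp: q_def tps_def)
  have scan: "scanned (tps t ! j) = fst (tps t ! j) (snd (tps t ! j))" for t j
    by (cases "tps t ! j") simp
  have lss: "length (map scanned (tps t)) = num_tapes M" for t
    using wf(2) by simp
  have ss: "set (map scanned (tps t)) \<subseteq> {..<num_symbols M}" for t
    by (rule set_map_scanned) (use wf(2,3) scan in simp)
  have act: "act t < length args" "args ! act t = (q t, map scanned (tps t))" for t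
    using someI_ex [OF args_ex [OF wf(1) lss ss], of t t] by (auto simp: act_def)
  have succ: "q (Suc t) = fst (trans (q t) (map scanned (tps t)))"
    "tps (Suc t) = map2 update_tape (tps t) (snd (trans (q t) (map scanned (tps t))))" for t
    using step_trans [OF wf(2) [of t], of "q t"] by (simp_all add: q_def tps_def config_Suc)
  have h: "int (h t j) = snd (tps t ! j) + int ?o" if "j < num_tapes M" "t \<le> ?o" for t j
    using wf(4) [OF that(1), of t] that(2) by (simp add: h_def)
  have step: "rd (act t) j = c t j (h t j) \<and> Suc (h (Suc t) j) = h t j + mv (act t) j \<and>
      (\<forall>i. c (Suc t) j i = (if i = h t j then wr (act t) j else c t j i))" if j: "j < num_tapes M" and t: "t < time x" for t j
  proof -
    let ?as = "snd (trans (q t) (map scanned (tps t)))"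
    have las: "length ?as = num_tapes M"
      by (rule trans_wf(2) [OF wf(1) lss ss])
    have eqs: "wr (act t) j = fst (?as ! j)" "mv (act t) j = nat (shift (snd (?as ! j)) + 1)"
      by (simp_all add: wr_def mv_def src_def act)
    obtain f i where fi: "tps t ! j = (f, i)" by fastforce
    obtain s d where sd: "?as ! j = (s, d)" by fastforce
    have next': "tps (Suc t) ! j = (f(i := s), i + shift d)"
      using fi sd las wf(2) j by (simp add: succ)
    have hi: "int (h t j) = i + int ?o" "int (h (Suc t) j) = i + shift d + int ?o"
      using h [OF j, of t] h [OF j, of "Suc t"] t fi next' by simp_all
    have "rd (act t) j = f i"
      using wf(2) j fi by (simp add: rd_def act)
    moreover have "c t j (h t j) = f i"
      unfolding c_def hi fi by simp
    moreover have "int (Suc (h (Suc t) j)) = int (h t j + mv (act t) j)"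
      using hi shift_code(2) [of d] eqs sd by simp
    moreover have "c (Suc t) j i' = (if i' = h t j then s else c t j i')" for i'
    proof -
      have "int i' - int ?o = i \<longleftrightarrow> i' = h t j"
        using hi(1) by linarith
      then show ?thesis
        unfolding c_def next' fi by simp
    qed
    ultimately show ?thesis
      using eqs sd by (simp del: of_nat_Suc of_nat_add)
  qed
  have init: "tps 0 ! j = (contents (if j < 2 then [x, u] ! j else []), 0)" if "j < num_tapes M" for j
    using that by (simp add: tps_def config_def initial_config_def)
  have c0: "c 0 j i = gen.tab.init x u j i" if "j < num_tapes M" for j i
  proof -
    have shifted: "contents w (int i - int ?o) = (if i < ?o then 0 else contents w (int (i - ?o)))" for w
      by (simp add: contents_def of_nat_diff)
    have Nil: "contents [] i' = 0" for i'
      by (simp add: contents_def)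
    show ?thesis
      unfolding c_def init [OF that] gen.tab.init_def fst_conv shifted
      by (auto simp: Nil less_2_cases_iff)
  qed
  have h0: "h 0 j = ?o" if "j < num_tapes M" for j
    using init [OF that] by (simp add: h_def)
  have q0: "q 0 = 0"
    by (simp add: q_def config_def initial_config_def)
  have "gen.tab.run x u q act c h"
    unfolding gen.tab.run_def
  proof (intro conjI allI impI)
    show "act t < length args" "src (act t) = q t" "q (Suc t) = dst (act t)" for t
      using act [of t] by (simp_all add: src_def dst_def succ)
  qed (use q0 h0 c0 step in blast)+
  moreover have "c (time x) 0 ?o = 2 \<longleftrightarrow> R x u"
    using config_halted [OF u] by (simp add: c_def tps_def)
  ultimately show ?thesis by blast
qed

definition equation :: "bool list \<Rightarrow> bool list" where
  "equation x = encode_equation (gen.tab.num_rows x) (gen.tab.equation_words x)"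

lemma equation_correct:
  "equation x \<in> spherical_problem \<longleftrightarrow> (\<exists>u. length u \<le> poly p (length x) \<and> R x u)"
  unfolding equation_def gen.tab.equation_solvable_iff bound_def [symmetric]
  by (rule gen.tab.solution_iff) (rule run_exists)

lemma equation_computable: "poly_time_computable 1 (\<lambda>xs. equation (xs ! 0))"
  unfolding equation_def by (rule emits_poly_time_computable) (rule gen.emits_equation)

end

theorem corollary5p8:
  shows "NP_hard spherical_problem"
  unfolding NP_hard_def
proof
  fix L assume "L \<in> NP"
  then obtain R p where R: "poly_time_computable 2 (\<lambda>xs. [R (xs ! 0) (xs ! 1)])"
    and L: "\<And>x. x \<in> L \<longleftrightarrow> (\<exists>u. length u \<le> poly p (length x) \<and> R x u)"
    unfolding NP_def by blast
  from R obtain M r where M: "well_formed M" "2 \<le> num_tapes M"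
    and halts: "\<And>xs. length xs = 2 \<Longrightarrow>
      \<exists>t \<le> poly r (sum_list (map length xs)). halts_with_output M xs t [R (xs ! 0) (xs ! 1)]"
    unfolding poly_time_computable_def by blast
  interpret verifier M R p r
  proof
    show "\<exists>t \<le> poly r (length x + length u). halts_with_output M [x, u] t [R x u]" for x u
      using halts [of "[x, u]"] by simp
  qed (use M in auto)
  show "poly_time_reducible L spherical_problem"
    unfolding poly_time_reducible_def using equation_computable equation_correct L by blast
qed

end
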